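(* Let $a_n$ ($n\in\mathbb{Z}$) and $b_m$ ($m\in\mathbb{Z}$) be non-zero real numbers with $a_n\ne b_m$, let $N\in\mathbb{Z}_{\ge0}$, and let $p_i,\alpha_i,\beta_i$ ($i=1,\dots,N$) be complex constants with $p_i\ne0$, $1\pm a_np_i\ne0$, $1\pm b_mp_i\neq0$ for all $n,m,i$. For $(x,t,y)\in\mathbb{R}^3$, $(m,n)\in\mathbb{Z}^2$, consider the $\tau$ function $$\tau_n^m=\exp\left[-\left(x+\sum_{n'}^{n-1}a_{n'}+\sum_{m'}^{m-1}b_{m'}\right)y\right]\det\left(f_{j-1}^{(i)}\right)_{i,j=1,\dots,N},\qquad f_s^{(i)}=e^{\eta_i}+e^{\mu_i},$$ $$e^{\eta_i}=\alpha_ip_i^s\prod_{n'}^{n-1}(1-a_{n'}p_i)^{-1}\prod_{m'}^{m-1}(1-b_{m'}p_i)^{-1}\,e^{p_ix-4p_i^3t+\frac1{p_i}y},$$ $$e^{\mu_i}=\beta_i(-p_i)^s\prod_{n'}^{n-1}(1+a_{n'}p_i)^{-1}\prod_{m'}^{m-1}(1+b_{m'}p_i)^{-1}\,e^{-p_ix+4p_i^3t-\frac1{p_i}y}.$$ (1) If $p_i,\alpha_i\in\mathbb{R}$ and $\beta_i\in\sqrt{-1}\,\mathbb{R}$ ($i=1,\dots,N$), then $\tau_n^m$ satisfies the bilinear equations $$\tfrac12 D_xD_y\,\tau_n^m\cdot\tau_n^m=-(\tau^{*m}_{n})^2,\qquad D_x^2\,\tau_n^m\cdot\tau^{*m}_{n}=0,\qquad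 (D_x^3+D_t)\,\tau_n^m\cdot\tau^{*m}_{n}=0,$$ $$D_y\,\tau_{n+1}^m\cdot\tau_n^m=-a_n\,\tau^{*m}_{n+1}\tau^{*m}_{n},\qquad D_y\,\tau_{n}^{m+1}\cdot\tau_n^m=-b_m\,\tau^{*\,m+1}_{n}\tau^{*m}_{n},$$ $$b_m\,\tau^{*\,m+1}_{n}\tau_{n+1}^m-a_n\,\tau^{*m}_{n+1}\tau_n^{m+1}+(a_n-b_m)\,\tau^{*\,m+1}_{n+1}\tau_n^m=0 ,$$ and thereby gives (the $N$-soliton) solution $\Theta_n^m=\frac{2}{\sqrt{-1}}\log\frac{\tau_n^m}{\tau^{*m}_n}$ (where $\tau$ does not vanish) to the potential mKdV equation $$\theta_t+\tfrac12(\theta_x)^3+\theta_{xxx}=0\qquad(\theta=\Theta_n^m)$$ and to the discrete potential mKdV equation $$\tan\left(\frac{\Theta_{n+1}^{m+1}-\Theta_n^m}{4}\right)=\frac{b_m+a_n}{b_m-a_n}\tan\left(\frac{\Theta_n^{m+1}-\Theta_{n+1}^m}{4}\right).$$ (2) If $N=2M$ and $p_{2k}=p_{2k-1}^*$, $\alpha_{2k}=\alpha_{2k-1}^*$, $\beta_{2k}=-\beta_{2k-1}^*$ for $k=1,\dots,M$ (with $p_i,\alpha_i,\beta_i\in\mathbb{C}$), then $\tau_n^m$ satisfies the same six bilinear equations, and likewise gives (the $M$-breather) solution $\Theta_n^m=\frac{2}{\sqrt{-1}}\log\frac{\tau_n^m}{\tau^{*m}_n}$ to the potential mKdV and the discrete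 potential mKdV equations.
   Context: ${}^*$ denotes complex conjugation, so $\tau^{*m}_n$ is the complex conjugate of $\tau_n^m$. For $N=0$ the determinant is set equal to $1$. Hirota's operators are $$D_x^iD_y^jD_t^k\,f\cdot g=\left.(\partial_x-\partial_{x'})^i(\partial_y-\partial_{y'})^j(\partial_t-\partial_{t'})^k f(x,y,t)\,g(x',y',t')\right|_{x'=x,\,y'=y,\,t'=t}.$$ $\sum_{n'}^{n-1}$ and $\prod_{n'}^{n-1}$ are sums and products from a fixed base point (say $0$), extended to all $n\in\mathbb{Z}$ so that $F(n+1)-F(n)=a_n$ for $F(n)=\sum_{n'}^{n-1}a_{n'}$, and $G(n+1)=G(n)(1\mp a_np_i)^{-1}$ for $G(n)=\prod_{n'}^{n-1}(1\mp a_{n'}p_i)^{-1}$ (value $0$, resp. $1$, at the base point); similarly for $m$ and $b_m$. $\Theta_n^m$ uses a locally smooth branch of the logarithm, so it is real with $e^{\sqrt{-1}\Theta_n^m/2}=\tau_n^m/\tau^{*m}_n$. An equation $\tan\alpha=\frac{p+q}{p-q}\tan\beta$ with $p\ne q$ is understood in the cross-multiplied form $(p-q)\sin\alpha\cos\beta=(p+q)\cos\alpha\sin\beta$ if a tangent is undefined. *)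

theory Defs
  imports "HOL-Analysis.Analysis" "Jordan_Normal_Form.Determinant"
begin

text \<open>Sums and products from the base point 0 up to \<open>n - 1\<close>, continued to negative \<open>n\<close> so that
  the recursions \<open>intsum_step\<close> and \<open>intprod_step\<close> hold on all of the integers.\<close>

definition intsum :: "(int \<Rightarrow> real) \<Rightarrow> int \<Rightarrow> real" where
  "intsum a n = (if 0 \<le> n then (\<Sum>k\<in>{0..<n}. a k) else - (\<Sum>k\<in>{n..<0}. a k))"

definition intprod :: "(int \<Rightarrow> complex) \<Rightarrow> int \<Rightarrow> complex" where
  "intprod g n = (if 0 \<le> n then (\<Prod>k\<in>{0..<n}. g k) else inverse (\<Prod>k\<in>{n..<0}. g k))"

lemma intsum_0: "intsum a 0 = 0"
  by (simp add: intsum_def)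

lemma intprod_0: "intprod g 0 = 1"
  by (simp add: intprod_def)

lemma intsum_step: "intsum a (n + 1) - intsum a n = a n"
proof (cases "0 \<le> n")
  case True
  then have "{0..<n + 1} = insert n {0..<n}" by auto
  with True show ?thesis by (simp add: intsum_def)
next
  case False
  then have "{n..<0} = insert n {n + 1..<0}" by auto
  with False show ?thesis by (cases "n = -1") (auto simp: intsum_def)
qed

lemma intprod_step:
  assumes "g n \<noteq> 0"
  shows "intprod g (n + 1) = intprod g n * g n"
proof (cases "0 \<le> n")
  case True
  then have "{0..<n + 1} = insert n {0..<n}" by auto
  with True show ?thesis by (simp add: intprod_def)
next
  case False
  then have "{n..<0} = insert n {n + 1..<0}" by auto
  with False assms show ?thesis by (cases "n = -1") (auto simp: intprod_def)
qed

text \<open>In the following, \<open>p\<close>, \<open>\<alpha>\<close>, \<open>\<beta>\<close> are indexed by 1, ..., N.  Functions of the lattice point and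
  of the continuous variables take their arguments in the order \<open>n m x y t\<close>.\<close>

definition e_eta ::
  "(int \<Rightarrow> real) \<Rightarrow> (int \<Rightarrow> real) \<Rightarrow> (nat \<Rightarrow> complex) \<Rightarrow> (nat \<Rightarrow> complex) \<Rightarrow> nat \<Rightarrow> nat \<Rightarrow>
   int \<Rightarrow> int \<Rightarrow> real \<Rightarrow> real \<Rightarrow> real \<Rightarrow> complex" where
  "e_eta a b p \<alpha> i s n m x y t =
     \<alpha> i * p i ^ s
     * intprod (\<lambda>k. inverse (1 - of_real (a k) * p i)) n
     * intprod (\<lambda>k. inverse (1 - of_real (b k) * p i)) m
     * exp (p i * of_real x - 4 * p i ^ 3 * of_real t + 1 / p i * of_real y)"

definition e_mu ::
  "(int \<Rightarrow> real) \<Rightarrow> (int \<Rightarrow> real) \<Rightarrow> (nat \<Rightarrow> complex) \<Rightarrow> (nat \<Rightarrow> complex) \<Rightarrow> nat \<Rightarrow> nat \<Rightarrow>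
   int \<Rightarrow> int \<Rightarrow> real \<Rightarrow> real \<Rightarrow> real \<Rightarrow> complex" where
  "e_mu a b p \<beta> i s n m x y t =
     \<beta> i * (- p i) ^ s
     * intprod (\<lambda>k. inverse (1 + of_real (a k) * p i)) n
     * intprod (\<lambda>k. inverse (1 + of_real (b k) * p i)) m
     * exp (- p i * of_real x + 4 * p i ^ 3 * of_real t - 1 / p i * of_real y)"

text \<open>Matrices of \<open>Jordan_Normal_Form\<close> are indexed from 0: the entry in row \<open>i + 1\<close> and column
  \<open>j + 1\<close> belongs to the parameters with index \<open>i + 1\<close> and has \<open>s = j\<close>.  The determinant of the
  0 by 0 matrix is 1.\<close>

definition tau ::
  "(int \<Rightarrow> real) \<Rightarrow> (int \<Rightarrow> real) \<Rightarrow> nat \<Rightarrow> (nat \<Rightarrow> complex) \<Rightarrow> (nat \<Rightarrow> complex) \<Rightarrow> (nat \<Rightarrow> complex) \<Rightarrow>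
   int \<Rightarrow> int \<Rightarrow> real \<Rightarrow> real \<Rightarrow> real \<Rightarrow> complex" where
  "tau a b N p \<alpha> \<beta> n m x y t =
     exp (- of_real ((x + intsum a n + intsum b m) * y))
     * Determinant.det (Matrix.mat N N (\<lambda>(i, j).
         e_eta a b p \<alpha> (i + 1) j n m x y t + e_mu a b p \<beta> (i + 1) j n m x y t))"

text \<open>The operators \<open>\<partial>\<^sub>x - \<partial>\<^sub>x\<^sub>'\<close> etc. on functions of \<open>(x, y, t, x', y', t')\<close>.  As \<open>hirota\<close> below uses the
  total function \<open>vector_derivative\<close>, it is only meaningful for sufficiently differentiable
  functions such as \<open>tau\<close>.\<close>

type_synonym fun6 = "real \<Rightarrow> real \<Rightarrow> real \<Rightarrow> real \<Rightarrow> real \<Rightarrow> real \<Rightarrow> complex"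

definition hirota_x :: "fun6 \<Rightarrow> fun6" where
  "hirota_x F = (\<lambda>x y t x' y' t'.
     vector_derivative (\<lambda>\<xi>. F \<xi> y t x' y' t') (at x) - vector_derivative (\<lambda>\<xi>. F x y t \<xi> y' t') (at x'))"

definition hirota_y :: "fun6 \<Rightarrow> fun6" where
  "hirota_y F = (\<lambda>x y t x' y' t'.
     vector_derivative (\<lambda>\<xi>. F x \<xi> t x' y' t') (at y) - vector_derivative (\<lambda>\<xi>. F x y t x' \<xi> t') (at y'))"

definition hirota_t :: "fun6 \<Rightarrow> fun6" where
  "hirota_t F = (\<lambda>x y t x' y' t'.
     vector_derivative (\<lambda>\<xi>. F x y \<xi> x' y' t') (at t) - vector_derivative (\<lambda>\<xi>. F x y t x' y' \<xi>) (at t'))"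

text \<open>\<open>hirota i j k f g\<close> is \<open>D\<^sub>x\<^sup>i D\<^sub>y\<^sup>j D\<^sub>t\<^sup>k f \<cdot> g\<close>.\<close>

definition hirota :: "nat \<Rightarrow> nat \<Rightarrow> nat \<Rightarrow> (real \<Rightarrow> real \<Rightarrow> real \<Rightarrow> complex) \<Rightarrow>
    (real \<Rightarrow> real \<Rightarrow> real \<Rightarrow> complex) \<Rightarrow> real \<Rightarrow> real \<Rightarrow> real \<Rightarrow> complex" where
  "hirota i j k f g x y t =
     (hirota_x ^^ i) ((hirota_y ^^ j) ((hirota_t ^^ k) (\<lambda>x y t x' y' t'. f x y t * g x' y' t')))
       x y t x y t"

definition conj_fun :: "(real \<Rightarrow> real \<Rightarrow> real \<Rightarrow> complex) \<Rightarrow> real \<Rightarrow> real \<Rightarrow> real \<Rightarrow> complex" where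
  "conj_fun f x y t = cnj (f x y t)"

definition bilinear_equations ::
  "(int \<Rightarrow> real) \<Rightarrow> (int \<Rightarrow> real) \<Rightarrow> (int \<Rightarrow> int \<Rightarrow> real \<Rightarrow> real \<Rightarrow> real \<Rightarrow> complex) \<Rightarrow> bool" where
  "bilinear_equations a b T \<longleftrightarrow> (\<forall>n m x y t.
     1/2 * hirota 1 1 0 (T n m) (T n m) x y t = - (cnj (T n m x y t))\<^sup>2 \<and>
     hirota 2 0 0 (T n m) (conj_fun (T n m)) x y t = 0 \<and>
     hirota 3 0 0 (T n m) (conj_fun (T n m)) x y t
       + hirota 0 0 1 (T n m) (conj_fun (T n m)) x y t = 0 \<and>
     hirota 0 1 0 (T (n + 1) m) (T n m) x y t
       = - of_real (a n) * cnj (T (n + 1) m x y t) * cnj (T n m x y t) \<and>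
     hirota 0 1 0 (T n (m + 1)) (T n m) x y t
       = - of_real (b m) * cnj (T n (m + 1) x y t) * cnj (T n m x y t) \<and>
     of_real (b m) * cnj (T n (m + 1) x y t) * T (n + 1) m x y t
       - of_real (a n) * cnj (T (n + 1) m x y t) * T n (m + 1) x y t
       + of_real (a n - b m) * cnj (T (n + 1) (m + 1) x y t) * T n m x y t = 0)"

text \<open>\<open>\<theta>\<close> is, on the open set \<open>U\<close> of points \<open>(x, y, t)\<close>, a real function of the form
  \<open>(2 / \<i>) log (f / f\<^sup>*)\<close>, where near each point a holomorphic branch \<open>L\<close> of the logarithm is
  used.  Any two branches differ locally by a multiple of \<open>4 \<pi>\<close>.\<close>

definition theta_branch ::
  "(real \<Rightarrow> real \<Rightarrow> real \<Rightarrow> complex) \<Rightarrow> (real \<times> real \<times> real) set \<Rightarrow>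
   (real \<Rightarrow> real \<Rightarrow> real \<Rightarrow> real) \<Rightarrow> bool" where
  "theta_branch f U \<theta> \<longleftrightarrow> open U \<and> (\<forall>(x, y, t)\<in>U. f x y t \<noteq> 0) \<and>
     (\<forall>P\<in>U. \<exists>W V L. open W \<and> P \<in> W \<and> W \<subseteq> U \<and>
        open V \<and> L holomorphic_on V \<and> (\<forall>z\<in>V. exp (L z) = z) \<and>
        (\<forall>(x, y, t)\<in>W. f x y t / cnj (f x y t) \<in> V \<and>
           complex_of_real (\<theta> x y t) = 2 / \<i> * L (f x y t / cnj (f x y t))))"

definition potential_mKdV_on ::
  "(real \<times> real \<times> real) set \<Rightarrow> (real \<Rightarrow> real \<Rightarrow> real \<Rightarrow> real) \<Rightarrow> bool" where
  "potential_mKdV_on U \<theta> \<longleftrightarrow> (\<exists>\<theta>t \<theta>x \<theta>xx \<theta>xxx. \<forall>(x, y, t)\<in>U.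
     ((\<lambda>\<tau>. \<theta> x y \<tau>) has_real_derivative \<theta>t x y t) (at t) \<and>
     ((\<lambda>\<xi>. \<theta> \<xi> y t) has_real_derivative \<theta>x x y t) (at x) \<and>
     ((\<lambda>\<xi>. \<theta>x \<xi> y t) has_real_derivative \<theta>xx x y t) (at x) \<and>
     ((\<lambda>\<xi>. \<theta>xx \<xi> y t) has_real_derivative \<theta>xxx x y t) (at x) \<and>
     \<theta>t x y t + 1/2 * (\<theta>x x y t) ^ 3 + \<theta>xxx x y t = 0)"

text \<open>The equation \<open>tan A = (p + q) / (p - q) * tan B\<close>, cross-multiplied if a tangent is undefined.\<close>

definition tan_equation :: "real \<Rightarrow> real \<Rightarrow> real \<Rightarrow> real \<Rightarrow> bool" where
  "tan_equation p q A B \<longleftrightarrow>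
     (if cos A \<noteq> 0 \<and> cos B \<noteq> 0 then tan A = (p + q) / (p - q) * tan B
      else (p - q) * sin A * cos B = (p + q) * cos A * sin B)"

definition discrete_potential_mKdV ::
  "(int \<Rightarrow> real) \<Rightarrow> (int \<Rightarrow> real) \<Rightarrow> (int \<Rightarrow> int \<Rightarrow> (real \<times> real \<times> real) set) \<Rightarrow>
   (int \<Rightarrow> int \<Rightarrow> real \<Rightarrow> real \<Rightarrow> real \<Rightarrow> real) \<Rightarrow> bool" where
  "discrete_potential_mKdV a b U \<Theta> \<longleftrightarrow> (\<forall>n m x y t.
     (x, y, t) \<in> U n m \<inter> U (n + 1) m \<inter> U n (m + 1) \<inter> U (n + 1) (m + 1) \<longrightarrow>
     tan_equation (b m) (a n)
       ((\<Theta> (n + 1) (m + 1) x y t - \<Theta> n m x y t) / 4)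
       ((\<Theta> n (m + 1) x y t - \<Theta> (n + 1) m x y t) / 4))"

text \<open>Near every point where it does not vanish, \<open>T n m\<close> has a branch \<open>\<Theta> n m\<close>, and every choice of
  branches (on arbitrary open sets, independently at each lattice point) solves both equations.\<close>

definition gives_mKdV_solutions ::
  "(int \<Rightarrow> real) \<Rightarrow> (int \<Rightarrow> real) \<Rightarrow> (int \<Rightarrow> int \<Rightarrow> real \<Rightarrow> real \<Rightarrow> real \<Rightarrow> complex) \<Rightarrow> bool" where
  "gives_mKdV_solutions a b T \<longleftrightarrow>
     (\<forall>n m x y t. T n m x y t \<noteq> 0 \<longrightarrow> (\<exists>U \<theta>. (x, y, t) \<in> U \<and> theta_branch (T n m) U \<theta>)) \<and>
     (\<forall>U \<Theta>. (\<forall>n m. theta_branch (T n m) (U n m) (\<Theta> n m)) \<longrightarrow>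
        (\<forall>n m. potential_mKdV_on (U n m) (\<Theta> n m)) \<and>
        discrete_potential_mKdV a b U \<Theta>)"

end

theory Submission
  imports Defs
begin

text \<open>
Up to an exponential factor, \<open>\<tau>\<close> is the determinant of the matrix \<open>M\<close> with entries
\<open>A\<^sub>i p\<^sub>i\<^sup>j + B\<^sub>i (- p\<^sub>i)\<^sup>j\<close>.  Then \<open>M\<^sub>x\<^sub>x = \<Lambda> M\<close> with \<open>\<Lambda> = diag(p\<^sub>i\<^sup>2)\<close>, so \<open>K = M\<^sub>x M\<^sup>-\<^sup>1\<close> satisfies
\<open>K\<^sub>x = \<Lambda> - K\<^sup>2\<close> and the logarithmic derivatives of \<open>\<tau>\<close> are traces of polynomials in \<open>K\<close> and \<open>\<Lambda>\<close>.
A lattice step multiplies \<open>M\<close> by \<open>1 - a K\<close>, and under the reality conditions the conjugate of \<open>\<tau>\<close> is,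
up to a constant, \<open>det M\<^sub>x = det K det M\<close>.  As \<open>M\<^sub>x\<close> is \<open>M\<close> with its columns shifted by one,
\<open>K\<^sup>2 - \<Lambda>\<close> has rank one.  Every bilinear equation is an instance of \<open>X\<^sup>2 = (tr X) X\<close> or
\<open>det (1 + X) = 1 + tr X\<close> for a matrix \<open>X\<close> of rank one.  This needs \<open>M\<close>, \<open>M\<^sub>x\<close> and \<open>1 - a K\<close> to be
invertible; the general case follows by continuity in \<open>p\<close>, \<open>A\<close>, \<open>B\<close>.  The equations for \<open>\<Theta>\<close> are the
bilinear ones divided by products of \<open>\<tau>\<close> and its conjugate.
\<close>

section \<open>Matrices of rank one\<close>

text \<open>The deformation to generic parameters does not respect the reality conditions. Hence
  every determinant identity is proved for arbitrary complex amplitudes \<open>A\<close>,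
  \<open>B\<close>, with the determinant for \<open>A\<close>, \<open>- B\<close> in the role of the
  conjugate of tau; conjugation itself enters only at the end. The link with det M_x is that row i
  of M_x carries the amplitudes p_i (A_i, - B_i). Lattice steps are taken downwards: from n + 1 to
  n, A_i is multiplied by 1 - a p_i and B_i by 1 + a p_i, so no denominators appear. The exponential
  factor of tau accounts for the 1 in det (1 + X) = 1 + tr X: it contributes - tau^2 to half of D_x
  D_y, and - a_n times the product of the two neighbours to D_y across a lattice step. What is left
  are the squares and products of conjugates on the right-hand sides. K and Lambda do not commute in
  general, so the equations with x- and t-derivatives are reduced to traces, where cyclicity is
  available.\<close>

lemma nonsingular_inverse:
  fixes G :: "complex Matrix.mat"
  assumes G: "G \<in> carrier_mat N N" and "Determinant.det G \<noteq> 0"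
  obtains H where "H \<in> carrier_mat N N" "G * H = 1\<^sub>m N" "H * G = 1\<^sub>m N"
proof
  let ?H = "inverse (Determinant.det G) \<cdot>\<^sub>m adj_mat G"
  note adj = adj_mat[OF G]
  show "?H \<in> carrier_mat N N" using adj by simp
  show "G * ?H = 1\<^sub>m N"
    using adj assms by (simp add: mult_smult_distrib[of _ N N _ N]) (auto intro!: eq_matI)
  show "?H * G = 1\<^sub>m N"
    using adj assms by (simp add: mult_smult_assoc_mat[of _ N N _ N]) (auto intro!: eq_matI)
qed

definition mtrace :: "complex Matrix.mat \<Rightarrow> complex" where
  "mtrace A = (\<Sum>i<dim_row A. A $$ (i, i))"

context
  fixes N :: nat
begin

lemma entry_mult:
  "\<lbrakk>A \<in> carrier_mat N N; B \<in> carrier_mat N N; i < N; j < N\<rbrakk>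
    \<Longrightarrow> (A * B :: complex Matrix.mat) $$ (i, j) = (\<Sum>k<N. A $$ (i, k) * B $$ (k, j))"
  by (auto simp: times_mat_def scalar_prod_def lessThan_atLeast0 intro!: sum.cong)

lemma mtrace_comm: "\<lbrakk>A \<in> carrier_mat N N; B \<in> carrier_mat N N\<rbrakk> \<Longrightarrow> mtrace (A * B) = mtrace (B * A)"
  unfolding mtrace_def
  by (simp add: entry_mult del: index_mult_mat(1)) (subst sum.swap, simp add: mult.commute)

lemma mtrace_add: "\<lbrakk>A \<in> carrier_mat N N; B \<in> carrier_mat N N\<rbrakk> \<Longrightarrow> mtrace (A + B) = mtrace A + mtrace B"
  unfolding mtrace_def by (simp add: sum.distrib)

lemma mtrace_diff: "\<lbrakk>A \<in> carrier_mat N N; B \<in> carrier_mat N N\<rbrakk> \<Longrightarrow> mtrace (A - B) = mtrace A - mtrace B"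
  unfolding mtrace_def by (simp add: sum_subtractf)

lemma mtrace_smult: "A \<in> carrier_mat N N \<Longrightarrow> mtrace (c \<cdot>\<^sub>m A) = c * mtrace A"
  unfolding mtrace_def by (simp add: sum_distrib_left)

lemmas ring_mat_simps =
  assoc_mult_mat[of _ N N _ N _ N] add_mult_distrib_mat[of _ N N _ _ N]
  mult_add_distrib_mat[of _ N N _ N] minus_mult_distrib_mat[of _ N N _ _ N]
  mult_minus_distrib_mat[of _ N N _ N] mult_smult_distrib[of _ N N _ N]
  mult_smult_assoc_mat[of _ N N _ N]

text \<open>The matrix \<open>1\<^sub>m N + Z\<close> is upper triangular with 1 on the diagonal
  except for the last entry, and the last diagonal entry of \<open>Z\<close> is its whole trace.
  This is the normal form to which a matrix of rank one is brought below.\<close>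

lemma det_one_add_last_column:
  assumes Z: "Z \<in> carrier_mat N N" and "\<And>i j. i < N \<Longrightarrow> Suc j < N \<Longrightarrow> Z $$ (i, j) = 0"
  shows "Determinant.det (1\<^sub>m N + Z) = 1 + mtrace Z" and "Z * Z = mtrace Z \<cdot>\<^sub>m Z"
proof -
  have "Determinant.det (1\<^sub>m N + Z) = 1 + mtrace Z \<and> Z * Z = mtrace Z \<cdot>\<^sub>m Z"
  proof (cases N)
    case 0
    then show ?thesis using Z by (auto simp: mtrace_def intro!: eq_matI)
  next
    case (Suc n)
    have tr: "mtrace Z = Z $$ (n, n)"
      using Z assms(2) by (simp add: mtrace_def Suc)
    have "Determinant.det (1\<^sub>m N + Z) = prod_list (diag_mat (1\<^sub>m N + Z))"
      using Z assms(2) Suc by (intro det_upper_triangular[of _ N]) (auto simp: upper_triangular_def)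
    also have "\<dots> = (\<Prod>i<N. (1\<^sub>m N + Z) $$ (i, i))"
      using Z by (simp add: diag_mat_def prod.distinct_set_conv_list[symmetric] lessThan_atLeast0
          del: upt_Suc)
    also have "\<dots> = (\<Prod>i<Suc n. if i = n then 1 + Z $$ (n, n) else 1)"
      unfolding Suc using Z assms(2) by (intro prod.cong) (auto simp: Suc)
    also have "\<dots> = 1 + Z $$ (n, n)" by simp
    finally have "Determinant.det (1\<^sub>m N + Z) = 1 + mtrace Z" using tr by simp
    moreover have "Z * Z = mtrace Z \<cdot>\<^sub>m Z"
    proof (rule eq_matI)
      fix i j assume ij: "i < dim_row (mtrace Z \<cdot>\<^sub>m Z)" "j < dim_col (mtrace Z \<cdot>\<^sub>m Z)"
      then have "(Z * Z) $$ (i, j) = (\<Sum>k<N. Z $$ (i, k) * Z $$ (k, j))"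
        using Z by (intro entry_mult) auto
      also have "\<dots> = Z $$ (i, n) * Z $$ (n, j)"
        using ij Z assms(2) by (simp add: Suc)
      also have "\<dots> = Z $$ (n, n) * Z $$ (i, j)"
        using ij Z assms(2)[of _ j] by (cases "j = n") (auto simp: Suc)
      finally show "(Z * Z) $$ (i, j) = (mtrace Z \<cdot>\<^sub>m Z) $$ (i, j)"
        using ij tr Z by simp
    qed (use Z in auto)
    ultimately show ?thesis by simp
  qed
  then show "Determinant.det (1\<^sub>m N + Z) = 1 + mtrace Z" and "Z * Z = mtrace Z \<cdot>\<^sub>m Z" by auto
qed

text \<open>The hypothesis says that \<open>X\<close> has rank at most one: in the basis formed by the columns of \<open>G\<close>,
  only the last one has a non-zero image.\<close>

lemma rank_one:
  assumes X: "X \<in> carrier_mat N N" and G: "G \<in> carrier_mat N N" "Determinant.det G \<noteq> 0"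
    and last: "\<And>i j. i < N \<Longrightarrow> Suc j < N \<Longrightarrow> (X * G) $$ (i, j) = 0"
  shows det_one_add_rank_one: "Determinant.det (1\<^sub>m N + X) = 1 + mtrace X"
    and square_rank_one: "X * X = mtrace X \<cdot>\<^sub>m X"
proof -
  obtain H where H: "H \<in> carrier_mat N N" "G * H = 1\<^sub>m N" "H * G = 1\<^sub>m N"
    using nonsingular_inverse[OF G] by blast
  \<comment> \<open>\<open>H\<close> inverts \<open>G\<close>, so \<open>Z\<close> is
    \<open>X\<close> written in the basis of the columns of \<open>G\<close>; trace, square and
    determinant are carried back by similarity.\<close>
  define Z where "Z = H * (X * G)"
  have Z: "Z \<in> carrier_mat N N" using X G H by (simp add: Z_def)
  have "Z $$ (i, j) = 0" if "i < N" "Suc j < N" for i j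
    using that last X G H
    unfolding Z_def by (subst entry_mult) auto
  note Z_last = det_one_add_last_column[OF Z this]
  have GZ: "G * Z = X * G"
    using X G H assoc_mult_mat[of G N N H N "X * G" N] by (simp add: Z_def)
  have XGH: "X * G * H = X"
    using X G H assoc_mult_mat[of X N N G N H N] by simp
  have XH: "X = G * Z * H" using XGH GZ by simp
  have "mtrace Z = mtrace (X * G * H)"
    using mtrace_comm[of H "X * G"] X G H by (simp add: Z_def)
  then have tr: "mtrace X = mtrace Z" by (simp only: XGH)
  have "G * (1\<^sub>m N + Z) * H = G * H + G * Z * H"
    using G H Z by (simp add: mult_add_distrib_mat[of _ N N _ N] add_mult_distrib_mat[of _ N N _ _ N])
  also have "\<dots> = 1\<^sub>m N + X" using H(2) XH by simp
  finally have "Determinant.det (1\<^sub>m N + X) = Determinant.det (G * (1\<^sub>m N + Z) * H)" by simp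
  also have "\<dots> = Determinant.det (1\<^sub>m N + Z) * (Determinant.det G * Determinant.det H)"
    using G(1) H(1) Z by (simp add: det_mult[of _ N])
  also have "Determinant.det G * Determinant.det H = 1"
    using det_mult[of G N H] G H by simp
  finally show "Determinant.det (1\<^sub>m N + X) = 1 + mtrace X" using Z_last tr by simp
  have "X * X = X * (G * Z * H)" using XH by simp
  also have "\<dots> = X * G * Z * H"
    using X G H Z assoc_mult_mat[of X N N "G * Z" N H N] assoc_mult_mat[of X N N G N Z N] by simp
  also have "\<dots> = G * Z * Z * H" by (simp only: GZ)
  also have "\<dots> = G * (Z * Z) * H"
    using G Z assoc_mult_mat[of G N N Z N Z N] by simp
  also have "\<dots> = mtrace X \<cdot>\<^sub>m (G * Z * H)"
    using Z_last(2) tr Z G H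
    by (simp add: mult_smult_distrib[of _ N N _ N] mult_smult_assoc_mat[of _ N N _ N])
  also have "\<dots> = mtrace X \<cdot>\<^sub>m X" using XH by simp
  finally show "X * X = mtrace X \<cdot>\<^sub>m X" .
qed

end

section \<open>Casorati determinants and their derivatives\<close>

text \<open>In each term of the Leibniz formula the product rule differentiates one factor, and each
  factor comes from one row. Collecting the terms by row gives a determinant with that row
  differentiated.\<close>

lemma has_field_derivative_det:
  fixes A :: "complex \<Rightarrow> complex Matrix.mat"
  assumes A: "\<And>h. A h \<in> carrier_mat N N"
    and deriv: "\<And>i j. i < N \<Longrightarrow> j < N \<Longrightarrow> ((\<lambda>h. A h $$ (i, j)) has_field_derivative A' (i, j)) (at z)"
  shows "((\<lambda>h. Determinant.det (A h)) has_field_derivative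
    (\<Sum>k<N. Determinant.det (Matrix.mat N N (\<lambda>(i, j). if i = k then A' (i, j) else A z $$ (i, j))))) (at z)"
proof -
  let ?P = "{\<pi>. \<pi> permutes {0..<N}}"
  have eq: "Determinant.det (Matrix.mat N N (\<lambda>(i, j). if i = k then A' (i, j) else A z $$ (i, j)))
      = (\<Sum>\<pi>\<in>?P. signof \<pi> * (A' (k, \<pi> k) * (\<Prod>i\<in>{0..<N} - {k}. A z $$ (i, \<pi> i))))" if "k < N" for k
  proof (subst det_def'[of _ N], simp, intro sum.cong refl arg_cong2[of _ _ _ _ "(*)"])
    fix \<pi> assume "\<pi> \<in> ?P"
    then have lt: "i < N \<Longrightarrow> \<pi> i < N" for i using permutes_in_image[of \<pi> "{0..<N}" i] by auto
    then show "(\<Prod>i = 0..<N. Matrix.mat N N (\<lambda>(i, j). if i = k then A' (i, j) else A z $$ (i, j)) $$ (i, \<pi> i))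
      = A' (k, \<pi> k) * (\<Prod>i\<in>{0..<N} - {k}. A z $$ (i, \<pi> i))"
      using that by (subst prod.remove[of _ k]) (auto intro!: prod.cong)
  qed
  have "((\<lambda>h. \<Sum>\<pi>\<in>?P. signof \<pi> * (\<Prod>i = 0..<N. A h $$ (i, \<pi> i))) has_field_derivative
     (\<Sum>\<pi>\<in>?P. signof \<pi> * (\<Sum>k\<in>{0..<N}. A' (k, \<pi> k) * (\<Prod>i\<in>{0..<N} - {k}. A z $$ (i, \<pi> i))))) (at z)"
  proof (intro DERIV_sum DERIV_cmult has_field_derivative_prod deriv)
    fix \<pi> i assume "\<pi> \<in> ?P" "i \<in> {0..<N}"
    then show "i < N" "\<pi> i < N" using permutes_in_image[of \<pi> "{0..<N}" i] by auto
  qed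
  also have "(\<Sum>\<pi>\<in>?P. signof \<pi> * (\<Sum>k\<in>{0..<N}. A' (k, \<pi> k) * (\<Prod>i\<in>{0..<N} - {k}. A z $$ (i, \<pi> i))))
    = (\<Sum>k<N. Determinant.det (Matrix.mat N N (\<lambda>(i, j). if i = k then A' (i, j) else A z $$ (i, j))))"
    by (simp add: eq sum_distrib_left lessThan_atLeast0) (rule sum.swap)
  finally show ?thesis using det_def'[OF A] by simp
qed

text \<open>The vectors \<open>A\<close> and \<open>B\<close> absorb everything in a row that does
  not depend on the column, so x, y, t and the lattice point act only by rescaling them.\<close>

definition cmat :: "nat \<Rightarrow> (nat \<Rightarrow> complex) \<Rightarrow> (nat \<Rightarrow> complex) \<Rightarrow> (nat \<Rightarrow> complex) \<Rightarrow> complex Matrix.mat" where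
  "cmat N p A B = Matrix.mat N N (\<lambda>(i, j). A i * p i ^ j + B i * (- p i) ^ j)"

definition cdet :: "nat \<Rightarrow> (nat \<Rightarrow> complex) \<Rightarrow> (nat \<Rightarrow> complex) \<Rightarrow> (nat \<Rightarrow> complex) \<Rightarrow> complex" where
  "cdet N p A B = Determinant.det (cmat N p A B)"

text \<open>\<open>rowd \<omega>\<close> is the infinitesimal generator of the flow \<open>A\<^sub>i \<mapsto> A\<^sub>i e\<^bsup>\<omega>\<^sub>i h\<^esup>\<close>, \<open>B\<^sub>i \<mapsto> B\<^sub>i e\<^bsup>-\<omega>\<^sub>i h\<^esup>\<close> on
  functions that are linear in each row \<open>(A\<^sub>i, B\<^sub>i)\<close>; \<open>\<partial>\<^sub>x\<close>, \<open>\<partial>\<^sub>y\<close>, \<open>\<partial>\<^sub>t\<close> are the choices \<open>p\<close>, \<open>1/p\<close>, \<open>- 4 p\<^sup>3\<close>.\<close>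

definition rowd :: "nat \<Rightarrow> (nat \<Rightarrow> complex) \<Rightarrow> ((nat \<Rightarrow> complex) \<Rightarrow> (nat \<Rightarrow> complex) \<Rightarrow> complex) \<Rightarrow>
    (nat \<Rightarrow> complex) \<Rightarrow> (nat \<Rightarrow> complex) \<Rightarrow> complex" where
  "rowd N \<omega> F A B = (\<Sum>i<N. F (A(i := \<omega> i * A i)) (B(i := - \<omega> i * B i)))"

definition flow :: "(nat \<Rightarrow> complex) \<Rightarrow> complex \<Rightarrow> (nat \<Rightarrow> complex) \<Rightarrow> nat \<Rightarrow> complex" where
  "flow \<omega> h A = (\<lambda>i. A i * exp (\<omega> i * h))"

text \<open>The formula is demanded at every time \<open>z\<close>, for every weight and every
  starting point, so that it can be differentiated again: iterated \<open>rowd\<close> then stands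
  for higher and mixed partial derivatives.\<close>

definition flowable :: "nat \<Rightarrow> ((nat \<Rightarrow> complex) \<Rightarrow> (nat \<Rightarrow> complex) \<Rightarrow> complex) \<Rightarrow> bool" where
  "flowable N F \<longleftrightarrow> (\<forall>\<omega> A B z.
     ((\<lambda>h. F (flow \<omega> h A) (flow \<omega> (- h) B)) has_field_derivative
       rowd N \<omega> F (flow \<omega> z A) (flow \<omega> (- z) B)) (at z))"

lemma cmat_carrier [simp]: "cmat N p A B \<in> carrier_mat N N"
  by (simp add: cmat_def)

lemma dim_cmat [simp]: "dim_row (cmat N p A B) = N" "dim_col (cmat N p A B) = N"
  by (simp_all add: cmat_def)

lemma cmat_entry: "i < N \<Longrightarrow> j < N \<Longrightarrow> cmat N p A B $$ (i, j) = A i * p i ^ j + B i * (- p i) ^ j"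
  by (simp add: cmat_def)

lemma cmat_entry_deriv:
  assumes "i < N" "j < N"
  shows "((\<lambda>h. cmat N p (flow \<omega> h A) (flow \<omega> (- h) B) $$ (i, j)) has_field_derivative
    cmat N p (\<lambda>i. \<omega> i * flow \<omega> z A i) (\<lambda>i. - \<omega> i * flow \<omega> (- z) B i) $$ (i, j)) (at z)"
  using assms unfolding cmat_entry[OF assms] flow_def
  by (auto intro!: derivative_eq_intros simp: algebra_simps)

lemma flowable_cdet: "flowable N (cdet N p)"
  unfolding flowable_def
proof (intro allI)
  fix \<omega> A B z
  let ?A = "flow \<omega> z A" and ?B = "flow \<omega> (- z) B"
  have eq: "Matrix.mat N N (\<lambda>(i, j). if i = k then cmat N p (\<lambda>i. \<omega> i * ?A i) (\<lambda>i. - \<omega> i * ?B i) $$ (i, j)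
      else cmat N p ?A ?B $$ (i, j)) = cmat N p (?A(k := \<omega> k * ?A k)) (?B(k := - \<omega> k * ?B k))" for k
    by (rule eq_matI) (auto simp: cmat_entry)
  show "((\<lambda>h. cdet N p (flow \<omega> h A) (flow \<omega> (- h) B)) has_field_derivative
        rowd N \<omega> (cdet N p) ?A ?B) (at z)"
    unfolding cdet_def rowd_def eq[symmetric]
    by (intro has_field_derivative_det cmat_entry_deriv) auto
qed

lemma flow_upd: "(flow \<omega> h A)(i := c * flow \<omega> h A i) = flow \<omega> h (A(i := c * A i))"
  by (auto simp: flow_def)

text \<open>Rescaling a row commutes with the flow, so each summand of \<open>rowd N \<nu> F\<close>
  is \<open>F\<close> along a flow with a rescaled start. Exchanging the two finite sums gives the
  iterated operator.\<close>

lemma flowable_rowd: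
  assumes "flowable N F"
  shows "flowable N (rowd N \<nu> F)"
  unfolding flowable_def
proof (intro allI)
  fix \<omega> A B z
  let ?A = "flow \<omega> z A" and ?B = "flow \<omega> (- z) B"
  have comm: "rowd N \<omega> (rowd N \<nu> F) ?A ?B =
     (\<Sum>i<N. rowd N \<omega> F (flow \<omega> z (A(i := \<nu> i * A i))) (flow \<omega> (- z) (B(i := - \<nu> i * B i))))"
    unfolding rowd_def
    by (subst sum.swap, intro sum.cong refl, rule arg_cong2[of _ _ _ _ F])
       (auto simp: flow_def fun_eq_iff algebra_simps)
  show "((\<lambda>h. rowd N \<nu> F (flow \<omega> h A) (flow \<omega> (- h) B)) has_field_derivative
        rowd N \<omega> (rowd N \<nu> F) ?A ?B) (at z)"
    unfolding comm unfolding rowd_def[of N \<nu>] flow_upd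
    using assms by (intro DERIV_sum) (auto simp: flowable_def)
qed

lemma flow_0 [simp]: "flow \<omega> 0 A = A"
  by (simp add: flow_def)

lemma flowableD:
  "flowable N F \<Longrightarrow> ((\<lambda>h. F (flow \<omega> h A) (flow \<omega> (- h) B)) has_field_derivative
       rowd N \<omega> F (flow \<omega> z A) (flow \<omega> (- z) B)) (at z)"
  by (auto simp: flowable_def)

section \<open>The logarithmic derivative of the determinant and its Riccati equation\<close>

definition dg :: "nat \<Rightarrow> (nat \<Rightarrow> complex) \<Rightarrow> complex Matrix.mat" where
  "dg N g = Matrix.mat N N (\<lambda>(i, j). if i = j then g i else 0)"

lemma dg_carrier [simp]: "dg N g \<in> carrier_mat N N" "dim_row (dg N g) = N" "dim_col (dg N g) = N"
  by (simp_all add: dg_def)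

lemma dg_mult_entry:
  assumes "X \<in> carrier_mat N N" "i < N" "j < N"
  shows "(dg N g * X) $$ (i, j) = g i * X $$ (i, j)"
proof -
  have "(dg N g * X) $$ (i, j) = (\<Sum>k<N. if k = i then g i * X $$ (i, j) else 0)"
    unfolding entry_mult[OF dg_carrier(1) assms] using assms
    by (intro sum.cong) (auto simp: dg_def)
  then show ?thesis using assms by simp
qed

lemma dg_mult_cmat: "dg N g * cmat N p A B = cmat N p (\<lambda>i. g i * A i) (\<lambda>i. g i * B i)"
proof (rule eq_matI)
  fix i j assume "i < dim_row (cmat N p (\<lambda>i. g i * A i) (\<lambda>i. g i * B i))"
    "j < dim_col (cmat N p (\<lambda>i. g i * A i) (\<lambda>i. g i * B i))"
  then have ij: "i < N" "j < N" by auto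
  then show "(dg N g * cmat N p A B) $$ (i, j) = cmat N p (\<lambda>i. g i * A i) (\<lambda>i. g i * B i) $$ (i, j)"
    unfolding dg_mult_entry[OF cmat_carrier ij] cmat_entry[OF ij] by (simp add: algebra_simps)
qed auto

text \<open>Jacobi's formula. Expansion along the altered row involves only minors that omit this
  row, and these are minors of the unaltered matrix.\<close>

lemma rowd_cdet:
  "rowd N \<omega> (cdet N p) A B =
    mtrace (cmat N p (\<lambda>i. \<omega> i * A i) (\<lambda>i. - \<omega> i * B i) * adj_mat (cmat N p A B))"
proof -
  let ?W = "cmat N p (\<lambda>i. \<omega> i * A i) (\<lambda>i. - \<omega> i * B i)" and ?M = "cmat N p A B"
  note adj = adj_mat(1)[OF cmat_carrier[of N p A B]]
  have "cdet N p (A(i := \<omega> i * A i)) (B(i := - \<omega> i * B i)) = (\<Sum>j<N. ?W $$ (i, j) * cofactor ?M i j)"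
    if "i < N" for i
  proof -
    let ?V = "cmat N p (A(i := \<omega> i * A i)) (B(i := - \<omega> i * B i))"
    have "mat_delete ?V i j = mat_delete ?M i j" if "j < N" for j
      using \<open>i < N\<close> that unfolding mat_delete_def by (auto intro!: eq_matI simp: cmat_def)
    then show ?thesis
      unfolding cdet_def laplace_expansion_row[OF cmat_carrier that] cofactor_def
      using that by (intro sum.cong) (auto simp: cmat_entry)
  qed
  then have "rowd N \<omega> (cdet N p) A B = (\<Sum>i<N. \<Sum>j<N. ?W $$ (i, j) * cofactor ?M i j)"
    unfolding rowd_def by simp
  also have "\<dots> = mtrace (?W * adj_mat ?M)"
    unfolding mtrace_def using adj
    by (auto simp: entry_mult[of _ N] adj_mat_def intro!: sum.cong simp del: index_mult_mat(1))
  finally show ?thesis .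
qed

text \<open>\<open>kmat\<close> is \<open>M\<^sub>x M\<^sup>-\<^sup>1\<close> for \<open>M = cmat N p A B\<close>; it is the zero matrix where \<open>M\<close> is singular.\<close>

definition kmat :: "nat \<Rightarrow> (nat \<Rightarrow> complex) \<Rightarrow> (nat \<Rightarrow> complex) \<Rightarrow> (nat \<Rightarrow> complex) \<Rightarrow> complex Matrix.mat" where
  "kmat N p A B = cmat N p (\<lambda>i. p i * A i) (\<lambda>i. - p i * B i) *
     (inverse (cdet N p A B) \<cdot>\<^sub>m adj_mat (cmat N p A B))"

lemma adj_cmat_carrier [simp]: "adj_mat (cmat N p A B) \<in> carrier_mat N N"
  by (rule adj_mat(1)[OF cmat_carrier])

lemma kmat_carrier [simp]: "kmat N p A B \<in> carrier_mat N N"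
  unfolding kmat_def by (intro mult_carrier_mat[of _ N N] smult_carrier_mat) auto

lemma dim_kmat [simp]: "dim_row (kmat N p A B) = N" "dim_col (kmat N p A B) = N"
  using kmat_carrier[of N p A B] by (auto simp del: kmat_carrier)

lemma kmat_mult:
  assumes "cdet N p A B \<noteq> 0"
  shows "kmat N p A B * cmat N p A B = cmat N p (\<lambda>i. p i * A i) (\<lambda>i. - p i * B i)"
  unfolding kmat_def using assms adj_mat(3)[OF cmat_carrier, of N p A B]
  by (simp add: assoc_mult_mat[of _ N N _ N _ N] mult_smult_distrib[of _ N N _ N]
      mult_smult_assoc_mat[of _ N N _ N] mult_carrier_mat[of _ N N _ N] cdet_def) (auto intro!: eq_matI)

lemma kmatI:
  assumes "cdet N p A B \<noteq> 0" "X \<in> carrier_mat N N"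
    and "X * cmat N p A B = cmat N p (\<lambda>i. p i * A i) (\<lambda>i. - p i * B i)"
  shows "kmat N p A B = X"
proof -
  obtain H where H: "H \<in> carrier_mat N N" "cmat N p A B * H = 1\<^sub>m N"
    using nonsingular_inverse[OF cmat_carrier] assms(1) unfolding cdet_def by metis
  have "kmat N p A B = kmat N p A B * cmat N p A B * H"
    using H assoc_mult_mat[OF kmat_carrier cmat_carrier H(1), of p A B p A B] by simp
  also have "\<dots> = X * cmat N p A B * H" using kmat_mult[OF assms(1)] assms(3) by simp
  also have "\<dots> = X" using assoc_mult_mat[OF assms(2) cmat_carrier H(1), of p A B] H assms(2) by simp
  finally show ?thesis .
qed

text \<open>Weights are split as \<open>g i * p i\<close> because the factors \<open>p i\<close> and
  \<open>- p i\<close> turn M into M_x; the remaining \<open>g i\<close> acts alike on both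
  amplitudes, hence as a diagonal matrix from the left. The derivatives in x, y, t use
  \<open>g\<close> equal to 1, p^-2 and p^2, up to the factor -4 for t.\<close>

lemma rowd_cdet_kmat:
  assumes "cdet N p A B \<noteq> 0"
  shows "rowd N (\<lambda>i. g i * p i) (cdet N p) A B = cdet N p A B * mtrace (dg N g * kmat N p A B)"
proof -
  have "mtrace (dg N g * kmat N p A B) =
    mtrace (inverse (cdet N p A B) \<cdot>\<^sub>m
      (dg N g * cmat N p (\<lambda>i. p i * A i) (\<lambda>i. - p i * B i) * adj_mat (cmat N p A B)))"
    unfolding kmat_def
    by (simp add: assoc_mult_mat[of _ N N _ N _ N] mult_smult_distrib[of _ N N _ N] mult_carrier_mat[of _ N N _ N])
  also have "\<dots> = inverse (cdet N p A B) * rowd N (\<lambda>i. g i * p i) (cdet N p) A B"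
    unfolding rowd_cdet
    by (subst mtrace_smult[of _ N]) (auto simp: dg_mult_cmat algebra_simps intro!: mult_carrier_mat[of _ N N])
  finally show ?thesis using assms by simp
qed

lemma flow_scale: "(\<lambda>i. c i * flow \<omega> h A i) = flow \<omega> h (\<lambda>i. c i * A i)"
  by (simp add: flow_def mult.assoc)

text \<open>\<open>kmat\<close> has its meaning only off the zeros of the determinant. Openness lets
  formulas that are valid there be differentiated along the flow.\<close>

lemma open_flow_nondeg: "open {h. cdet N p (flow \<omega> h A) (flow \<omega> (- h) B) \<noteq> 0}"
proof -
  have "continuous_on UNIV (\<lambda>h. cdet N p (flow \<omega> h A) (flow \<omega> (- h) B))"
    by (intro continuous_at_imp_continuous_on ballI DERIV_isCont)
       (rule flowableD[OF flowable_cdet])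
  then show ?thesis by (intro open_Collect_neq continuous_on_const)
qed

text \<open>The matrix Riccati equation \<open>K\<^sub>x = \<Lambda> - K\<^sup>2\<close>.\<close>

lemma kmat_deriv:
  assumes nz: "cdet N p (flow p z A) (flow p (- z) B) \<noteq> 0" and ij: "i < N" "j < N"
  defines "K \<equiv> kmat N p (flow p z A) (flow p (- z) B)"
  shows "((\<lambda>h. kmat N p (flow p h A) (flow p (- h) B) $$ (i, j)) has_field_derivative
    (dg N (\<lambda>i. (p i)\<^sup>2) - K * K) $$ (i, j)) (at z)"
proof -
  let ?M = "\<lambda>h. cmat N p (flow p h A) (flow p (- h) B)"
  let ?M1 = "\<lambda>h. cmat N p (flow p h (\<lambda>i. p i * A i)) (flow p (- h) (\<lambda>i. - p i * B i))"
  let ?M2 = "\<lambda>h. cmat N p (flow p h (\<lambda>i. p i * (p i * A i))) (flow p (- h) (\<lambda>i. - p i * (- p i * B i)))"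
  let ?K = "\<lambda>h. kmat N p (flow p h A) (flow p (- h) B)"
  have dM: "((\<lambda>h. ?M h $$ (i, j)) has_field_derivative ?M1 z $$ (i, j)) (at z)"
    if "i < N" "j < N" for i j
    using cmat_entry_deriv[OF that, of p p A B z] by (simp only: flow_scale)
  have dM1: "((\<lambda>h. ?M1 h $$ (i, j)) has_field_derivative ?M2 z $$ (i, j)) (at z)"
    if "i < N" "j < N" for i j
    using cmat_entry_deriv[OF that, of p p "\<lambda>i. p i * A i" "\<lambda>i. - p i * B i" z] by (simp only: flow_scale)
  \<comment> \<open>Only the existence of the derivative matters here; for \<open>K\<close> its
    value is found below by differentiating K M = M_x.\<close>
  have dadj: "(\<lambda>h. adj_mat (?M h) $$ (i, j)) field_differentiable (at z)" if "i < N" "j < N" for i j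
  proof -
    have "((\<lambda>h. Determinant.det (mat_delete (?M h) j i)) has_field_derivative
      (\<Sum>k<N - 1. Determinant.det (Matrix.mat (N - 1) (N - 1)
        (\<lambda>(i', j'). if i' = k then (\<lambda>(i', j'). mat_delete (?M1 z) j i $$ (i', j')) (i', j')
           else mat_delete (?M z) j i $$ (i', j'))))) (at z)"
    proof (rule has_field_derivative_det)
      show "mat_delete (?M h) j i \<in> carrier_mat (N - 1) (N - 1)" for h
        by (rule mat_delete_carrier) auto
      fix i' j' assume "i' < N - 1" "j' < N - 1"
      then show "((\<lambda>h. mat_delete (?M h) j i $$ (i', j')) has_field_derivative
          (case (i', j') of (i', j') \<Rightarrow> mat_delete (?M1 z) j i $$ (i', j'))) (at z)"
        using dM[of i' j'] dM[of "Suc i'" j'] dM[of i' "Suc j'"] dM[of "Suc i'" "Suc j'"]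
        by (simp add: mat_delete_def)
    qed
    then have "(\<lambda>h. (- 1) ^ (j + i) * Determinant.det (mat_delete (?M h) j i)) field_differentiable (at z)"
      by (intro field_differentiable_mult field_differentiable_const) (auto simp: field_differentiable_def)
    then show ?thesis using that by (simp add: adj_mat_def cofactor_def)
  qed
  have "\<exists>D. ((\<lambda>h. ?K h $$ (i, j)) has_field_derivative D) (at z)" if "i < N" "j < N" for i j
  proof -
    have eq: "?K h $$ (i, j) = (\<Sum>k<N. ?M1 h $$ (i, k) * (inverse (cdet N p (flow p h A) (flow p (- h) B)) * adj_mat (?M h) $$ (k, j)))" for h
    proof -
      have "adj_mat (?M h) \<in> carrier_mat N N" by simp
      then have "dim_row (adj_mat (?M h)) = N" "dim_col (adj_mat (?M h)) = N" by (auto simp only: carrier_matD)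
      then show ?thesis
      unfolding kmat_def flow_scale using that by (subst entry_mult[of _ N]) auto
    qed
    have "(\<lambda>h. \<Sum>k<N. ?M1 h $$ (i, k) * (inverse (cdet N p (flow p h A) (flow p (- h) B)) * adj_mat (?M h) $$ (k, j))) field_differentiable (at z)"
      using nz that dM1 flowableD[OF flowable_cdet[of N p], where \<omega> = p and A = A and B = B and z = z]
      by (intro field_differentiable_sum field_differentiable_mult field_differentiable_inverse dadj)
         (auto simp: field_differentiable_def)
    then show ?thesis unfolding eq field_differentiable_def .
  qed
  then obtain D where D: "\<And>i j. i < N \<Longrightarrow> j < N \<Longrightarrow> ((\<lambda>h. ?K h $$ (i, j)) has_field_derivative D i j) (at z)"
    by metis
  define DK where "DK = Matrix.mat N N (\<lambda>(i, j). D i j)"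
  have DK: "DK \<in> carrier_mat N N" "\<And>i j. i < N \<Longrightarrow> j < N \<Longrightarrow> DK $$ (i, j) = D i j"
    by (auto simp: DK_def)
  have Kc: "K \<in> carrier_mat N N" by (simp add: K_def)
  have KM: "?K h * ?M h = ?M1 h" if "cdet N p (flow p h A) (flow p (- h) B) \<noteq> 0" for h
    using kmat_mult[OF that] by (simp only: flow_scale)
  \<comment> \<open>Product rule for K M = M_x. Together with M_xx = Lambda M and K M_x = K^2 M,
    cancelling M on the right yields the Riccati equation.\<close>
  have "DK * ?M z + K * ?M1 z = ?M2 z"
  proof (rule eq_matI)
    fix i j assume "i < dim_row (?M2 z)" "j < dim_col (?M2 z)"
    then have ij: "i < N" "j < N" by auto
    have "((\<lambda>h. \<Sum>k<N. ?K h $$ (i, k) * ?M h $$ (k, j)) has_field_derivative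
        (\<Sum>k<N. ?K z $$ (i, k) * ?M1 z $$ (k, j) + D i k * ?M z $$ (k, j))) (at z)"
      using ij by (intro DERIV_sum DERIV_mult' D dM) auto
    then have "((\<lambda>h. ?M1 h $$ (i, j)) has_field_derivative
        (\<Sum>k<N. ?K z $$ (i, k) * ?M1 z $$ (k, j) + D i k * ?M z $$ (k, j))) (at z)"
    proof (rule has_field_derivative_transform_within_open[OF _ open_flow_nondeg[of N p p A B]])
      fix h assume "h \<in> {h. cdet N p (flow p h A) (flow p (- h) B) \<noteq> 0}"
      then have "?M1 h = ?K h * ?M h" using KM by simp
      then show "(\<Sum>k<N. ?K h $$ (i, k) * ?M h $$ (k, j)) = ?M1 h $$ (i, j)"
        using ij by (simp only: entry_mult[OF kmat_carrier cmat_carrier])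
    qed (use nz in auto)
    then have "?M2 z $$ (i, j) = (\<Sum>k<N. ?K z $$ (i, k) * ?M1 z $$ (k, j) + D i k * ?M z $$ (k, j))"
      using dM1[OF ij] DERIV_unique by blast
    also have "\<dots> = (DK * ?M z + K * ?M1 z) $$ (i, j)"
      using ij Kc DK by (simp add: entry_mult[of _ N] sum.distrib K_def del: index_mult_mat(1))
    finally show "(DK * ?M z + K * ?M1 z) $$ (i, j) = ?M2 z $$ (i, j)" ..
  qed (use DK Kc in auto)
  moreover have "?M2 z = dg N (\<lambda>i. (p i)\<^sup>2) * ?M z"
    unfolding dg_mult_cmat flow_scale by (simp add: power2_eq_square mult.assoc)
  moreover have "K * ?M1 z = K * K * ?M z"
    using KM[OF nz] assoc_mult_mat[OF Kc Kc cmat_carrier] by (simp add: K_def)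
  moreover obtain H where H: "H \<in> carrier_mat N N" "?M z * H = 1\<^sub>m N"
    using nonsingular_inverse[OF cmat_carrier] nz unfolding cdet_def by metis
  ultimately have eq: "DK * ?M z + K * K * ?M z = dg N (\<lambda>i. (p i)\<^sup>2) * ?M z" by simp
  have "DK + K * K = (DK + K * K) * ?M z * H"
    using DK Kc H assoc_mult_mat[of "DK + K * K" N N "?M z" N H N] by simp
  also have "(DK + K * K) * ?M z = dg N (\<lambda>i. (p i)\<^sup>2) * ?M z"
    using eq DK Kc by (subst add_mult_distrib_mat[of _ N N _ _ N]) auto
  also have "\<dots> * H = dg N (\<lambda>i. (p i)\<^sup>2)"
    using H assoc_mult_mat[of "dg N (\<lambda>i. (p i)\<^sup>2)" N N "?M z" N H N] by simp
  finally have "DK + K * K = dg N (\<lambda>i. (p i)\<^sup>2)" .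
  then have "DK $$ (i, j) = (dg N (\<lambda>i. (p i)\<^sup>2) - K * K) $$ (i, j)"
    using ij DK Kc by (metis add_diff_cancel_right' carrier_matD index_add_mat(1) index_minus_mat(1) index_mult_mat(2,3))
  then show ?thesis using D[OF ij] DK ij by simp
qed

lemma mtrace_deriv:
  assumes "\<And>h. X h \<in> carrier_mat N N" "X' \<in> carrier_mat N N"
    and "\<And>i j. i < N \<Longrightarrow> j < N \<Longrightarrow> ((\<lambda>h. X h $$ (i, j)) has_field_derivative X' $$ (i, j)) (at z)"
  shows "((\<lambda>h. mtrace (dg N g * X h)) has_field_derivative mtrace (dg N g * X')) (at z)"
proof -
  have eq: "mtrace (dg N g * Y) = (\<Sum>i<N. g i * Y $$ (i, i))" if "Y \<in> carrier_mat N N" for Y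
    unfolding mtrace_def using that by (simp add: dg_mult_entry[OF that] del: index_mult_mat(1))
  show ?thesis
    unfolding eq[OF assms(1)] eq[OF assms(2)] using assms(3) by (intro DERIV_sum DERIV_cmult) auto
qed

lemma mtrace_square_deriv:
  assumes X: "\<And>h. X h \<in> carrier_mat N N" "X' \<in> carrier_mat N N"
    and d: "\<And>i j. i < N \<Longrightarrow> j < N \<Longrightarrow> ((\<lambda>h. X h $$ (i, j)) has_field_derivative X' $$ (i, j)) (at z)"
  shows "((\<lambda>h. mtrace (X h * X h)) has_field_derivative 2 * mtrace (X z * X')) (at z)"
proof -
  have eq: "mtrace (Y * Z) = (\<Sum>i<N. \<Sum>k<N. Y $$ (i, k) * Z $$ (k, i))"
    if "Y \<in> carrier_mat N N" "Z \<in> carrier_mat N N" for Y Z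
    unfolding mtrace_def using that by (simp add: entry_mult[OF that] del: index_mult_mat(1))
  have "((\<lambda>h. \<Sum>i<N. \<Sum>k<N. X h $$ (i, k) * X h $$ (k, i)) has_field_derivative
    (\<Sum>i<N. \<Sum>k<N. X z $$ (i, k) * X' $$ (k, i) + X' $$ (i, k) * X z $$ (k, i))) (at z)"
    using d by (intro DERIV_sum DERIV_mult') auto
  moreover have "(\<Sum>i<N. \<Sum>k<N. X z $$ (i, k) * X' $$ (k, i) + X' $$ (i, k) * X z $$ (k, i)) =
      mtrace (X z * X') + mtrace (X' * X z)"
    by (simp add: eq X sum.distrib)
  ultimately show ?thesis using mtrace_comm[OF X(2) X(1)] by (simp add: eq X)
qed

lemma dg_one: "dg N (\<lambda>_. 1) = 1\<^sub>m N"
  by (auto simp: dg_def)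

text \<open>Start from D_x = D tr K and differentiate with K_x = L - K^2. As \<open>L\<close> is
  constant in x, the second derivative of tr K is - 2 tr (K K_x), the last term of the third-order
  formula. The weight \<open>g\<close> sits on the inner derivation only, which covers the mixed
  xy-derivative.\<close>

lemma cdet_jets:
  fixes N p A B
  defines "K \<equiv> kmat N p A B" and "L \<equiv> dg N (\<lambda>i. (p i)\<^sup>2)" and "D \<equiv> cdet N p"
  assumes nz: "D A B \<noteq> 0"
  shows rowd2_cdet: "rowd N p (rowd N (\<lambda>i. g i * p i) D) A B =
      D A B * (mtrace K * mtrace (dg N g * K) + mtrace (dg N g * (L - K * K)))"
    and rowd3_cdet: "rowd N p (rowd N p (rowd N p D)) A B =
      D A B * (mtrace K ^ 3 + 3 * mtrace K * mtrace (L - K * K) - 2 * mtrace (K * (L - K * K)))"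
proof -
  let ?A = "\<lambda>h. flow p h A" and ?B = "\<lambda>h. flow p (- h) B"
  let ?K = "\<lambda>h. kmat N p (?A h) (?B h)"
  define U where "U = {h. D (?A h) (?B h) \<noteq> 0}"
  have U: "open U" "0 \<in> U" using open_flow_nondeg[of N p p A B] nz by (auto simp: U_def D_def)
  have Kc: "K \<in> carrier_mat N N" and Lc: "L \<in> carrier_mat N N" by (auto simp: K_def L_def)
  have R: "L - ?K h * ?K h \<in> carrier_mat N N" for h
    using Lc by (auto intro!: minus_carrier_mat mult_carrier_mat[of _ N N])
  \<comment> \<open>Needed for all \<open>h\<close> in an open set, not only at 0, because the
    formula is differentiated once more.\<close>
  have D1g: "rowd N (\<lambda>i. g i * p i) D (?A h) (?B h) = D (?A h) (?B h) * mtrace (dg N g * ?K h)"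
    if "h \<in> U" for h g using that rowd_cdet_kmat unfolding U_def D_def by blast
  have one: "mtrace (dg N (\<lambda>_. 1) * X) = mtrace X" if "X \<in> carrier_mat N N" for X
    using that by (simp add: dg_one)
  have D1: "rowd N p D (?A h) (?B h) = D (?A h) (?B h) * mtrace (?K h)" if "h \<in> U" for h
    using D1g[OF that, of "\<lambda>_. 1"] by (simp add: dg_one)
  have dK: "((\<lambda>h. ?K h $$ (i, j)) has_field_derivative (L - ?K z * ?K z) $$ (i, j)) (at z)"
    if "z \<in> U" "i < N" "j < N" for i j z
    using kmat_deriv[of N p z A B i j] that by (simp add: U_def L_def D_def)
  have dtr: "((\<lambda>h. mtrace (dg N g * ?K h)) has_field_derivative mtrace (dg N g * (L - ?K z * ?K z))) (at z)"
    if "z \<in> U" for z g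
    using dK[OF that] R by (intro mtrace_deriv) auto
  have dtr1: "((\<lambda>h. mtrace (?K h)) has_field_derivative mtrace (L - ?K z * ?K z)) (at z)"
    if "z \<in> U" for z
    using dtr[OF that, of "\<lambda>_. 1"] by (simp add: one R)
  have fD: "flowable N D" by (simp add: D_def flowable_cdet)
  have dD: "((\<lambda>h. D (?A h) (?B h)) has_field_derivative D (?A z) (?B z) * mtrace (?K z)) (at z)"
    if "z \<in> U" for z using flowableD[OF fD, of p A B z] D1[OF that] by simp
  have D2: "rowd N p (rowd N (\<lambda>i. g i * p i) D) (?A z) (?B z) =
      D (?A z) (?B z) * (mtrace (?K z) * mtrace (dg N g * ?K z) + mtrace (dg N g * (L - ?K z * ?K z)))"
    if z: "z \<in> U" for z g
  proof (rule DERIV_unique)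
    show "((\<lambda>h. rowd N (\<lambda>i. g i * p i) D (?A h) (?B h)) has_field_derivative
        rowd N p (rowd N (\<lambda>i. g i * p i) D) (?A z) (?B z)) (at z)"
      by (intro flowableD flowable_rowd fD)
    show "((\<lambda>h. rowd N (\<lambda>i. g i * p i) D (?A h) (?B h)) has_field_derivative
       D (?A z) (?B z) * (mtrace (?K z) * mtrace (dg N g * ?K z) + mtrace (dg N g * (L - ?K z * ?K z)))) (at z)"
    proof (rule has_field_derivative_transform_within_open[OF _ U(1) z D1g[symmetric]])
      show "((\<lambda>h. D (?A h) (?B h) * mtrace (dg N g * ?K h)) has_field_derivative
       D (?A z) (?B z) * (mtrace (?K z) * mtrace (dg N g * ?K z) + mtrace (dg N g * (L - ?K z * ?K z)))) (at z)"
        by (rule derivative_eq_intros dD[OF z] dtr[OF z])+ (simp add: algebra_simps)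
    qed
  qed
  show "rowd N p (rowd N (\<lambda>i. g i * p i) D) A B =
      D A B * (mtrace K * mtrace (dg N g * K) + mtrace (dg N g * (L - K * K)))"
    using D2[OF U(2)] by (simp add: K_def)
  have trR: "mtrace (L - ?K h * ?K h) = mtrace L - mtrace (?K h * ?K h)" for h
    using Lc by (intro mtrace_diff[of _ N]) (auto intro!: mult_carrier_mat[of _ N N])
  have D2': "rowd N p (rowd N p D) (?A z) (?B z) =
      D (?A z) (?B z) * ((mtrace (?K z))\<^sup>2 + mtrace L - mtrace (?K z * ?K z))" if "z \<in> U" for z
    using D2[OF that, of "\<lambda>_. 1"] trR by (simp add: one R power2_eq_square)
  show "rowd N p (rowd N p (rowd N p D)) A B =
      D A B * (mtrace K ^ 3 + 3 * mtrace K * mtrace (L - K * K) - 2 * mtrace (K * (L - K * K)))"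
  proof (rule DERIV_unique)
    show "((\<lambda>h. rowd N p (rowd N p D) (?A h) (?B h)) has_field_derivative
        rowd N p (rowd N p (rowd N p D)) A B) (at 0)"
      using flowableD[OF flowable_rowd[OF flowable_rowd[OF fD, of p], of p], where \<omega> = p and A = A and B = B and z = 0] by simp
    show "((\<lambda>h. rowd N p (rowd N p D) (?A h) (?B h)) has_field_derivative
        D A B * (mtrace K ^ 3 + 3 * mtrace K * mtrace (L - K * K) - 2 * mtrace (K * (L - K * K)))) (at 0)"
    proof (rule has_field_derivative_transform_within_open[OF _ U D2'[symmetric]])
      have dsq: "((\<lambda>h. mtrace (?K h * ?K h)) has_field_derivative 2 * mtrace (?K 0 * (L - ?K 0 * ?K 0))) (at 0)"
        using dK[OF U(2)] R by (intro mtrace_square_deriv) auto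
      have q: "mtrace L = mtrace (L - K * K) + mtrace (K * K)" using trR[of 0] by (simp add: K_def)
      show "((\<lambda>h. D (?A h) (?B h) * ((mtrace (?K h))\<^sup>2 + mtrace L - mtrace (?K h * ?K h))) has_field_derivative
          D A B * (mtrace K ^ 3 + 3 * mtrace K * mtrace (L - K * K) - 2 * mtrace (K * (L - K * K)))) (at 0)"
        by (rule_tac derivative_eq_intros dD[OF U(2)] dtr1[OF U(2)] dsq refl)+
           (simp add: trR K_def[symmetric] q algebra_simps power2_eq_square power3_eq_cube)
    qed
  qed
qed

section \<open>Bilinear identities for non-singular matrices\<close>

lemma det_dg: "Determinant.det (dg N g) = (\<Prod>i<N. g i)"
proof -
  have "Determinant.det (dg N g) = prod_list (diag_mat (dg N g))"
    by (intro det_upper_triangular[of _ N]) (auto simp: upper_triangular_def dg_def)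
  then show ?thesis
    by (simp add: diag_mat_def prod.distinct_set_conv_list[symmetric] lessThan_atLeast0 dg_def)
qed

lemma dg_mult_dg: "dg N f * dg N g = dg N (\<lambda>i. f i * g i)"
proof (rule eq_matI)
  fix i j assume "i < dim_row (dg N (\<lambda>i. f i * g i))" "j < dim_col (dg N (\<lambda>i. f i * g i))"
  then have ij: "i < N" "j < N" by auto
  then show "(dg N f * dg N g) $$ (i, j) = dg N (\<lambda>i. f i * g i) $$ (i, j)"
    unfolding dg_mult_entry[OF dg_carrier(1) ij] by (simp add: dg_def)
qed auto

lemma rowd_cong: "(\<And>i. i < N \<Longrightarrow> \<omega> i = \<nu> i) \<Longrightarrow> rowd N \<omega> F = rowd N \<nu> F"
  unfolding rowd_def fun_eq_iff by auto

lemma cmat_cong: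
  "\<lbrakk>\<And>i. i < N \<Longrightarrow> A i = A' i; \<And>i. i < N \<Longrightarrow> B i = B' i\<rbrakk> \<Longrightarrow> cmat N p A B = cmat N p A' B'"
  unfolding cmat_def by (rule cong_mat) auto

text \<open>Taking p_i out of row i of M_x leaves the amplitudes with the sign of the second one
  reversed. Conjugation under the reality conditions reverses the same sign, which identifies the
  conjugate of tau with det M_x up to a constant.\<close>

lemma det_shift:
  "cdet N p (\<lambda>i. p i * \<alpha> i) (\<lambda>i. - p i * \<beta> i) = (\<Prod>i<N. p i) * cdet N p \<alpha> (\<lambda>i. - \<beta> i)"
proof -
  have "cmat N p (\<lambda>i. p i * \<alpha> i) (\<lambda>i. - p i * \<beta> i) = dg N p * cmat N p \<alpha> (\<lambda>i. - \<beta> i)"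
    unfolding dg_mult_cmat by (rule cmat_cong) auto
  then show ?thesis unfolding cdet_def by (simp add: det_mult[of _ N] det_dg)
qed

text \<open>By \<open>det_shift\<close>, the assumptions \<open>p\<close> and \<open>nz'\<close> say
  that M_x is invertible, hence so is K.\<close>

locale casorati =
  fixes N :: nat and p A B :: "nat \<Rightarrow> complex"
  assumes p: "\<And>i. i < N \<Longrightarrow> p i \<noteq> 0"
    and nz: "cdet N p A B \<noteq> 0"
    and nz': "cdet N p A (\<lambda>i. - B i) \<noteq> 0"
begin

abbreviation "\<D> \<equiv> cdet N p"
definition "M = cmat N p A B"
definition "M1 = cmat N p (\<lambda>i. p i * A i) (\<lambda>i. - p i * B i)"
definition "K = kmat N p A B"
definition "L = dg N (\<lambda>i. (p i)\<^sup>2)"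
definition "Li = dg N (\<lambda>i. inverse ((p i)\<^sup>2))"
definition "R = K * K - L"

lemma square [simp]: "X \<in> carrier_mat N N \<Longrightarrow> Y \<in> carrier_mat N N \<Longrightarrow> X * Y \<in> carrier_mat N N"
  "X \<in> carrier_mat N N \<Longrightarrow> Y \<in> carrier_mat N N \<Longrightarrow> X - Y \<in> carrier_mat N N"
  for X Y :: "complex Matrix.mat"
  by auto

lemma carriers [simp]:
  "M \<in> carrier_mat N N" "M1 \<in> carrier_mat N N" "K \<in> carrier_mat N N" "L \<in> carrier_mat N N"
  "Li \<in> carrier_mat N N" "R \<in> carrier_mat N N"
  by (auto simp: M_def M1_def K_def L_def Li_def R_def)

lemmas dims [simp] = carriers[THEN carrier_matD(1)] carriers[THEN carrier_matD(2)]

lemmas mat_assoc = assoc_mult_mat[of _ N N _ N _ N]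
lemmas mat_ring = ring_mat_simps[of _ N]

lemma det_mult': "X \<in> carrier_mat N N \<Longrightarrow> Y \<in> carrier_mat N N \<Longrightarrow>
    Determinant.det (X * Y) = Determinant.det X * Determinant.det Y"
  for X Y :: "complex Matrix.mat"
  by (rule det_mult)

lemma K_M: "K * M = M1"
  unfolding K_def M_def M1_def by (rule kmat_mult[OF nz])

lemma L_M: "L * M = cmat N p (\<lambda>i. p i * (p i * A i)) (\<lambda>i. - p i * (- p i * B i))"
  unfolding L_def M_def dg_mult_cmat by (rule cmat_cong) (simp_all add: power2_eq_square)

lemma Li_L: "Li * L = 1\<^sub>m N" "L * Li = 1\<^sub>m N"
  unfolding Li_def L_def dg_mult_dg using p by (auto simp: dg_def)

lemma det_L: "Determinant.det L = (\<Prod>i<N. p i)\<^sup>2"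
  unfolding L_def det_dg by (simp add: prod_power_distrib)

lemma prod_p: "(\<Prod>i<N. p i) \<noteq> 0" using p by auto

lemma nz1: "\<D> (\<lambda>i. p i * A i) (\<lambda>i. - p i * B i) \<noteq> 0"
  unfolding det_shift using prod_p nz' by simp

lemma det_M: "Determinant.det M = \<D> A B" "Determinant.det M1 = \<D> (\<lambda>i. p i * A i) (\<lambda>i. - p i * B i)"
  by (simp_all add: M_def M1_def cdet_def)

lemma det_K: "Determinant.det K * \<D> A B = (\<Prod>i<N. p i) * \<D> A (\<lambda>i. - B i)"
  using det_mult'[of K M] det_shift[of N p A B] by (simp add: K_M det_M)

lemma det_K_nz: "Determinant.det K \<noteq> 0"
  using det_K prod_p nz' by auto

text \<open>\<open>K\<close> maps each column of \<open>M\<close> but the last to the next one, and two such steps are multiplication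
  by \<open>\<Lambda> = L\<close>.\<close>

lemma R_M:
  assumes "i < N" "Suc j < N"
  shows "(R * M) $$ (i, j) = 0"
proof -
  have "(K * M1) $$ (i, j) = (\<Sum>k<N. K $$ (i, k) * M1 $$ (k, j))"
    using assms by (intro entry_mult) auto
  also have "\<dots> = (\<Sum>k<N. K $$ (i, k) * M $$ (k, Suc j))"
    using assms by (intro sum.cong) (auto simp: M_def M1_def cmat_entry)
  also have "\<dots> = (K * M) $$ (i, Suc j)"
    using assms by (intro entry_mult[symmetric]) auto
  also have "\<dots> = (L * M) $$ (i, j)"
    using assms unfolding K_M L_M by (simp add: M1_def cmat_entry)
  finally have "(K * M1) $$ (i, j) = (L * M) $$ (i, j)" .
  moreover have "R * M = K * M1 - L * M"
    unfolding R_def by (simp add: mat_ring K_M)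
  ultimately show ?thesis using assms by (simp del: index_mult_mat(1))
qed

text \<open>The amplitudes are left arbitrary because the formulas are applied at \<open>A\<close>,
  \<open>B\<close>, at the amplitudes of M_x and at those of a lattice neighbour.\<close>

lemma rowd_D:
  assumes "\<D> \<alpha> \<beta> \<noteq> 0"
  shows "rowd N p \<D> \<alpha> \<beta> = \<D> \<alpha> \<beta> * mtrace (kmat N p \<alpha> \<beta>)"
    "rowd N (\<lambda>i. p i ^ 3) \<D> \<alpha> \<beta> = \<D> \<alpha> \<beta> * mtrace (L * kmat N p \<alpha> \<beta>)"
    "rowd N (\<lambda>i. 1 / p i) \<D> \<alpha> \<beta> = \<D> \<alpha> \<beta> * mtrace (Li * kmat N p \<alpha> \<beta>)"
    "rowd N p (rowd N p \<D>) \<alpha> \<beta> = \<D> \<alpha> \<beta> * (mtrace (kmat N p \<alpha> \<beta>) ^ 2 +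
       mtrace (L - kmat N p \<alpha> \<beta> * kmat N p \<alpha> \<beta>))"
    "rowd N p (rowd N (\<lambda>i. 1 / p i) \<D>) \<alpha> \<beta> = \<D> \<alpha> \<beta> *
      (mtrace (kmat N p \<alpha> \<beta>) * mtrace (Li * kmat N p \<alpha> \<beta>) +
       mtrace (Li * (L - kmat N p \<alpha> \<beta> * kmat N p \<alpha> \<beta>)))"
proof -
  have inv: "rowd N (\<lambda>i. 1 / p i) F = rowd N (\<lambda>i. inverse ((p i)\<^sup>2) * p i) F" for F
    using p by (intro rowd_cong) (auto simp: power2_eq_square field_simps)
  have cube: "rowd N (\<lambda>i. p i ^ 3) F = rowd N (\<lambda>i. (p i)\<^sup>2 * p i) F" for F
    by (intro rowd_cong) (auto simp: power2_eq_square power3_eq_cube)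
  have one: "mtrace (dg N (\<lambda>_. 1) * X) = mtrace X" if "X \<in> carrier_mat N N" for X
    using that by (simp add: dg_one)
  show "rowd N (\<lambda>i. p i ^ 3) \<D> \<alpha> \<beta> = \<D> \<alpha> \<beta> * mtrace (L * kmat N p \<alpha> \<beta>)"
    "rowd N (\<lambda>i. 1 / p i) \<D> \<alpha> \<beta> = \<D> \<alpha> \<beta> * mtrace (Li * kmat N p \<alpha> \<beta>)"
    unfolding cube inv L_def Li_def using rowd_cdet_kmat[OF assms] by auto
  show "rowd N p \<D> \<alpha> \<beta> = \<D> \<alpha> \<beta> * mtrace (kmat N p \<alpha> \<beta>)"
    using rowd_cdet_kmat[OF assms, of "\<lambda>_. 1"] by (simp add: dg_one)
  show "rowd N p (rowd N p \<D>) \<alpha> \<beta> = \<D> \<alpha> \<beta> * (mtrace (kmat N p \<alpha> \<beta>) ^ 2 +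
       mtrace (L - kmat N p \<alpha> \<beta> * kmat N p \<alpha> \<beta>))"
    using rowd2_cdet[OF assms, of "\<lambda>_. 1"] by (simp add: one L_def power2_eq_square)
  show "rowd N p (rowd N (\<lambda>i. 1 / p i) \<D>) \<alpha> \<beta> = \<D> \<alpha> \<beta> *
      (mtrace (kmat N p \<alpha> \<beta>) * mtrace (Li * kmat N p \<alpha> \<beta>) +
       mtrace (Li * (L - kmat N p \<alpha> \<beta> * kmat N p \<alpha> \<beta>)))"
    unfolding inv using rowd2_cdet[OF assms] by (simp add: L_def Li_def)
qed

lemma left_dg_last:
  assumes "X \<in> carrier_mat N N" "\<And>i j. i < N \<Longrightarrow> Suc j < N \<Longrightarrow> X $$ (i, j) = 0" "i < N" "Suc j < N"
  shows "(dg N g * X) $$ (i, j) = 0"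
  using assms by (subst dg_mult_entry) auto

lemma tr_ops:
  "X \<in> carrier_mat N N \<Longrightarrow> Y \<in> carrier_mat N N \<Longrightarrow> mtrace (X + Y) = mtrace X + mtrace Y"
  "X \<in> carrier_mat N N \<Longrightarrow> Y \<in> carrier_mat N N \<Longrightarrow> mtrace (X - Y) = mtrace X - mtrace Y"
  "X \<in> carrier_mat N N \<Longrightarrow> mtrace (c \<cdot>\<^sub>m X) = c * mtrace X"
  by (rule mtrace_add mtrace_diff mtrace_smult; assumption)+

text \<open>From K^2 = L (1 + L^-1 R) with L^-1 R of rank one, (det K)^2 = det L (1 + tr (L^-1 R)).
  By \<open>det_K\<close> the left side is det L times the squared quotient of the determinants for
  \<open>A\<close>, \<open>- B\<close> and for \<open>A\<close>, \<open>B\<close>; the trace is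
  minus the mixed xy-derivative of log D.\<close>

lemma bilinear_xy:
  "\<D> A B * rowd N p (rowd N (\<lambda>i. 1 / p i) \<D>) A B - rowd N p \<D> A B * rowd N (\<lambda>i. 1 / p i) \<D> A B
     = (\<D> A B)\<^sup>2 - (\<D> A (\<lambda>i. - B i))\<^sup>2"
proof -
  have det1: "Determinant.det (1\<^sub>m N + Li * R) = 1 + mtrace (Li * R)"
  proof (rule det_one_add_rank_one[of _ N M])
    fix i j assume "i < N" "Suc j < N"
    then show "(Li * R * M) $$ (i, j) = 0"
      using left_dg_last[of "R * M" i j] R_M by (simp add: mat_assoc Li_def)
  qed (use nz det_M in auto)
  have "K * K = L * (1\<^sub>m N + Li * R)"
    by (simp add: mat_ring mat_assoc[symmetric] Li_L del: assoc_mult_mat)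
       (auto simp: R_def intro!: eq_matI)
  then have "(Determinant.det K)\<^sup>2 = (\<Prod>i<N. p i)\<^sup>2 * (1 + mtrace (Li * R))"
    using det_mult'[of K K] by (simp add: det_mult' det_L det1 power2_eq_square)
  then have "(\<Prod>i<N. p i)\<^sup>2 * (\<D> A (\<lambda>i. - B i))\<^sup>2 = (\<Prod>i<N. p i)\<^sup>2 * ((1 + mtrace (Li * R)) * (\<D> A B)\<^sup>2)"
    by (metis det_K mult.assoc power_mult_distrib)
  then have "(\<D> A (\<lambda>i. - B i))\<^sup>2 = (1 + mtrace (Li * R)) * (\<D> A B)\<^sup>2"
    using prod_p by simp
  moreover have "mtrace (Li * (L - K * K)) = - mtrace (Li * R)"
    unfolding R_def by (simp add: mat_ring tr_ops)
  ultimately show ?thesis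
    unfolding rowd_D[OF nz] K_def[symmetric] by (simp add: algebra_simps power2_eq_square)
qed

end

section \<open>The matrix of the conjugate, and the identities with x- and t-derivatives\<close>

context casorati
begin

definition "Ki = (SOME X. X \<in> carrier_mat N N \<and> K * X = 1\<^sub>m N \<and> X * K = 1\<^sub>m N)"

lemma Ki [simp]: "Ki \<in> carrier_mat N N" and K_Ki: "K * Ki = 1\<^sub>m N" and Ki_K: "Ki * K = 1\<^sub>m N"
proof -
  have "\<exists>X. X \<in> carrier_mat N N \<and> K * X = 1\<^sub>m N \<and> X * K = 1\<^sub>m N"
    using nonsingular_inverse[OF carriers(3) det_K_nz] by metis
  then have "Ki \<in> carrier_mat N N \<and> K * Ki = 1\<^sub>m N \<and> Ki * K = 1\<^sub>m N"
    unfolding Ki_def by (rule someI_ex)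
  then show "Ki \<in> carrier_mat N N" "K * Ki = 1\<^sub>m N" "Ki * K = 1\<^sub>m N" by auto
qed

text \<open>Since M_xx = L M = L K^-1 M_x, this is the logarithmic derivative matrix of M_x, the one
  that belongs to the conjugate of tau.\<close>

definition "K' = L * Ki"

lemma K'_carrier [simp]: "K' \<in> carrier_mat N N"
  by (simp add: K'_def)

lemma dim_K' [simp]: "dim_row K' = N" "dim_col K' = N"
  using K'_carrier by (auto simp del: K'_carrier)

lemma K'_K: "K' * K = L"
  by (simp add: K'_def mat_assoc Ki_K)

lemma kmat_shift: "kmat N p (\<lambda>i. p i * A i) (\<lambda>i. - p i * B i) = K'"
proof (rule kmatI[OF nz1 K'_carrier])
  have "K' * M1 = K' * K * M" by (simp only: K_M[symmetric] mat_assoc K'_carrier carriers)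
  then show "K' * cmat N p (\<lambda>i. p i * A i) (\<lambda>i. - p i * B i) =
      cmat N p (\<lambda>i. p i * (p i * A i)) (\<lambda>i. - p i * (- p i * B i))"
    unfolding M1_def K'_K L_M .
qed

text \<open>Q = K - K' satisfies Q M_x = (K^2 - L) M = R M, so it has rank one, and the traces of
  its square and cube are powers of its trace. Expanding these with K' K = L gives both
  formulas.\<close>

lemma trace_difference:
  "(mtrace K - mtrace K')\<^sup>2 = mtrace (K * K) - 2 * mtrace L + mtrace (K' * K')"
  "(mtrace K - mtrace K') ^ 3 = mtrace (K * (K * K)) - mtrace (K' * (K' * K'))
     - 3 * mtrace (L * K) + 3 * mtrace (L * K')"
proof -
  define Q where "Q = K - K'"
  have Q: "Q \<in> carrier_mat N N" by (simp add: Q_def)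
  have "Q * M1 = R * M"
    unfolding Q_def R_def by (simp add: mat_ring K'_K K_M[symmetric]) (simp add: mat_assoc[symmetric] K'_K del: assoc_mult_mat)
  then have QQ: "Q * Q = mtrace Q \<cdot>\<^sub>m Q"
    using square_rank_one[of Q N M1] Q R_M nz1 det_M by simp
  have sq: "Q * Q = K * K - K * K' - L + K' * K'"
    by (simp add: Q_def mat_ring K'_K) (auto intro!: eq_matI simp del: index_mult_mat(1))
  \<comment> \<open>The order matters: K' K is \<open>L\<close>, whereas of K K' only the trace is
    known.\<close>
  have comm: "mtrace (K * K') = mtrace L" using mtrace_comm[of K N K'] by (simp add: K'_K)
  have trQ: "mtrace Q = mtrace K - mtrace K'" by (simp add: Q_def tr_ops)
  have "mtrace (Q * Q) = (mtrace Q)\<^sup>2"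
    unfolding QQ using Q by (simp add: tr_ops power2_eq_square)
  then show "(mtrace K - mtrace K')\<^sup>2 = mtrace (K * K) - 2 * mtrace L + mtrace (K' * K')"
    unfolding sq using trQ comm by (simp add: tr_ops)
  have "mtrace (Q * Q * Q) = mtrace Q ^ 3"
    using Q QQ by (simp add: tr_ops mult_smult_assoc_mat[of _ N N _ N] power3_eq_cube)
  moreover have "Q * Q * Q = K * (K * K) - K * (K * K') - K * L + K * (K' * K') - L * K + L * K' + K' * L - K' * (K' * K')"
    unfolding sq by (simp add: Q_def mat_ring K'_K) (auto intro!: eq_matI simp del: index_mult_mat(1))
  moreover have "mtrace (K * (K * K')) = mtrace (L * K)"
    using mtrace_comm[of "K * K" N K'] by (simp add: mat_assoc K'_K mat_assoc[symmetric, of K' K K] del: assoc_mult_mat)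
  moreover have "mtrace (K * (K' * K')) = mtrace (L * K')"
    using mtrace_comm[of K N "K' * K'"] mtrace_comm[of K' N L] by (simp add: mat_assoc K'_K)
  moreover have "mtrace (K * L) = mtrace (L * K)" "mtrace (K' * L) = mtrace (L * K')"
    using mtrace_comm[of K N L] mtrace_comm[of K' N L] by simp_all
  ultimately show "(mtrace K - mtrace K') ^ 3 = mtrace (K * (K * K)) - mtrace (K' * (K' * K'))
     - 3 * mtrace (L * K) + 3 * mtrace (L * K')"
    using trQ by (simp add: tr_ops algebra_simps)
qed

abbreviation "A1 \<equiv> \<lambda>i. p i * A i"
abbreviation "B1 \<equiv> \<lambda>i. - p i * B i"

text \<open>After division by both determinants there remains (tr K - tr K')^2 + tr (L - K^2) + tr
  (L - K'^2), which vanishes by the quadratic trace identity.\<close>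

lemma bilinear_xx:
  "rowd N p (rowd N p \<D>) A B * \<D> A1 B1 - 2 * rowd N p \<D> A B * rowd N p \<D> A1 B1
     + \<D> A B * rowd N p (rowd N p \<D>) A1 B1 = 0"
proof -
  have q: "mtrace (L - K' * K') = - (mtrace K - mtrace K')\<^sup>2 - mtrace (L - K * K)"
    unfolding trace_difference by (simp add: tr_ops)
  have "\<D> A B * \<D> A1 B1 * ((mtrace K ^ 2 + mtrace (L - K * K)) - 2 * mtrace K * mtrace K' +
     (mtrace K' ^ 2 + mtrace (L - K' * K'))) = 0"
    unfolding q by (simp add: algebra_simps power2_eq_square)
  then show ?thesis
    unfolding rowd_D[OF nz] rowd_D[OF nz1] kmat_shift K_def[symmetric]
    by (simp only: algebra_simps)
qed

text \<open>The cubic trace identity enters here. It leaves 4 (tr (L K) - tr (L K')), which the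
  coefficient -4 of p^3 t in the phase is made to cancel.\<close>

lemma bilinear_xxx_t:
  "rowd N p (rowd N p (rowd N p \<D>)) A B * \<D> A1 B1 - 3 * rowd N p (rowd N p \<D>) A B * rowd N p \<D> A1 B1
     + 3 * rowd N p \<D> A B * rowd N p (rowd N p \<D>) A1 B1 - \<D> A B * rowd N p (rowd N p (rowd N p \<D>)) A1 B1
     - 4 * (rowd N (\<lambda>i. p i ^ 3) \<D> A B * \<D> A1 B1 - \<D> A B * rowd N (\<lambda>i. p i ^ 3) \<D> A1 B1) = 0"
proof -
  define k k' q q' c c' l l' where "k = mtrace K" and "k' = mtrace K'"
    and "q = mtrace (L - K * K)" and "q' = mtrace (L - K' * K')"
    and "c = mtrace (K * (L - K * K))" and "c' = mtrace (K' * (L - K' * K'))"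
    and "l = mtrace (L * K)" and "l' = mtrace (L * K')"
  note defs = k_def k'_def q_def q'_def c_def c'_def l_def l'_def
  have q: "q' = - (k - k')\<^sup>2 - q"
    unfolding defs trace_difference by (simp add: tr_ops)
  have "mtrace (K * L) = mtrace (L * K)" "mtrace (K' * L) = mtrace (L * K')"
    using mtrace_comm[of K N L] mtrace_comm[of K' N L] by simp_all
  then have c: "c' = c + (k - k') ^ 3 + 2 * l - 2 * l'"
    unfolding defs trace_difference by (simp add: mat_ring tr_ops)
  have "(k ^ 3 + 3 * k * q - 2 * c) - 3 * (k\<^sup>2 + q) * k' + 3 * k * (k'\<^sup>2 + q') - (k' ^ 3 + 3 * k' * q' - 2 * c')
      - 4 * (l - l') = 0"
    unfolding c q by (simp add: algebra_simps power2_eq_square power3_eq_cube)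
  then have "\<D> A B * \<D> A1 B1 * ((k ^ 3 + 3 * k * q - 2 * c) - 3 * (k\<^sup>2 + q) * k' + 3 * k * (k'\<^sup>2 + q')
      - (k' ^ 3 + 3 * k' * q' - 2 * c') - 4 * (l - l')) = 0" by simp
  then show ?thesis
    unfolding rowd_D[OF nz] rowd_D[OF nz1] rowd3_cdet[OF nz] rowd3_cdet[OF nz1] kmat_shift
      K_def[symmetric] L_def[symmetric] defs
    by (simp only: algebra_simps)
qed

end

text \<open>A lattice step downwards: with \<open>c\<close> equal to a_n for \<open>A\<close> and to
  - a_n for \<open>B\<close>, it leads from site n + 1 to site n. In this direction the step is
  polynomial, and on M it is left multiplication by 1 - a_n K.\<close>

definition damp :: "(nat \<Rightarrow> complex) \<Rightarrow> complex \<Rightarrow> (nat \<Rightarrow> complex) \<Rightarrow> nat \<Rightarrow> complex" where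
  "damp p c A = (\<lambda>i. (1 - c * p i) * A i)"

context casorati
begin

definition "W c = 1\<^sub>m N - c \<cdot>\<^sub>m K"

lemma W_carrier [simp]: "W c \<in> carrier_mat N N" and dim_W [simp]: "dim_row (W c) = N" "dim_col (W c) = N"
  by (auto simp: W_def)

lemma W_M: "W c * M = cmat N p (damp p c A) (damp p (- c) B)"
proof -
  have "W c * M = M - c \<cdot>\<^sub>m M1"
    unfolding W_def by (simp add: mat_ring K_M)
  then show ?thesis
    by (auto intro!: eq_matI simp: M_def M1_def cmat_entry damp_def algebra_simps)
qed

text \<open>This is M_x - c M_xx, the x-derivative of the matrix after the step, so its determinant
  carries the conjugate of tau at the lower site.\<close>

lemma KL_M: "(K - c \<cdot>\<^sub>m L) * M = cmat N p (\<lambda>i. p i * damp p c A i) (\<lambda>i. - p i * damp p (- c) B i)"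
proof -
  have "(K - c \<cdot>\<^sub>m L) * M = M1 - c \<cdot>\<^sub>m (L * M)"
    by (simp add: mat_ring K_M)
  then show ?thesis unfolding L_M
    by (auto intro!: eq_matI simp: M1_def cmat_entry damp_def algebra_simps)
qed

lemma det_W: "Determinant.det (W c) * \<D> A B = \<D> (damp p c A) (damp p (- c) B)"
  using det_mult'[of "W c" M] by (simp add: W_M det_M cdet_def)

lemma det_KL: "Determinant.det (K - c \<cdot>\<^sub>m L) * \<D> A B =
    (\<Prod>i<N. p i) * \<D> (damp p c A) (\<lambda>i. - damp p (- c) B i)"
  using det_mult'[of "K - c \<cdot>\<^sub>m L" M] by (simp add: KL_M det_M flip: det_shift) (simp add: cdet_def)

lemma K_W: "K * W c = W c * K"
  unfolding W_def by (simp add: mat_ring)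

lemma inverse_commute:
  fixes X Y Z :: "complex Matrix.mat"
  assumes "X \<in> carrier_mat N N" "Y \<in> carrier_mat N N" "Z \<in> carrier_mat N N"
    and "X * Y = 1\<^sub>m N" "Y * X = 1\<^sub>m N" "X * Z = Z * X"
  shows "Y * Z = Z * Y"
proof -
  have "Y * Z = Y * Z * (X * Y)" using assms by simp
  also have "\<dots> = Y * (Z * X) * Y" using assms(1-3) by (simp add: mat_assoc)
  also have "\<dots> = Y * (X * Z) * Y" using assms by simp
  also have "\<dots> = (Y * X) * (Z * Y)" using assms(1-3) by (simp add: mat_assoc)
  finally show ?thesis using assms by simp
qed

text \<open>The logarithmic derivative matrix of the neighbour is K2 = (K - c L) W^-1, and K - K2 =
  - c R W^-1; its trace against \<open>Li\<close> is the difference of the logarithmic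
  y-derivatives. The two conjugate determinants come from (K - c L) K = L W + R = L (1 + L^-1 R
  W^-1) W, which involves the same rank one matrix L^-1 R W^-1.\<close>

lemma bilinear_y_step:
  assumes nzc: "\<D> (damp p c A) (damp p (- c) B) \<noteq> 0"
  shows "rowd N (\<lambda>i. 1 / p i) \<D> A B * \<D> (damp p c A) (damp p (- c) B)
      - \<D> A B * rowd N (\<lambda>i. 1 / p i) \<D> (damp p c A) (damp p (- c) B)
      = c * (\<D> A B * \<D> (damp p c A) (damp p (- c) B)
          - \<D> A (\<lambda>i. - B i) * \<D> (damp p c A) (\<lambda>i. - damp p (- c) B i))"
proof -
  let ?D' = "\<D> (damp p c A) (damp p (- c) B)"
  have dW: "Determinant.det (W c) \<noteq> 0" using det_W[of c] nzc by auto
  then obtain V where V [simp]: "V \<in> carrier_mat N N" and WV: "W c * V = 1\<^sub>m N" and VW: "V * W c = 1\<^sub>m N"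
    using nonsingular_inverse[of "W c" N] by auto
  have VK: "V * K = K * V"
    by (rule inverse_commute[of "W c"]) (simp_all add: WV VW K_W)
  define K2 where "K2 = (K - c \<cdot>\<^sub>m L) * V"
  have K2 [simp]: "K2 \<in> carrier_mat N N" by (simp add: K2_def)
  have K2W: "K2 * W c = K - c \<cdot>\<^sub>m L" by (simp add: K2_def mat_assoc VW)
  have k2: "kmat N p (damp p c A) (damp p (- c) B) = K2"
  proof (rule kmatI[OF nzc K2])
    have "K2 * (W c * M) = K2 * W c * M" by (simp add: mat_assoc)
    then show "K2 * cmat N p (damp p c A) (damp p (- c) B) =
        cmat N p (\<lambda>i. p i * damp p c A i) (\<lambda>i. - p i * damp p (- c) B i)"
      unfolding W_M K2W KL_M .
  qed
  have "(K - K2) * W c = - c \<cdot>\<^sub>m R"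
    unfolding minus_mult_distrib_mat[OF carriers(3) K2 W_carrier] K2W
    by (simp add: W_def R_def mat_ring) (auto intro!: eq_matI simp: algebra_simps simp del: index_mult_mat(1))
  then have "K - K2 = - c \<cdot>\<^sub>m (R * V)"
    using mat_assoc[of "K - K2" "W c" V] WV right_mult_one_mat[of "K - K2" N N]
    by (simp add: mult_smult_assoc_mat[of _ N N _ N])
  then have "mtrace (Li * (K - K2)) = - c * mtrace (Li * (R * V))"
    by (simp add: mult_smult_distrib[of _ N N _ N] tr_ops del: uminus_mat_def)
  then have tr: "mtrace (Li * K) - mtrace (Li * K2) = - c * mtrace (Li * (R * V))"
    by (simp add: mat_ring tr_ops)
  have det1: "Determinant.det (1\<^sub>m N + Li * (R * V)) = 1 + mtrace (Li * (R * V))"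
  proof (rule det_one_add_rank_one[of _ N "W c * M"])
    fix i j assume "i < N" "Suc j < N"
    moreover have "Li * (R * V) * (W c * M) = Li * (R * (V * W c) * M)"
      by (simp add: mat_assoc)
    ultimately show "(Li * (R * V) * (W c * M)) $$ (i, j) = 0"
      using left_dg_last[of "R * M" i j] R_M by (simp add: VW Li_def)
  qed (use dW nz det_M in \<open>auto simp: det_mult'\<close>)
  have "L * (1\<^sub>m N + Li * (R * V)) * W c = L * W c + (L * Li) * (R * (V * W c))"
    by (simp add: mat_ring)
  also have "\<dots> = L * W c + R"
    by (simp add: Li_L VW)
  also have "\<dots> = (K - c \<cdot>\<^sub>m L) * K"
    by (simp add: W_def R_def mat_ring) (auto intro!: eq_matI simp: algebra_simps simp del: index_mult_mat(1))
  finally have eq: "Determinant.det ((K - c \<cdot>\<^sub>m L) * K) = Determinant.det (L * (1\<^sub>m N + Li * (R * V)) * W c)"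
    by (simp only:)
  have "Determinant.det (K - c \<cdot>\<^sub>m L) * Determinant.det K =
      (\<Prod>i<N. p i)\<^sup>2 * (1 + mtrace (Li * (R * V))) * Determinant.det (W c)"
  proof -
    have "Determinant.det ((K - c \<cdot>\<^sub>m L) * K) = Determinant.det (K - c \<cdot>\<^sub>m L) * Determinant.det K"
      by (rule det_mult') auto
    moreover have "Determinant.det (L * (1\<^sub>m N + Li * (R * V)) * W c) =
        Determinant.det (L * (1\<^sub>m N + Li * (R * V))) * Determinant.det (W c)"
      by (rule det_mult') auto
    moreover have "Determinant.det (L * (1\<^sub>m N + Li * (R * V))) =
        Determinant.det L * Determinant.det (1\<^sub>m N + Li * (R * V))"
      by (rule det_mult') auto
    ultimately show ?thesis using eq by (simp only: det1 det_L)
  qed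
  then have "(Determinant.det (K - c \<cdot>\<^sub>m L) * \<D> A B) * (Determinant.det K * \<D> A B) =
      (\<Prod>i<N. p i)\<^sup>2 * ((1 + mtrace (Li * (R * V))) * (Determinant.det (W c) * \<D> A B) * \<D> A B)"
    by (simp add: algebra_simps)
  then have "\<D> (damp p c A) (\<lambda>i. - damp p (- c) B i) * \<D> A (\<lambda>i. - B i) = (1 + mtrace (Li * (R * V))) * ?D' * \<D> A B"
    unfolding det_KL det_K det_W using prod_p by (simp add: power2_eq_square)
  then have g: "\<D> A (\<lambda>i. - B i) * \<D> (damp p c A) (\<lambda>i. - damp p (- c) B i) =
      (1 + mtrace (Li * (R * V))) * ?D' * \<D> A B" by (simp only: mult.commute)
  have "rowd N (\<lambda>i. 1 / p i) \<D> A B * ?D' - \<D> A B * rowd N (\<lambda>i. 1 / p i) \<D> (damp p c A) (damp p (- c) B)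
    = \<D> A B * ?D' * (mtrace (Li * K) - mtrace (Li * K2))"
    unfolding rowd_D[OF nz] rowd_D[OF nzc] k2 K_def[symmetric] by (simp only: algebra_simps)
  then show ?thesis unfolding tr g by (simp add: algebra_simps)
qed

text \<open>Besides K, W a and W b, the determinants of K - c L for c = a, b and of 1 - (a + b) K +
  a b L occur. These matrices are K W c + c R and W a W b - a b R, invertible products plus a
  multiple of R, so each determinant contributes a single trace; a resolvent identity relates the
  three traces linearly.\<close>

lemma bilinear_lattice:
  assumes nza: "\<D> (damp p a A) (damp p (- a) B) \<noteq> 0" and nzb: "\<D> (damp p b A) (damp p (- b) B) \<noteq> 0"
  shows "b * \<D> (damp p a A) (\<lambda>i. - damp p (- a) B i) * \<D> (damp p b A) (damp p (- b) B)
     - a * \<D> (damp p b A) (\<lambda>i. - damp p (- b) B i) * \<D> (damp p a A) (damp p (- a) B)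
     + (a - b) * \<D> A (\<lambda>i. - B i) * \<D> (damp p b (damp p a A)) (damp p (- b) (damp p (- a) B)) = 0"
proof -
  have inv: "\<exists>V. V \<in> carrier_mat N N \<and> W c * V = 1\<^sub>m N \<and> V * W c = 1\<^sub>m N"
    if "\<D> (damp p c A) (damp p (- c) B) \<noteq> 0" for c
    using nonsingular_inverse[of "W c" N] det_W[of c] that by (metis W_carrier mult_eq_0_iff)
  obtain Va where Va [simp]: "Va \<in> carrier_mat N N" and WVa: "W a * Va = 1\<^sub>m N" and VWa: "Va * W a = 1\<^sub>m N"
    using inv[OF nza] by auto
  obtain Vb where Vb [simp]: "Vb \<in> carrier_mat N N" and WVb: "W b * Vb = 1\<^sub>m N" and VWb: "Vb * W b = 1\<^sub>m N"
    using inv[OF nzb] by auto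
  \<comment> \<open>Rank one update: once \<open>X\<close> is taken out on the right, s R X^-1 maps
    every column of X M but the last to 0, because R does so for the columns of M.\<close>
  have rank: "Determinant.det (X + s \<cdot>\<^sub>m R) = (1 + s * mtrace (R * Y)) * Determinant.det X"
    if X [simp]: "X \<in> carrier_mat N N" and Y [simp]: "Y \<in> carrier_mat N N"
      and XY: "X * Y = 1\<^sub>m N" and YX: "Y * X = 1\<^sub>m N" for X Y s
  proof -
    have "Determinant.det X * Determinant.det Y = 1"
      using det_mult'[OF X Y] XY by simp
    then have dX: "Determinant.det X \<noteq> 0" by auto
    have "Determinant.det (1\<^sub>m N + s \<cdot>\<^sub>m (R * Y)) = 1 + mtrace (s \<cdot>\<^sub>m (R * Y))"
    proof (rule det_one_add_rank_one[of _ N "X * M"])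
      fix i j assume ij: "i < N" "Suc j < N"
      have "s \<cdot>\<^sub>m (R * Y) * (X * M) = s \<cdot>\<^sub>m (R * (Y * X) * M)"
        by (simp add: mat_assoc mult_smult_assoc_mat[of _ N N _ N])
      then show "(s \<cdot>\<^sub>m (R * Y) * (X * M)) $$ (i, j) = 0"
        using R_M[OF ij] ij by (simp add: YX del: index_mult_mat(1))
    qed (use dX nz det_M in \<open>auto simp: det_mult'\<close>)
    moreover have "X + s \<cdot>\<^sub>m R = (1\<^sub>m N + s \<cdot>\<^sub>m (R * Y)) * X"
      by (simp add: mat_ring YX left_mult_one_mat[OF X])
    ultimately show ?thesis by (simp add: det_mult' tr_ops)
  qed
  have KVa: "Va * K = K * Va" and KVb: "Vb * K = K * Vb"
    by (rule inverse_commute[of "W a"] inverse_commute[of "W b"]; simp add: WVa VWa WVb VWb K_W)+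
  have KiVa: "Ki * Va = Va * Ki" and KiVb: "Ki * Vb = Vb * Ki"
    by (rule inverse_commute[of K]; simp add: K_Ki Ki_K KVa KVb)+
  define ta tb tab where "ta = mtrace (R * (Va * Ki))" and "tb = mtrace (R * (Vb * Ki))"
    and "tab = mtrace (R * (Va * Vb))"
  have KL: "Determinant.det (K - c \<cdot>\<^sub>m L) = (1 + c * mtrace (R * (V * Ki))) * (Determinant.det K * Determinant.det (W c))"
    if [simp]: "V \<in> carrier_mat N N" and WV: "W c * V = 1\<^sub>m N" and VW: "V * W c = 1\<^sub>m N" for c V
  proof -
    have VK: "V * K = K * V" by (rule inverse_commute[of "W c"]) (simp_all add: WV VW K_W)
    have "K - c \<cdot>\<^sub>m L = K * W c + c \<cdot>\<^sub>m R"
      by (simp add: W_def R_def mat_ring) (auto intro!: eq_matI simp: algebra_simps simp del: index_mult_mat(1))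
    moreover have "K * W c * (V * Ki) = K * (W c * V) * Ki" "V * Ki * (K * W c) = V * (Ki * K) * W c"
      by (simp_all add: mat_assoc)
    ultimately show ?thesis
      using rank[of "K * W c" "V * Ki" c] right_mult_one_mat[OF that(1)]
      by (simp add: WV VW K_Ki Ki_K det_mult')
  qed
  have Wab: "W a * W b + (- (a * b)) \<cdot>\<^sub>m R = 1\<^sub>m N - (a + b) \<cdot>\<^sub>m K + (a * b) \<cdot>\<^sub>m L"
    by (simp add: W_def R_def mat_ring) (auto intro!: eq_matI simp: algebra_simps simp del: index_mult_mat(1))
  have WWc: "W a * W b = W b * W a"
    by (simp add: W_def mat_ring) (auto intro!: eq_matI simp: algebra_simps simp del: index_mult_mat(1))
  have "Va * Vb * (W b * W a) = Va * (Vb * W b) * W a" "W b * W a * (Va * Vb) = W b * (W a * Va) * Vb"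
    by (simp_all add: mat_assoc)
  then have inv_ab: "W a * W b * (Va * Vb) = 1\<^sub>m N" "Va * Vb * (W a * W b) = 1\<^sub>m N"
    by (simp_all add: WWc VWa VWb WVa WVb right_mult_one_mat[OF Va])
  have Dab: "Determinant.det (1\<^sub>m N - (a + b) \<cdot>\<^sub>m K + (a * b) \<cdot>\<^sub>m L) =
      (1 - a * b * tab) * (Determinant.det (W a) * Determinant.det (W b))"
    using rank[of "W a * W b" "Va * Vb" "- (a * b)"] inv_ab unfolding Wab[symmetric]
    by (simp add: det_mult' tab_def)
  have "(1\<^sub>m N - (a + b) \<cdot>\<^sub>m K + (a * b) \<cdot>\<^sub>m L) * M = M - (a + b) \<cdot>\<^sub>m M1 + (a * b) \<cdot>\<^sub>m (L * M)"
    by (simp add: mat_ring K_M)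
  also have "\<dots> = cmat N p (damp p b (damp p a A)) (damp p (- b) (damp p (- a) B))"
    unfolding L_M by (auto intro!: eq_matI simp: M_def M1_def cmat_entry damp_def algebra_simps)
  finally have MD: "Determinant.det (1\<^sub>m N - (a + b) \<cdot>\<^sub>m K + (a * b) \<cdot>\<^sub>m L) * \<D> A B =
      \<D> (damp p b (damp p a A)) (damp p (- b) (damp p (- a) B))"
    by (subst det_M(1)[symmetric], subst det_mult'[symmetric]) (auto simp: cdet_def)
  \<comment> \<open>Resolvent identity: W a and W b differ by a multiple of K, so their inverses
    differ by a multiple of Va Vb K, and \<open>Ki\<close> removes the K.\<close>
  have "Va - Vb = Va * (W b * Vb) - (Va * W a) * Vb" by (simp add: WVb VWa right_mult_one_mat[OF Va] left_mult_one_mat[OF Vb])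
  also have "\<dots> = Va * (W b - W a) * Vb" by (simp add: mat_ring)
  also have "W b - W a = (a - b) \<cdot>\<^sub>m K"
    by (auto simp: W_def algebra_simps intro!: eq_matI)
  also have "Va * ((a - b) \<cdot>\<^sub>m K) * Vb = (a - b) \<cdot>\<^sub>m (Va * Vb * K)"
    by (simp add: mat_ring KVb)
  finally have "(Va - Vb) * Ki = (a - b) \<cdot>\<^sub>m (Va * Vb * K) * Ki" by simp
  also have "\<dots> = (a - b) \<cdot>\<^sub>m (Va * Vb)"
    by (simp add: mat_ring K_Ki right_mult_one_mat[OF Vb])
  finally have "mtrace (R * ((Va - Vb) * Ki)) = (a - b) * tab"
    by (simp add: mult_smult_distrib[of _ N N _ N] tr_ops tab_def)
  then have t: "ta = tb + (a - b) * tab"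
    by (simp add: mat_ring tr_ops ta_def tb_def) (simp add: algebra_simps)
  define \<pi> g ga gb \<tau>a \<tau>b \<tau>ab where "\<pi> = (\<Prod>i<N. p i)" and "g = \<D> A (\<lambda>i. - B i)"
    and "ga = \<D> (damp p a A) (\<lambda>i. - damp p (- a) B i)" and "gb = \<D> (damp p b A) (\<lambda>i. - damp p (- b) B i)"
    and "\<tau>a = \<D> (damp p a A) (damp p (- a) B)" and "\<tau>b = \<D> (damp p b A) (damp p (- b) B)"
    and "\<tau>ab = \<D> (damp p b (damp p a A)) (damp p (- b) (damp p (- a) B))"
  note defs = \<pi>_def g_def ga_def gb_def \<tau>a_def \<tau>b_def \<tau>ab_def
  define dK da db d where "dK = Determinant.det K" and "da = Determinant.det (W a)"
    and "db = Determinant.det (W b)" and "d = \<D> A B"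
  have ga: "\<pi> * ga = (1 + a * ta) * (dK * da) * d"
    unfolding defs det_KL[symmetric] KL[OF Va WVa VWa] by (simp add: ta_def dK_def da_def d_def)
  have gb: "\<pi> * gb = (1 + b * tb) * (dK * db) * d"
    unfolding defs det_KL[symmetric] KL[OF Vb WVb VWb] by (simp add: tb_def dK_def db_def d_def)
  have g: "\<pi> * g = dK * d" using det_K by (simp add: defs dK_def d_def)
  have \<tau>: "\<tau>a = da * d" "\<tau>b = db * d" using det_W[of a] det_W[of b] by (simp_all add: defs da_def db_def d_def)
  have \<tau>ab: "\<tau>ab = (1 - a * b * tab) * (da * db) * d"
    using MD unfolding Dab by (simp add: defs da_def db_def d_def)
  have "\<pi> * (b * ga * \<tau>b - a * gb * \<tau>a + (a - b) * g * \<tau>ab) =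
      b * (\<pi> * ga) * \<tau>b - a * (\<pi> * gb) * \<tau>a + (a - b) * (\<pi> * g) * \<tau>ab"
    by (simp add: algebra_simps)
  also have "\<dots> = 0"
    unfolding ga gb g \<tau> \<tau>ab t by (simp add: algebra_simps)
  finally show ?thesis using prod_p unfolding defs by simp
qed

end

section \<open>Removing the non-singularity conditions\<close>

text \<open>A kernel vector is the coefficient list of a polynomial of degree below \<open>N\<close>
  that vanishes at the \<open>N\<close> distinct points \<open>q i\<close>.\<close>

lemma vandermonde_nonzero:
  assumes "inj_on q {..<N}" "\<And>i. i < N \<Longrightarrow> g i \<noteq> 0"
  shows "cdet N q g (\<lambda>_. 0) \<noteq> 0"
proof
  assume "cdet N q g (\<lambda>_. 0) = 0"
  then obtain v where v: "v \<in> carrier_vec N" "v \<noteq> 0\<^sub>v N" "cmat N q g (\<lambda>_. 0) *\<^sub>v v = 0\<^sub>v N"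
    unfolding cdet_def using det_0_iff_vec_prod_zero_field[OF cmat_carrier, of N q g "\<lambda>_. 0"] by auto
  define f where "f = (\<Sum>j<N. Polynomial.monom (Matrix.vec_index v j) j)"
  have root: "poly f (q i) = 0" if "i < N" for i
  proof -
    have "Matrix.vec_index (cmat N q g (\<lambda>_. 0) *\<^sub>v v) i = (\<Sum>j<N. g i * q i ^ j * Matrix.vec_index v j)"
      using that v(1) by (auto simp: scalar_prod_def cmat_entry lessThan_atLeast0 intro!: sum.cong)
    also have "\<dots> = g i * poly f (q i)"
      by (simp add: f_def poly_sum poly_monom sum_distrib_left algebra_simps)
    finally show ?thesis using v(3) that assms(2) by simp
  qed
  have coeff: "poly.coeff f j = (if j < N then Matrix.vec_index v j else 0)" for j
    by (simp add: f_def coeff_sum)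
  have "f = 0"
  proof (rule ccontr)
    assume "f \<noteq> 0"
    then have "degree f < N"
      using coeff by (metis leading_coeff_0_iff)
    moreover have "q ` {..<N} \<subseteq> {x. poly f x = 0}" using root by auto
    then have "card (q ` {..<N}) \<le> card {x. poly f x = 0}"
      by (intro card_mono poly_roots_finite \<open>f \<noteq> 0\<close>)
    then have "N \<le> degree f"
      using card_image[OF assms(1)] card_poly_roots_bound[OF \<open>f \<noteq> 0\<close>] by simp
    ultimately show False by simp
  qed
  then have "Matrix.vec_index v j = 0" if "j < N" for j using coeff[of j] that by simp
  then have "v = 0\<^sub>v N" using v(1) by (intro eq_vecI) auto
  with v(2) show False by simp
qed

section \<open>Polynomial dependence on the parameters and passage to the limit\<close>

definition polyfun :: "(complex \<Rightarrow> complex) \<Rightarrow> bool" where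
  "polyfun f \<longleftrightarrow> (\<exists>P. f = poly P)"

lemma polyfun_intros:
  shows polyfun_const: "polyfun (\<lambda>_. c)"
    and polyfun_id: "polyfun (\<lambda>z. z)"
    and polyfun_add: "polyfun f \<Longrightarrow> polyfun g \<Longrightarrow> polyfun (\<lambda>z. f z + g z)"
    and polyfun_diff: "polyfun f \<Longrightarrow> polyfun g \<Longrightarrow> polyfun (\<lambda>z. f z - g z)"
    and polyfun_uminus: "polyfun f \<Longrightarrow> polyfun (\<lambda>z. - f z)"
    and polyfun_mult: "polyfun f \<Longrightarrow> polyfun g \<Longrightarrow> polyfun (\<lambda>z. f z * g z)"
    and polyfun_power: "polyfun f \<Longrightarrow> polyfun (\<lambda>z. f z ^ n)"
proof -
  show "polyfun (\<lambda>_. c)" unfolding polyfun_def by (intro exI[of _ "[:c:]"]) auto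
  show "polyfun (\<lambda>z. z)" unfolding polyfun_def by (intro exI[of _ "[:0, 1:]"]) auto
  assume "polyfun f"
  then obtain P where P: "f = poly P" unfolding polyfun_def by auto
  show "polyfun (\<lambda>z. - f z)" unfolding polyfun_def P by (intro exI[of _ "- P"]) auto
  show "polyfun (\<lambda>z. f z ^ n)" unfolding polyfun_def P by (intro exI[of _ "P ^ n"]) auto
  assume "polyfun g"
  then obtain Q where Q: "g = poly Q" unfolding polyfun_def by auto
  show "polyfun (\<lambda>z. f z + g z)" unfolding polyfun_def P Q by (intro exI[of _ "P + Q"]) auto
  show "polyfun (\<lambda>z. f z - g z)" unfolding polyfun_def P Q by (intro exI[of _ "P - Q"]) auto
  show "polyfun (\<lambda>z. f z * g z)" unfolding polyfun_def P Q by (intro exI[of _ "P * Q"]) auto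
qed

lemma polyfun_sum: "(\<And>i. i \<in> S \<Longrightarrow> polyfun (f i)) \<Longrightarrow> polyfun (\<lambda>z. \<Sum>i\<in>S. f i z)"
  by (induction S rule: infinite_finite_induct) (auto intro: polyfun_intros)

lemma polyfun_prod: "(\<And>i. i \<in> S \<Longrightarrow> polyfun (f i)) \<Longrightarrow> polyfun (\<lambda>z. \<Prod>i\<in>S. f i z)"
  by (induction S rule: infinite_finite_induct) (auto intro: polyfun_intros)

text \<open>Explicit in the parameters, so that polynomial dependence, continuity and conjugation
  can each be read off term by term.\<close>

lemma cdet_leibniz:
  "cdet N p A B = (\<Sum>\<pi> | \<pi> permutes {0..<N}. signof \<pi> * (\<Prod>i = 0..<N. A i * p i ^ \<pi> i + B i * (- p i) ^ \<pi> i))"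
  unfolding cdet_def det_def'[OF cmat_carrier]
proof (intro sum.cong refl arg_cong2[of _ _ _ _ "(*)"] prod.cong)
  fix \<pi> i assume "\<pi> \<in> {\<pi>. \<pi> permutes {0..<N}}" "i \<in> {0..<N}"
  then show "cmat N p A B $$ (i, \<pi> i) = A i * p i ^ \<pi> i + B i * (- p i) ^ \<pi> i"
    using permutes_in_image[of \<pi> "{0..<N}" i] by (intro cmat_entry) auto
qed

lemma polyfun_cdet:
  assumes "\<And>i. i < N \<Longrightarrow> polyfun (\<lambda>z. p z i)" "\<And>i. i < N \<Longrightarrow> polyfun (\<lambda>z. A z i)" "\<And>i. i < N \<Longrightarrow> polyfun (\<lambda>z. B z i)"
  shows "polyfun (\<lambda>z. cdet N (p z) (A z) (B z))"
  unfolding cdet_leibniz using assms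
  by (intro polyfun_sum polyfun_prod polyfun_intros) auto

lemma polyfun_nonzero:
  assumes "polyfun f" "f w \<noteq> 0"
  shows "eventually (\<lambda>z. f z \<noteq> 0) (at x)"
proof -
  obtain P where P: "f = poly P" using assms(1) unfolding polyfun_def by auto
  with assms(2) have "P \<noteq> 0" by auto
  then have "finite ({z. f z = 0} - {x})" unfolding P by (intro finite_Diff poly_roots_finite)
  then have "open (- ({z. f z = 0} - {x}))" by (intro open_Compl finite_imp_closed)
  then show ?thesis unfolding eventually_at_topological by (intro exI[of _ "- ({z. f z = 0} - {x})"]) auto
qed

lemma tendsto_cdet:
  assumes "\<And>i. i < N \<Longrightarrow> ((\<lambda>z. p z i) \<longlongrightarrow> p0 i) G" "\<And>i. i < N \<Longrightarrow> ((\<lambda>z. A z i) \<longlongrightarrow> A0 i) G"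
    "\<And>i. i < N \<Longrightarrow> ((\<lambda>z. B z i) \<longlongrightarrow> B0 i) G"
  shows "((\<lambda>z. cdet N (p z) (A z) (B z)) \<longlongrightarrow> cdet N p0 A0 B0) G"
  unfolding cdet_leibniz using assms by (intro tendsto_intros) auto

text \<open>Convergence is asked along all convergent amplitudes. \<open>rowd\<close> evaluates its
  argument at altered amplitudes that move with \<open>z\<close>, so this form is inherited by
  \<open>rowd\<close>, and iterated derivatives follow by repeated application.\<close>

definition rtends where
  "rtends N G \<Phi> \<Phi>0 \<longleftrightarrow> (\<forall>A B A0 B0.
     (\<forall>i<N. ((\<lambda>z. A z i) \<longlongrightarrow> A0 i) G) \<and> (\<forall>i<N. ((\<lambda>z. B z i) \<longlongrightarrow> B0 i) G) \<longrightarrow>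
       ((\<lambda>z. \<Phi> z (A z) (B z)) \<longlongrightarrow> (\<Phi>0 A0 B0 :: complex)) G)"
  for A B :: "'z \<Rightarrow> nat \<Rightarrow> complex"

lemma rtendsD:
  "\<lbrakk>rtends N G \<Phi> \<Phi>0; \<And>i. i < N \<Longrightarrow> ((\<lambda>z. A z i) \<longlongrightarrow> A0 i) G; \<And>i. i < N \<Longrightarrow> ((\<lambda>z. B z i) \<longlongrightarrow> B0 i) G\<rbrakk>
    \<Longrightarrow> ((\<lambda>z. \<Phi> z (A z) (B z)) \<longlongrightarrow> \<Phi>0 A0 B0) G"
  by (auto simp: rtends_def)

lemma rtends_cdet:
  assumes "\<And>i. i < N \<Longrightarrow> ((\<lambda>z. p z i) \<longlongrightarrow> p0 i) G"
  shows "rtends N G (\<lambda>z. cdet N (p z)) (cdet N p0)"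
  unfolding rtends_def using assms by (auto intro!: tendsto_cdet)

lemma rtends_rowd:
  assumes "rtends N G \<Phi> \<Phi>0" and \<omega>: "\<And>i. i < N \<Longrightarrow> ((\<lambda>z. \<omega> z i) \<longlongrightarrow> \<omega>0 i) G"
  shows "rtends N G (\<lambda>z. rowd N (\<omega> z) (\<Phi> z)) (rowd N \<omega>0 \<Phi>0)"
  unfolding rtends_def rowd_def
proof (intro allI impI tendsto_sum rtendsD[OF assms(1)])
  fix A B :: "'a \<Rightarrow> nat \<Rightarrow> complex" and A0 B0 :: "nat \<Rightarrow> complex" and k i
  assume AB: "(\<forall>i<N. ((\<lambda>z. A z i) \<longlongrightarrow> A0 i) G) \<and> (\<forall>i<N. ((\<lambda>z. B z i) \<longlongrightarrow> B0 i) G)"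
    and k: "k \<in> {..<N}" and i: "i < N"
  show "((\<lambda>z. ((A z)(k := \<omega> z k * A z k)) i) \<longlongrightarrow> (A0(k := \<omega>0 k * A0 k)) i) G"
    "((\<lambda>z. ((B z)(k := - \<omega> z k * B z k)) i) \<longlongrightarrow> (B0(k := - \<omega>0 k * B0 k)) i) G"
    using AB k i \<omega> by (cases "i = k"; auto intro!: tendsto_intros)+
qed

text \<open>The parameters are joined by a segment to a Vandermonde configuration.  The determinants to be
  inverted are polynomials along the segment, so they vanish only at finitely many of its points.\<close>

lemma casorati_density:
  fixes I :: "(nat \<Rightarrow> complex) \<Rightarrow> (nat \<Rightarrow> complex) \<Rightarrow> (nat \<Rightarrow> complex) \<Rightarrow> complex" and a b :: real
  assumes p: "\<And>i. i < N \<Longrightarrow> p i \<noteq> 0"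
    and generic: "\<And>p A B. casorati N p A B \<Longrightarrow>
      cdet N p (damp p (of_real a) A) (damp p (- of_real a) B) \<noteq> 0 \<Longrightarrow>
      cdet N p (damp p (of_real b) A) (damp p (- of_real b) B) \<noteq> 0 \<Longrightarrow> I p A B = 0"
    and limit: "\<And>P A' B'. (\<And>i. i < N \<Longrightarrow> ((\<lambda>z. P z i) \<longlongrightarrow> p i) (at 0)) \<Longrightarrow>
      (\<And>i. i < N \<Longrightarrow> ((\<lambda>z. A' z i) \<longlongrightarrow> A i) (at 0)) \<Longrightarrow>
      (\<And>i. i < N \<Longrightarrow> ((\<lambda>z. B' z i) \<longlongrightarrow> B i) (at 0)) \<Longrightarrow>
      ((\<lambda>z::complex. I (P z) (A' z) (B' z)) \<longlongrightarrow> I p A B) (at 0)"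
  shows "I p A B = 0"
proof -
  \<comment> \<open>imaginary, so that \<open>1 - c q\<^sub>i \<noteq> 0\<close> for all real \<open>c\<close>\<close>
  define q where "q = (\<lambda>k. \<i> * of_nat (Suc k) :: complex)"
  \<comment> \<open>The given parameters sit at z = 0; at z = 1 the nodes are \<open>q\<close>, with
    \<open>A\<close> equal to 1 and \<open>B\<close> to 0. With \<open>B\<close> = 0 the determinant
    is a Vandermonde determinant with weighted rows, before and after a lattice step.\<close>
  define P A' B' where "P = (\<lambda>z i. (1 - z) * p i + z * q i)" and "A' = (\<lambda>z i. (1 - z) * A i + z)"
    and "B' = (\<lambda>z i. (1 - z) * B i)"
  note path = P_def A'_def B'_def
  have lim: "((\<lambda>z. P z i) \<longlongrightarrow> p i) (at 0)" "((\<lambda>z. A' z i) \<longlongrightarrow> A i) (at 0)" "((\<lambda>z. B' z i) \<longlongrightarrow> B i) (at 0)" for i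
    unfolding path by (rule tendsto_eq_intros refl | simp)+
  have poly: "polyfun (\<lambda>z. P z i)" "polyfun (\<lambda>z. A' z i)" "polyfun (\<lambda>z. B' z i)" for i
    unfolding path by (intro polyfun_intros)+
  have end1: "P 1 = q" "A' 1 = (\<lambda>_. 1)" "B' 1 = (\<lambda>_. 0)" by (simp_all add: path)
  have inj: "inj_on q {..<N}" by (auto simp: q_def inj_on_def)
  have q: "q i \<noteq> 0" "of_real c * q i \<noteq> 1" for i and c :: real
    by (auto simp: q_def complex_eq_iff simp del: of_nat_Suc)
  have damp_end: "damp (P 1) c (B' 1) = (\<lambda>_. 0)" for c by (simp add: end1 damp_def)
  have ev: "eventually (\<lambda>z. cdet N (P z) (damp (P z) (of_real c) (A' z)) (damp (P z) (- of_real c) (B' z)) \<noteq> 0) (at 0)"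
    for c :: real
  proof (rule polyfun_nonzero[of _ 1])
    show "polyfun (\<lambda>z. cdet N (P z) (damp (P z) (of_real c) (A' z)) (damp (P z) (- of_real c) (B' z)))"
      unfolding damp_def by (intro polyfun_cdet polyfun_intros poly)
    show "cdet N (P 1) (damp (P 1) (of_real c) (A' 1)) (damp (P 1) (- of_real c) (B' 1)) \<noteq> 0"
      unfolding damp_end unfolding end1 by (rule vandermonde_nonzero[OF inj]) (simp add: damp_def q)
  qed
  have "eventually (\<lambda>z. cdet N (P z) (A' z) (B' z) \<noteq> 0) (at 0)"
    by (rule polyfun_nonzero[of _ 1])
       (auto intro!: polyfun_cdet poly simp: end1 vandermonde_nonzero[OF inj])
  moreover have "eventually (\<lambda>z. cdet N (P z) (A' z) (\<lambda>i. - B' z i) \<noteq> 0) (at 0)"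
    by (rule polyfun_nonzero[of _ 1])
       (auto intro!: polyfun_cdet polyfun_uminus poly simp: end1 vandermonde_nonzero[OF inj])
  moreover note ev[of a] ev[of b]
  moreover have "eventually (\<lambda>z. \<forall>i\<in>{..<N}. P z i \<noteq> 0) (at 0)"
    by (intro eventually_ball_finite ballI finite_lessThan polyfun_nonzero[of _ 1] poly) (simp add: end1 q)
  ultimately have "eventually (\<lambda>z. I (P z) (A' z) (B' z) = 0) (at 0)"
  proof eventually_elim
    case (elim z)
    then show ?case by (intro generic casorati.intro) auto
  qed
  then have "((\<lambda>z. I (P z) (A' z) (B' z)) \<longlongrightarrow> 0) (at 0)" by (rule tendsto_eventually)
  moreover have "((\<lambda>z. I (P z) (A' z) (B' z)) \<longlongrightarrow> I p A B) (at 0)"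
    by (intro limit lim)
  ultimately show ?thesis by (metis tendsto_unique trivial_limit_at)
qed

lemma tendsto_cdet_rowd:
  fixes P :: "complex \<Rightarrow> nat \<Rightarrow> complex"
  assumes P: "\<And>i. i < N \<Longrightarrow> ((\<lambda>z. P z i) \<longlongrightarrow> p i) G"
    and A: "\<And>i. i < N \<Longrightarrow> ((\<lambda>z. A' z i) \<longlongrightarrow> A i) G" and B: "\<And>i. i < N \<Longrightarrow> ((\<lambda>z. B' z i) \<longlongrightarrow> B i) G"
  shows "((\<lambda>z. cdet N (P z) (A' z) (B' z)) \<longlongrightarrow> cdet N p A B) G"
    and "((\<lambda>z. rowd N (P z) (cdet N (P z)) (A' z) (B' z)) \<longlongrightarrow> rowd N p (cdet N p) A B) G"
    and "((\<lambda>z. rowd N (P z) (rowd N (P z) (cdet N (P z))) (A' z) (B' z)) \<longlongrightarrow>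
      rowd N p (rowd N p (cdet N p)) A B) G"
    and "((\<lambda>z. rowd N (P z) (rowd N (P z) (rowd N (P z) (cdet N (P z)))) (A' z) (B' z)) \<longlongrightarrow>
      rowd N p (rowd N p (rowd N p (cdet N p))) A B) G"
    and "((\<lambda>z. rowd N (\<lambda>i. P z i ^ 3) (cdet N (P z)) (A' z) (B' z)) \<longlongrightarrow>
      rowd N (\<lambda>i. p i ^ 3) (cdet N p) A B) G"
    and "(\<And>i. i < N \<Longrightarrow> p i \<noteq> 0) \<Longrightarrow>
      ((\<lambda>z. rowd N (\<lambda>i. 1 / P z i) (cdet N (P z)) (A' z) (B' z)) \<longlongrightarrow>
        rowd N (\<lambda>i. 1 / p i) (cdet N p) A B) G"
    and "(\<And>i. i < N \<Longrightarrow> p i \<noteq> 0) \<Longrightarrow>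
      ((\<lambda>z. rowd N (P z) (rowd N (\<lambda>i. 1 / P z i) (cdet N (P z))) (A' z) (B' z)) \<longlongrightarrow>
        rowd N p (rowd N (\<lambda>i. 1 / p i) (cdet N p)) A B) G"
  by (rule rtendsD[OF _ A B]; (assumption)?;
      (rule rtends_rowd rtends_cdet | (auto intro!: tendsto_intros P)[1])+)+

section \<open>The determinant identities for all amplitudes\<close>

context
  fixes N :: nat and p :: "nat \<Rightarrow> complex"
  assumes p: "\<And>i. i < N \<Longrightarrow> p i \<noteq> 0"
begin

lemma cdet_bilinear_xy:
  "cdet N p A B * rowd N p (rowd N (\<lambda>i. 1 / p i) (cdet N p)) A B - rowd N p (cdet N p) A B * rowd N (\<lambda>i. 1 / p i) (cdet N p) A B
     - (cdet N p A B)\<^sup>2 + (cdet N p A (\<lambda>i. - B i))\<^sup>2 = 0"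
\<comment> \<open>No lattice neighbour occurs in this identity, so both step sizes are 0, and
  damping by 0 is the identity.\<close>
proof (rule casorati_density[of N p 0 0 "\<lambda>p A B. cdet N p A B * rowd N p (rowd N (\<lambda>i. 1 / p i) (cdet N p)) A B
    - rowd N p (cdet N p) A B * rowd N (\<lambda>i. 1 / p i) (cdet N p) A B
    - (cdet N p A B)\<^sup>2 + (cdet N p A (\<lambda>i. - B i))\<^sup>2"])
qed (auto simp: p casorati.bilinear_xy intro!: tendsto_intros tendsto_cdet_rowd)

lemma cdet_bilinear_xx:
  fixes A B
  defines "A1 \<equiv> \<lambda>i. p i * A i" and "B1 \<equiv> \<lambda>i. - p i * B i"
  shows "rowd N p (rowd N p (cdet N p)) A B * cdet N p A1 B1 - 2 * rowd N p (cdet N p) A B * rowd N p (cdet N p) A1 B1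
     + cdet N p A B * rowd N p (rowd N p (cdet N p)) A1 B1 = 0"
  unfolding A1_def B1_def
proof (rule casorati_density[of N p 0 0 "\<lambda>p A B.
    rowd N p (rowd N p (cdet N p)) A B * cdet N p (\<lambda>i. p i * A i) (\<lambda>i. - p i * B i)
    - 2 * rowd N p (cdet N p) A B * rowd N p (cdet N p) (\<lambda>i. p i * A i) (\<lambda>i. - p i * B i)
    + cdet N p A B * rowd N p (rowd N p (cdet N p)) (\<lambda>i. p i * A i) (\<lambda>i. - p i * B i)"])
qed (auto simp: p intro!: tendsto_intros tendsto_cdet_rowd dest: casorati.bilinear_xx)

lemma cdet_bilinear_xxx_t:
  fixes A B
  defines "A1 \<equiv> \<lambda>i. p i * A i" and "B1 \<equiv> \<lambda>i. - p i * B i"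
  shows "rowd N p (rowd N p (rowd N p (cdet N p))) A B * cdet N p A1 B1 - 3 * rowd N p (rowd N p (cdet N p)) A B * rowd N p (cdet N p) A1 B1
     + 3 * rowd N p (cdet N p) A B * rowd N p (rowd N p (cdet N p)) A1 B1 - cdet N p A B * rowd N p (rowd N p (rowd N p (cdet N p))) A1 B1
     - 4 * (rowd N (\<lambda>i. p i ^ 3) (cdet N p) A B * cdet N p A1 B1 - cdet N p A B * rowd N (\<lambda>i. p i ^ 3) (cdet N p) A1 B1) = 0"
  unfolding A1_def B1_def
proof (rule casorati_density[of N p 0 0 "\<lambda>p A B.
    rowd N p (rowd N p (rowd N p (cdet N p))) A B * cdet N p (\<lambda>i. p i * A i) (\<lambda>i. - p i * B i)
    - 3 * rowd N p (rowd N p (cdet N p)) A B * rowd N p (cdet N p) (\<lambda>i. p i * A i) (\<lambda>i. - p i * B i)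
    + 3 * rowd N p (cdet N p) A B * rowd N p (rowd N p (cdet N p)) (\<lambda>i. p i * A i) (\<lambda>i. - p i * B i)
    - cdet N p A B * rowd N p (rowd N p (rowd N p (cdet N p))) (\<lambda>i. p i * A i) (\<lambda>i. - p i * B i)
    - 4 * (rowd N (\<lambda>i. p i ^ 3) (cdet N p) A B * cdet N p (\<lambda>i. p i * A i) (\<lambda>i. - p i * B i)
        - cdet N p A B * rowd N (\<lambda>i. p i ^ 3) (cdet N p) (\<lambda>i. p i * A i) (\<lambda>i. - p i * B i))"])
qed (auto simp: p intro!: tendsto_intros tendsto_cdet_rowd dest: casorati.bilinear_xxx_t)

lemma cdet_bilinear_y_step:
  fixes A B and a :: real
  defines "A' \<equiv> damp p (of_real a) A" and "B' \<equiv> damp p (- of_real a) B"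
  shows "rowd N (\<lambda>i. 1 / p i) (cdet N p) A B * cdet N p A' B' - cdet N p A B * rowd N (\<lambda>i. 1 / p i) (cdet N p) A' B'
      - of_real a * (cdet N p A B * cdet N p A' B' - cdet N p A (\<lambda>i. - B i) * cdet N p A' (\<lambda>i. - B' i)) = 0"
  unfolding A'_def B'_def
proof (rule casorati_density[of N p a a "\<lambda>p A B.
    rowd N (\<lambda>i. 1 / p i) (cdet N p) A B * cdet N p (damp p (of_real a) A) (damp p (- of_real a) B)
    - cdet N p A B * rowd N (\<lambda>i. 1 / p i) (cdet N p) (damp p (of_real a) A) (damp p (- of_real a) B)
    - of_real a * (cdet N p A B * cdet N p (damp p (of_real a) A) (damp p (- of_real a) B)
      - cdet N p A (\<lambda>i. - B i) * cdet N p (damp p (of_real a) A) (\<lambda>i. - damp p (- of_real a) B i))"])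
  fix p A B assume "casorati N p A B" "cdet N p (damp p (of_real a) A) (damp p (- of_real a) B) \<noteq> 0"
  then show "rowd N (\<lambda>i. 1 / p i) (cdet N p) A B * cdet N p (damp p (of_real a) A) (damp p (- of_real a) B)
    - cdet N p A B * rowd N (\<lambda>i. 1 / p i) (cdet N p) (damp p (of_real a) A) (damp p (- of_real a) B)
    - of_real a * (cdet N p A B * cdet N p (damp p (of_real a) A) (damp p (- of_real a) B)
      - cdet N p A (\<lambda>i. - B i) * cdet N p (damp p (of_real a) A) (\<lambda>i. - damp p (- of_real a) B i)) = 0"
    using casorati.bilinear_y_step by simp
qed (unfold damp_def, auto simp: p intro!: tendsto_intros tendsto_cdet_rowd)

lemma cdet_bilinear_lattice:
  fixes A B and a b :: real
  shows "of_real b * cdet N p (damp p (of_real a) A) (\<lambda>i. - damp p (- of_real a) B i) *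
        cdet N p (damp p (of_real b) A) (damp p (- of_real b) B)
     - of_real a * cdet N p (damp p (of_real b) A) (\<lambda>i. - damp p (- of_real b) B i) *
        cdet N p (damp p (of_real a) A) (damp p (- of_real a) B)
     + (of_real a - of_real b) * cdet N p A (\<lambda>i. - B i) *
        cdet N p (damp p (of_real b) (damp p (of_real a) A)) (damp p (- of_real b) (damp p (- of_real a) B)) = 0"
proof (rule casorati_density[of N p a b "\<lambda>p A B.
     of_real b * cdet N p (damp p (of_real a) A) (\<lambda>i. - damp p (- of_real a) B i) *
        cdet N p (damp p (of_real b) A) (damp p (- of_real b) B)
     - of_real a * cdet N p (damp p (of_real b) A) (\<lambda>i. - damp p (- of_real b) B i) *
        cdet N p (damp p (of_real a) A) (damp p (- of_real a) B)
     + (of_real a - of_real b) * cdet N p A (\<lambda>i. - B i) *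
        cdet N p (damp p (of_real b) (damp p (of_real a) A)) (damp p (- of_real b) (damp p (- of_real a) B))"])
  fix p A B assume "casorati N p A B" "cdet N p (damp p (of_real a) A) (damp p (- of_real a) B) \<noteq> 0"
    "cdet N p (damp p (of_real b) A) (damp p (- of_real b) B) \<noteq> 0"
  then show "of_real b * cdet N p (damp p (of_real a) A) (\<lambda>i. - damp p (- of_real a) B i) *
        cdet N p (damp p (of_real b) A) (damp p (- of_real b) B)
     - of_real a * cdet N p (damp p (of_real b) A) (\<lambda>i. - damp p (- of_real b) B i) *
        cdet N p (damp p (of_real a) A) (damp p (- of_real a) B)
     + (of_real a - of_real b) * cdet N p A (\<lambda>i. - B i) *
        cdet N p (damp p (of_real b) (damp p (of_real a) A)) (damp p (- of_real b) (damp p (- of_real a) B)) = 0"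
    by (rule casorati.bilinear_lattice)
qed (unfold damp_def, auto simp: p intro!: tendsto_intros tendsto_cdet_rowd)

end

section \<open>Hirota derivatives\<close>

type_synonym fun3 = "real \<Rightarrow> real \<Rightarrow> real \<Rightarrow> complex"

definition dx :: "fun3 \<Rightarrow> fun3 \<Rightarrow> bool" where
  "dx f f' \<longleftrightarrow> (\<forall>x y t. ((\<lambda>\<xi>. f \<xi> y t) has_vector_derivative f' x y t) (at x))"

definition dy :: "fun3 \<Rightarrow> fun3 \<Rightarrow> bool" where
  "dy f f' \<longleftrightarrow> (\<forall>x y t. ((\<lambda>\<xi>. f x \<xi> t) has_vector_derivative f' x y t) (at y))"

definition dt :: "fun3 \<Rightarrow> fun3 \<Rightarrow> bool" where
  "dt f f' \<longleftrightarrow> (\<forall>x y t. ((\<lambda>\<xi>. f x y \<xi>) has_vector_derivative f' x y t) (at t))"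

lemma dxD: "dx f f' \<Longrightarrow> ((\<lambda>\<xi>. f \<xi> y t) has_vector_derivative f' x y t) (at x)"
  and dyD: "dy f f' \<Longrightarrow> ((\<lambda>\<xi>. f x \<xi> t) has_vector_derivative f' x y t) (at y)"
  and dtD: "dt f f' \<Longrightarrow> ((\<lambda>\<xi>. f x y \<xi>) has_vector_derivative f' x y t) (at t)"
  by (auto simp: dx_def dy_def dt_def)

text \<open>\<open>hirota_x\<close> is iterated and also follows \<open>hirota_y\<close>, so it
  meets sums of products and not only the product f g; hence the general \<open>F\<close>.\<close>

lemma hirota_x_eqI:
  assumes "\<And>x y t x' y' t'. ((\<lambda>\<xi>. F \<xi> y t x' y' t') has_vector_derivative P x y t x' y' t') (at x)"
    and "\<And>x y t x' y' t'. ((\<lambda>\<xi>. F x y t \<xi> y' t') has_vector_derivative Q x y t x' y' t') (at x')"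
  shows "hirota_x F = (\<lambda>x y t x' y' t'. P x y t x' y' t' - Q x y t x' y' t')"
  unfolding hirota_x_def fun_eq_iff
  by (intro allI arg_cong2[of _ _ _ _ "(-)"] vector_derivative_at assms)

lemma hirota_y_product:
  assumes "dy f fy" "dy g gy"
  shows "hirota_y (\<lambda>x y t x' y' t'. f x y t * g x' y' t') =
    (\<lambda>x y t x' y' t'. fy x y t * g x' y' t' - f x y t * gy x' y' t')"
  unfolding hirota_y_def fun_eq_iff
  by (auto intro!: arg_cong2[of _ _ _ _ "(-)"] vector_derivative_at
      has_vector_derivative_mult_left has_vector_derivative_mult_right dyD[OF assms(1)] dyD[OF assms(2)])

lemma hirota_t_product:
  assumes "dt f ft" "dt g gt"
  shows "hirota_t (\<lambda>x y t x' y' t'. f x y t * g x' y' t') =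
    (\<lambda>x y t x' y' t'. ft x y t * g x' y' t' - f x y t * gt x' y' t')"
  unfolding hirota_t_def fun_eq_iff
  by (auto intro!: arg_cong2[of _ _ _ _ "(-)"] vector_derivative_at
      has_vector_derivative_mult_left has_vector_derivative_mult_right dtD[OF assms(1)] dtD[OF assms(2)])

lemma hirota_010: "dy f fy \<Longrightarrow> dy g gy \<Longrightarrow> hirota 0 1 0 f g x y t = fy x y t * g x y t - f x y t * gy x y t"
  by (simp add: hirota_def hirota_y_product)

lemma hirota_001: "dt f ft \<Longrightarrow> dt g gt \<Longrightarrow> hirota 0 0 1 f g x y t = ft x y t * g x y t - f x y t * gt x y t"
  by (simp add: hirota_def hirota_t_product)

lemma hirota_110:
  assumes "dy f fy" "dy g gy" "dx f fx" "dx g gx" "dx fy fxy" "dx gy gxy"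
  shows "hirota 1 1 0 f g x y t =
    fxy x y t * g x y t - fx x y t * gy x y t - fy x y t * gx x y t + f x y t * gxy x y t"
proof -
  have "hirota_x (\<lambda>x y t x' y' t'. fy x y t * g x' y' t' - f x y t * gy x' y' t') =
    (\<lambda>x y t x' y' t'. (fxy x y t * g x' y' t' - fx x y t * gy x' y' t')
       - (fy x y t * gx x' y' t' - f x y t * gxy x' y' t'))"
    by (intro hirota_x_eqI has_vector_derivative_diff has_vector_derivative_mult_left
        has_vector_derivative_mult_right dxD assms)
  then show ?thesis by (simp add: hirota_def hirota_y_product[OF assms(1,2)])
qed

lemma hirota_x_power:
  assumes "dx f fx" "dx fx fxx" "dx fxx fxxx" "dx g gx" "dx gx gxx" "dx gxx gxxx"
  shows hirota_200: "hirota 2 0 0 f g x y t =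
      fxx x y t * g x y t - 2 * fx x y t * gx x y t + f x y t * gxx x y t"
    and hirota_300: "hirota 3 0 0 f g x y t = fxxx x y t * g x y t - 3 * fxx x y t * gx x y t
      + 3 * fx x y t * gxx x y t - f x y t * gxxx x y t"
proof -
  note intros = has_vector_derivative_diff has_vector_derivative_add has_vector_derivative_mult_left
      has_vector_derivative_mult_right dxD assms
  have 1: "hirota_x (\<lambda>x y t x' y' t'. f x y t * g x' y' t') =
    (\<lambda>x y t x' y' t'. fx x y t * g x' y' t' - f x y t * gx x' y' t')"
    by (intro hirota_x_eqI intros)
  have 2: "hirota_x (\<lambda>x y t x' y' t'. fx x y t * g x' y' t' - f x y t * gx x' y' t') =
    (\<lambda>x y t x' y' t'. (fxx x y t * g x' y' t' - fx x y t * gx x' y' t')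
       - (fx x y t * gx x' y' t' - f x y t * gxx x' y' t'))"
    by (intro hirota_x_eqI intros)
  have 3: "hirota_x (\<lambda>x y t x' y' t'. (fxx x y t * g x' y' t' - fx x y t * gx x' y' t')
       - (fx x y t * gx x' y' t' - f x y t * gxx x' y' t')) =
    (\<lambda>x y t x' y' t'. ((fxxx x y t * g x' y' t' - fxx x y t * gx x' y' t')
       - (fxx x y t * gx x' y' t' - fx x y t * gxx x' y' t'))
      - ((fxx x y t * gx x' y' t' - fx x y t * gxx x' y' t')
       - (fx x y t * gxx x' y' t' - f x y t * gxxx x' y' t')))"
    by (intro hirota_x_eqI intros)
  show "hirota 2 0 0 f g x y t = fxx x y t * g x y t - 2 * fx x y t * gx x y t + f x y t * gxx x y t"
    unfolding hirota_def funpow.simps numeral_2_eq_2 comp_def id_def 1 2 by simp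
  show "hirota 3 0 0 f g x y t = fxxx x y t * g x y t - 3 * fxx x y t * gx x y t
      + 3 * fx x y t * gxx x y t - f x y t * gxxx x y t"
    unfolding hirota_def funpow.simps numeral_3_eq_3 comp_def id_def 1 2 3 by simp
qed

section \<open>Amplitudes and exponential factor as functions of x, y, t\<close>

definition phase :: "(nat \<Rightarrow> complex) \<Rightarrow> real \<Rightarrow> real \<Rightarrow> real \<Rightarrow> nat \<Rightarrow> complex" where
  "phase p x y t i = p i * of_real x - 4 * p i ^ 3 * of_real t + 1 / p i * of_real y"

definition amp :: "(nat \<Rightarrow> complex) \<Rightarrow> complex \<Rightarrow> (nat \<Rightarrow> complex) \<Rightarrow> real \<Rightarrow> real \<Rightarrow> real \<Rightarrow> nat \<Rightarrow> complex" where
  "amp p \<sigma> A x y t = (\<lambda>i. A i * exp (\<sigma> * phase p x y t i))"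

definition along :: "(nat \<Rightarrow> complex) \<Rightarrow> (nat \<Rightarrow> complex) \<Rightarrow> (nat \<Rightarrow> complex) \<Rightarrow>
    ((nat \<Rightarrow> complex) \<Rightarrow> (nat \<Rightarrow> complex) \<Rightarrow> complex) \<Rightarrow> fun3" where
  "along p A B F = (\<lambda>x y t. F (amp p 1 A x y t) (amp p (- 1) B x y t))"

text \<open>The phase is linear in each variable, so moving one variable away from 0 is a flow. For
  t the weight is p^3 and the factor -4 goes into the time, which matches the weight in the
  determinant identities.\<close>

lemma amp_flow:
  "amp p 1 A x y t = flow p (of_real x) (amp p 1 A 0 y t)"
  "amp p (- 1) A x y t = flow p (- of_real x) (amp p (- 1) A 0 y t)"
  "amp p 1 A x y t = flow (\<lambda>i. 1 / p i) (of_real y) (amp p 1 A x 0 t)"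
  "amp p (- 1) A x y t = flow (\<lambda>i. 1 / p i) (- of_real y) (amp p (- 1) A x 0 t)"
  "amp p 1 A x y t = flow (\<lambda>i. p i ^ 3) (- 4 * of_real t) (amp p 1 A x y 0)"
  "amp p (- 1) A x y t = flow (\<lambda>i. p i ^ 3) (- (- 4 * of_real t)) (amp p (- 1) A x y 0)"
  unfolding amp_def flow_def phase_def fun_eq_iff mult.assoc mult_exp_exp
  by (simp_all add: algebra_simps)

lemma along_derivs:
  assumes "flowable N F"
  shows dx_along: "dx (along p A B F) (along p A B (rowd N p F))"
    and dy_along: "dy (along p A B F) (along p A B (rowd N (\<lambda>i. 1 / p i) F))"
    and dt_along: "dt (along p A B F) (\<lambda>x y t. - 4 * along p A B (rowd N (\<lambda>i. p i ^ 3) F) x y t)"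
proof -
  note D = flowableD[OF assms, THEN has_vector_derivative_real_field]
  show "dx (along p A B F) (along p A B (rowd N p F))"
    unfolding dx_def along_def
  proof (intro allI)
    fix x y t :: real
    show "((\<lambda>\<xi>. F (amp p 1 A \<xi> y t) (amp p (- 1) B \<xi> y t)) has_vector_derivative
           rowd N p F (amp p 1 A x y t) (amp p (- 1) B x y t)) (at x)"
      using D[of "p" "amp p 1 A 0 y t" "amp p (- 1) B 0 y t" x]
      by (simp only: amp_flow(1,2)[symmetric])
  qed
  show "dy (along p A B F) (along p A B (rowd N (\<lambda>i. 1 / p i) F))"
    unfolding dy_def along_def
  proof (intro allI)
    fix x y t :: real
    show "((\<lambda>\<xi>. F (amp p 1 A x \<xi> t) (amp p (- 1) B x \<xi> t)) has_vector_derivative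
           rowd N (\<lambda>i. 1 / p i) F (amp p 1 A x y t) (amp p (- 1) B x y t)) (at y)"
      using D[of "(\<lambda>i. 1 / p i)" "amp p 1 A x 0 t" "amp p (- 1) B x 0 t" y]
      by (simp only: amp_flow(3,4)[symmetric])
  qed
  show "dt (along p A B F) (\<lambda>x y t. - 4 * along p A B (rowd N (\<lambda>i. p i ^ 3) F) x y t)"
    unfolding dt_def along_def
  proof (intro allI)
    fix x y t :: real
    let ?\<omega> = "\<lambda>i. p i ^ 3"
    let ?G = "\<lambda>z. F (flow ?\<omega> (- 4 * z) (amp p 1 A x y 0)) (flow ?\<omega> (- (- 4 * z)) (amp p (- 1) B x y 0))"
    have "(?G has_field_derivative rowd N ?\<omega> F (flow ?\<omega> (- 4 * of_real t) (amp p 1 A x y 0))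
        (flow ?\<omega> (- (- 4 * of_real t)) (amp p (- 1) B x y 0)) * (- 4)) (at (of_real t))"
      by (rule DERIV_chain2[OF flowableD[OF assms]]) (auto intro!: derivative_eq_intros)
    note has_vector_derivative_real_field[OF this]
    then show "((\<lambda>\<xi>. F (amp p 1 A x y \<xi>) (amp p (- 1) B x y \<xi>)) has_vector_derivative
           - 4 * rowd N ?\<omega> F (amp p 1 A x y t) (amp p (- 1) B x y t)) (at t)"
      by (simp only: amp_flow(5,6)[symmetric] mult.commute[of _ "- 4"])
  qed
qed

definition gauge_factor :: "real \<Rightarrow> real \<Rightarrow> real \<Rightarrow> complex" where
  "gauge_factor S x y = exp (- of_real ((x + S) * y))"

lemma gauge_x: "((\<lambda>\<xi>. gauge_factor S \<xi> y) has_vector_derivative - of_real y * gauge_factor S x y) (at x)"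
proof -
  have "((\<lambda>z. exp (- ((z + of_real S) * of_real y))) has_field_derivative
      - of_real y * gauge_factor S x y) (at (of_real x))"
    by (auto intro!: derivative_eq_intros simp: gauge_factor_def)
  from has_vector_derivative_real_field[OF this] show ?thesis by (simp only: gauge_factor_def of_real_mult of_real_add)
qed

lemma gauge_y: "((\<lambda>\<xi>. gauge_factor S x \<xi>) has_vector_derivative - of_real (x + S) * gauge_factor S x y) (at y)"
proof -
  have "((\<lambda>z. exp (- ((of_real x + of_real S) * z))) has_field_derivative
      - of_real (x + S) * gauge_factor S x y) (at (of_real y))"
    by (auto intro!: derivative_eq_intros simp: gauge_factor_def)
  from has_vector_derivative_real_field[OF this] show ?thesis by (simp only: gauge_factor_def of_real_mult of_real_add)
qed

lemma dx_gauge: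
  assumes "dx f f'"
  shows "dx (\<lambda>x y t. gauge_factor S x y * f x y t) (\<lambda>x y t. gauge_factor S x y * (f' x y t - of_real y * f x y t))"
  unfolding dx_def
proof (intro allI)
  fix x y t
  show "((\<lambda>\<xi>. gauge_factor S \<xi> y * f \<xi> y t) has_vector_derivative gauge_factor S x y * (f' x y t - of_real y * f x y t)) (at x)"
    using has_vector_derivative_mult[OF gauge_x dxD[OF assms]] by (simp add: algebra_simps)
qed

lemma dy_gauge:
  assumes "dy f f'"
  shows "dy (\<lambda>x y t. gauge_factor S x y * f x y t) (\<lambda>x y t. gauge_factor S x y * (f' x y t - of_real (x + S) * f x y t))"
  unfolding dy_def
proof (intro allI)
  fix x y t
  show "((\<lambda>\<xi>. gauge_factor S x \<xi> * f x \<xi> t) has_vector_derivative gauge_factor S x y * (f' x y t - of_real (x + S) * f x y t)) (at y)"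
    using has_vector_derivative_mult[OF gauge_y dyD[OF assms]] by (simp add: algebra_simps)
qed

lemma dt_gauge:
  assumes "dt f f'"
  shows "dt (\<lambda>x y t. gauge_factor S x y * f x y t) (\<lambda>x y t. gauge_factor S x y * f' x y t)"
  using assms unfolding dt_def by (auto intro!: has_vector_derivative_mult_right)

lemma dx_minus_y:
  assumes "dx f f'" "dx g g'"
  shows "dx (\<lambda>x y t. f x y t - of_real y * g x y t) (\<lambda>x y t. f' x y t - of_real y * g' x y t)"
  using assms unfolding dx_def
  by (auto intro!: has_vector_derivative_diff has_vector_derivative_mult_right)

text \<open>The coefficient x + S itself depends on x. The extra \<open>g\<close> becomes the -1 in
  \<open>fxy\<close> below and thereby the term - tau^2 in half of D_x D_y.\<close>

lemma dx_minus_xS: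
  assumes "dx f f'" "dx g g'"
  shows "dx (\<lambda>x y t. f x y t - of_real (x + S) * g x y t)
    (\<lambda>x y t. f' x y t - (of_real (x + S) * g' x y t + g x y t))"
proof -
  have "((\<lambda>\<xi>. complex_of_real (\<xi> + S)) has_vector_derivative 1) (at x)" for x
    by (rule has_vector_derivative_eq_rhs) (auto intro!: derivative_eq_intros)
  then have "((\<lambda>\<xi>. of_real (\<xi> + S) * g \<xi> y t) has_vector_derivative of_real (x + S) * g' x y t + 1 * g x y t) (at x)"
    for x y t
    by (rule has_vector_derivative_mult) (rule dxD[OF assms(2)])
  then show ?thesis
    unfolding dx_def using dxD[OF assms(1)] by (intro allI has_vector_derivative_diff) auto
qed

section \<open>The bilinear equations\<close>

text \<open>Behind the exponential factor, differentiation in x acts as the x-derivative minus y,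
  and differentiation in y as the y-derivative minus x + S; the listed combinations are the expanded
  iterates.\<close>

lemma gauged_derivs:
  fixes N p A B S
  defines "D \<equiv> along p A B (cdet N p)"
    and "Dx \<equiv> along p A B (rowd N p (cdet N p))"
    and "Dxx \<equiv> along p A B (rowd N p (rowd N p (cdet N p)))"
    and "Dxxx \<equiv> along p A B (rowd N p (rowd N p (rowd N p (cdet N p))))"
    and "Dy \<equiv> along p A B (rowd N (\<lambda>i. 1 / p i) (cdet N p))"
    and "Dxy \<equiv> along p A B (rowd N p (rowd N (\<lambda>i. 1 / p i) (cdet N p)))"
    and "Dt \<equiv> along p A B (rowd N (\<lambda>i. p i ^ 3) (cdet N p))"
  defines "h \<equiv> gauge_factor S"
  defines "f \<equiv> \<lambda>x y t. h x y * D x y t"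
    and "fx \<equiv> \<lambda>x y t. h x y * (Dx x y t - of_real y * D x y t)"
    and "fxx \<equiv> \<lambda>x y t. h x y * (Dxx x y t - 2 * of_real y * Dx x y t + of_real y ^ 2 * D x y t)"
    and "fxxx \<equiv> \<lambda>x y t. h x y * (Dxxx x y t - 3 * of_real y * Dxx x y t + 3 * of_real y ^ 2 * Dx x y t - of_real y ^ 3 * D x y t)"
    and "fy \<equiv> \<lambda>x y t. h x y * (Dy x y t - of_real (x + S) * D x y t)"
    and "fxy \<equiv> \<lambda>x y t. h x y * (Dxy x y t - of_real y * Dy x y t - of_real (x + S) * Dx x y t
        + (of_real ((x + S) * y) - 1) * D x y t)"
    and "ft \<equiv> \<lambda>x y t. h x y * (- 4 * Dt x y t)"
  shows "dx f fx" "dx fx fxx" "dx fxx fxxx" "dy f fy" "dx fy fxy" "dt f ft"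
proof -
  have D: "dx D Dx" "dx Dx Dxx" "dx Dxx Dxxx" "dy D Dy" "dx Dy Dxy" "dt D (\<lambda>x y t. - 4 * Dt x y t)"
    unfolding D_def Dx_def Dxx_def Dxxx_def Dy_def Dxy_def Dt_def
    by (intro along_derivs flowable_rowd flowable_cdet)+
  show "dx f fx" unfolding f_def fx_def h_def by (rule dx_gauge[OF D(1)])
  show "dy f fy" unfolding f_def fy_def h_def by (rule dy_gauge[OF D(4)])
  show "dt f ft" unfolding f_def ft_def h_def by (rule dt_gauge[OF D(6)])
  note D2 = dx_minus_y[OF D(2) D(1)] and D3 = dx_minus_y[OF D(3) D(2)]
  have 1: "fxx = (\<lambda>x y t. h x y * (Dxx x y t - of_real y * Dx x y t - of_real y * (Dx x y t - of_real y * D x y t)))"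
    by (simp add: fxx_def fun_eq_iff algebra_simps power2_eq_square)
  show "dx fx fxx" unfolding 1 fx_def h_def using dx_gauge[OF D2] by simp
  have "fxxx = (\<lambda>x y t. h x y *
     ((Dxxx x y t - of_real y * Dxx x y t - of_real y * (Dxx x y t - of_real y * Dx x y t))
       - of_real y * (Dxx x y t - of_real y * Dx x y t - of_real y * (Dx x y t - of_real y * D x y t))))"
    by (simp add: fxxx_def fun_eq_iff algebra_simps power2_eq_square power3_eq_cube)
  then show "dx fxx fxxx" unfolding 1 h_def using dx_gauge[OF dx_minus_y[OF D3 D2]] by simp
  have "fxy = (\<lambda>x y t. h x y * ((Dxy x y t - (of_real (x + S) * Dx x y t + D x y t))
      - of_real y * (Dy x y t - of_real (x + S) * D x y t)))"
    by (simp add: fxy_def fun_eq_iff algebra_simps)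
  then show "dx fy fxy" unfolding fy_def h_def using dx_gauge[OF dx_minus_xS[OF D(5) D(1)]] by simp
qed

lemma dx_cmult: "dx f f' \<Longrightarrow> dx (\<lambda>x y t. c * f x y t) (\<lambda>x y t. c * f' x y t)"
  and dt_cmult: "dt f f' \<Longrightarrow> dt (\<lambda>x y t. c * f x y t) (\<lambda>x y t. c * f' x y t)"
  unfolding dx_def dt_def by (auto intro!: has_vector_derivative_mult_right)

lemma amp_scale: "amp p \<sigma> (\<lambda>i. c i * A i) x y t = (\<lambda>i. c i * amp p \<sigma> A x y t i)"
  by (simp add: amp_def mult.assoc)

lemma amp_uminus: "amp p \<sigma> (\<lambda>i. - A i) x y t = (\<lambda>i. - amp p \<sigma> A x y t i)"
  by (simp add: amp_def)

lemma amp_damp: "amp p \<sigma> (damp p c A) x y t = damp p c (amp p \<sigma> A x y t)"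
  by (simp add: amp_def damp_def mult.assoc)

text \<open>This collects what solitons and breathers have in common: amplitudes that descend by
  \<open>damp\<close>, an additive \<open>S\<close>, and conjugation as a sign change of
  \<open>B\<close>, up to the sign \<open>\<kappa>\<close> of a row permutation.
  \<open>\<kappa>\<close> factors out of the equations linear in the conjugate and squares to 1 in
  the others.\<close>

locale tau_family =
  fixes N :: nat and p :: "nat \<Rightarrow> complex" and a b :: "int \<Rightarrow> real"
    and A B :: "int \<Rightarrow> int \<Rightarrow> nat \<Rightarrow> complex" and S :: "int \<Rightarrow> int \<Rightarrow> real"
    and T :: "int \<Rightarrow> int \<Rightarrow> fun3" and \<kappa> :: complex
  assumes p: "\<And>i. i < N \<Longrightarrow> p i \<noteq> 0"
    and A_n: "\<And>n m. A n m = damp p (of_real (a n)) (A (n + 1) m)"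
    and A_m: "\<And>n m. A n m = damp p (of_real (b m)) (A n (m + 1))"
    and B_n: "\<And>n m. B n m = damp p (- of_real (a n)) (B (n + 1) m)"
    and B_m: "\<And>n m. B n m = damp p (- of_real (b m)) (B n (m + 1))"
    and S_n: "\<And>n m. S (n + 1) m = S n m + a n"
    and S_m: "\<And>n m. S n (m + 1) = S n m + b m"
    and T: "\<And>n m. T n m = (\<lambda>x y t. gauge_factor (S n m) x y * along p (A n m) (B n m) (cdet N p) x y t)"
    and cnj_T: "\<And>n m x y t. cnj (T n m x y t) =
        \<kappa> * (gauge_factor (S n m) x y * along p (A n m) (\<lambda>i. - B n m i) (cdet N p) x y t)"
    and \<kappa>: "\<kappa>\<^sup>2 = 1"
begin

definition "\<kappa>' = \<kappa> / (\<Prod>i<N. p i)"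

text \<open>The sign change of \<open>B\<close> is traded for the amplitudes of M_x, the form in
  which the identities with x- and t-derivatives are proved. These are linear in the conjugate, so
  the constant \<open>\<kappa>'\<close> comes out.\<close>

lemma conj_T: "conj_fun (T n m) = (\<lambda>x y t. \<kappa>' * (gauge_factor (S n m) x y *
    along p (\<lambda>i. p i * A n m i) (\<lambda>i. - p i * B n m i) (cdet N p) x y t))"
proof -
  have pos: "(\<Prod>i<N. p i) \<noteq> 0" using p by auto
  show ?thesis
    unfolding conj_fun_def cnj_T along_def amp_scale amp_uminus det_shift \<kappa>'_def using pos
    by (simp add: fun_eq_iff)
qed

lemmas T_derivs = gauged_derivs[where S = "S n m" and p = p and N = N and A = "A n m" and B = "B n m", folded T] for n m
lemmas conj_T_derivs = gauged_derivs[where S = "S n m" and p = p and N = N and A = "\<lambda>i. p i * A n m i"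
    and B = "\<lambda>i. - p i * B n m i"] for n m

lemma eq_xy: "1 / 2 * hirota 1 1 0 (T n m) (T n m) x y t = - (cnj (T n m x y t))\<^sup>2"
proof -
  let ?A = "amp p 1 (A n m) x y t" and ?B = "amp p (- 1) (B n m) x y t" and ?h = "gauge_factor (S n m) x y"
  note d = T_derivs[of n m]
  have "1 / 2 * hirota 1 1 0 (T n m) (T n m) x y t = ?h\<^sup>2 *
    (cdet N p ?A ?B * rowd N p (rowd N (\<lambda>i. 1 / p i) (cdet N p)) ?A ?B
      - rowd N p (cdet N p) ?A ?B * rowd N (\<lambda>i. 1 / p i) (cdet N p) ?A ?B - (cdet N p ?A ?B)\<^sup>2)"
    unfolding hirota_110[OF d(4) d(4) d(1) d(1) d(5) d(5)]
    by (simp add: T along_def algebra_simps power2_eq_square)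
  also have "\<dots> = ?h\<^sup>2 * - (cdet N p ?A (\<lambda>i. - ?B i))\<^sup>2"
    using cdet_bilinear_xy[of N p ?A ?B, OF p] by (simp add: add_eq_0_iff2)
  also have "\<dots> = - (cnj (T n m x y t))\<^sup>2"
    unfolding cnj_T along_def amp_uminus power_mult_distrib \<kappa> by simp
  finally show ?thesis .
qed

lemma eq_xx: "hirota 2 0 0 (T n m) (conj_fun (T n m)) x y t = 0"
proof -
  let ?A = "amp p 1 (A n m) x y t" and ?B = "amp p (- 1) (B n m) x y t" and ?h = "gauge_factor (S n m) x y"
  let ?A1 = "\<lambda>i. p i * ?A i" and ?B1 = "\<lambda>i. - p i * ?B i"
  note d = T_derivs[of n m] and e = conj_T_derivs[of n m]
  have "hirota 2 0 0 (T n m) (conj_fun (T n m)) x y t = \<kappa>' * ?h\<^sup>2 *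
     (rowd N p (rowd N p (cdet N p)) ?A ?B * cdet N p ?A1 ?B1 - 2 * rowd N p (cdet N p) ?A ?B * rowd N p (cdet N p) ?A1 ?B1
     + cdet N p ?A ?B * rowd N p (rowd N p (cdet N p)) ?A1 ?B1)"
    unfolding conj_T hirota_200[OF d(1-3) e(1-3)[THEN dx_cmult]]
    unfolding T along_def amp_scale
    by (simp add: algebra_simps power2_eq_square power3_eq_cube)
  also have "\<dots> = 0" using cdet_bilinear_xx[of N p ?A ?B, OF p] by simp
  finally show ?thesis .
qed

lemma eq_xxx_t: "hirota 3 0 0 (T n m) (conj_fun (T n m)) x y t + hirota 0 0 1 (T n m) (conj_fun (T n m)) x y t = 0"
proof -
  let ?A = "amp p 1 (A n m) x y t" and ?B = "amp p (- 1) (B n m) x y t" and ?h = "gauge_factor (S n m) x y"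
  let ?A1 = "\<lambda>i. p i * ?A i" and ?B1 = "\<lambda>i. - p i * ?B i"
  note d = T_derivs[of n m] and e = conj_T_derivs[of n m]
  have "hirota 3 0 0 (T n m) (conj_fun (T n m)) x y t + hirota 0 0 1 (T n m) (conj_fun (T n m)) x y t = \<kappa>' * ?h\<^sup>2 *
     (rowd N p (rowd N p (rowd N p (cdet N p))) ?A ?B * cdet N p ?A1 ?B1
     - 3 * rowd N p (rowd N p (cdet N p)) ?A ?B * rowd N p (cdet N p) ?A1 ?B1
     + 3 * rowd N p (cdet N p) ?A ?B * rowd N p (rowd N p (cdet N p)) ?A1 ?B1
     - cdet N p ?A ?B * rowd N p (rowd N p (rowd N p (cdet N p))) ?A1 ?B1
     - 4 * (rowd N (\<lambda>i. p i ^ 3) (cdet N p) ?A ?B * cdet N p ?A1 ?B1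
         - cdet N p ?A ?B * rowd N (\<lambda>i. p i ^ 3) (cdet N p) ?A1 ?B1))"
    unfolding conj_T hirota_300[OF d(1-3) e(1-3)[THEN dx_cmult]] hirota_001[OF d(6) e(6)[THEN dt_cmult]]
    unfolding T along_def amp_scale
    by (simp add: algebra_simps power2_eq_square power3_eq_cube)
  also have "\<dots> = 0" using cdet_bilinear_xxx_t[of N p ?A ?B, OF p] by simp
  finally show ?thesis .
qed

text \<open>Phrased for abstract data of the upper site, so that one proof serves both lattice
  directions.\<close>

lemma eq_y_step:
  assumes T': "T' = (\<lambda>x y t. gauge_factor (s + c) x y * along p A' B' (cdet N p) x y t)"
    and T0: "T0 = (\<lambda>x y t. gauge_factor s x y * along p (damp p (of_real c) A') (damp p (- of_real c) B') (cdet N p) x y t)"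
    and T'c: "cnj (T' x y t) = \<kappa> * (gauge_factor (s + c) x y * along p A' (\<lambda>i. - B' i) (cdet N p) x y t)"
    and T0c: "cnj (T0 x y t) = \<kappa> * (gauge_factor s x y * along p (damp p (of_real c) A') (\<lambda>i. - damp p (- of_real c) B' i) (cdet N p) x y t)"
  shows "hirota 0 1 0 T' T0 x y t = - of_real c * cnj (T' x y t) * cnj (T0 x y t)"
proof -
  let ?A = "amp p 1 A' x y t" and ?B = "amp p (- 1) B' x y t"
  let ?Ad = "damp p (of_real c) ?A" and ?Bd = "damp p (- of_real c) ?B"
  let ?h = "gauge_factor (s + c) x y" and ?hd = "gauge_factor s x y"
  note d = gauged_derivs(4)[where S = "s + c" and p = p and N = N and A = A' and B = B']
  note e = gauged_derivs(4)[where S = s and p = p and N = N and A = "damp p (of_real c) A'" and B = "damp p (- of_real c) B'"]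
  have "hirota 0 1 0 T' T0 x y t = ?h * ?hd * (rowd N (\<lambda>i. 1 / p i) (cdet N p) ?A ?B * cdet N p ?Ad ?Bd
      - cdet N p ?A ?B * rowd N (\<lambda>i. 1 / p i) (cdet N p) ?Ad ?Bd - of_real c * (cdet N p ?A ?B * cdet N p ?Ad ?Bd))"
  proof -
    \<comment> \<open>The antisymmetry of D_y cancels the common part x + s of the logarithmic
      y-derivatives of the two exponential factors and leaves c.\<close>
    have alg: "h * (u - (X + (\<sigma> + \<gamma>)) * v) * (k * w) - h * v * (k * (z - (X + \<sigma>) * w)) = h * k * (u * w - v * z - \<gamma> * (v * w))"
      for h k u v w z X \<sigma> \<gamma> :: complex by (simp add: algebra_simps)
    show ?thesis
      unfolding T' T0 hirota_010[OF d e] unfolding along_def amp_damp of_real_add by (rule alg)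
  qed
  also have "\<dots> = - of_real c * (?h * ?hd) * (cdet N p ?A (\<lambda>i. - ?B i) * cdet N p ?Ad (\<lambda>i. - ?Bd i))"
  proof -
    have "rowd N (\<lambda>i. 1 / p i) (cdet N p) ?A ?B * cdet N p ?Ad ?Bd
      - cdet N p ?A ?B * rowd N (\<lambda>i. 1 / p i) (cdet N p) ?Ad ?Bd - of_real c * (cdet N p ?A ?B * cdet N p ?Ad ?Bd)
      = - of_real c * (cdet N p ?A (\<lambda>i. - ?B i) * cdet N p ?Ad (\<lambda>i. - ?Bd i))"
      using cdet_bilinear_y_step[of N p ?A ?B c, OF p] by (simp add: algebra_simps)
    then show ?thesis by simp
  qed
  also have "\<dots> = - of_real c * \<kappa>\<^sup>2 * (?h * ?hd) * (cdet N p ?A (\<lambda>i. - ?B i) * cdet N p ?Ad (\<lambda>i. - ?Bd i))"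
    unfolding \<kappa> by simp
  also have "\<dots> = - of_real c * cnj (T' x y t) * cnj (T0 x y t)"
    unfolding T'c T0c along_def amp_uminus amp_damp by (simp add: power2_eq_square)
  finally show ?thesis .
qed

lemma gauge_factor_cross:
  "gauge_factor s01 x y * gauge_factor s10 x y = gauge_factor s11 x y * gauge_factor s00 x y"
  if "s01 + s10 = s11 + s00"
proof -
  have "(x + s01) * y + (x + s10) * y = (2 * x + (s01 + s10)) * y" by (simp add: algebra_simps)
  also have "\<dots> = (x + s11) * y + (x + s00) * y" unfolding that by (simp add: algebra_simps)
  finally have "- complex_of_real ((x + s01) * y) + - of_real ((x + s10) * y) =
      - of_real ((x + s11) * y) + - of_real ((x + s00) * y)"
    by (metis minus_add_distrib of_real_add)
  then show ?thesis unfolding gauge_factor_def mult_exp_exp by simp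
qed

lemma eq_lattice:
  "of_real (b m) * cnj (T n (m + 1) x y t) * T (n + 1) m x y t
     - of_real (a n) * cnj (T (n + 1) m x y t) * T n (m + 1) x y t
     + of_real (a n - b m) * cnj (T (n + 1) (m + 1) x y t) * T n m x y t = 0"
proof -
  let ?A = "amp p 1 (A (n + 1) (m + 1)) x y t" and ?B = "amp p (- 1) (B (n + 1) (m + 1)) x y t"
  let ?a = "complex_of_real (a n)" and ?b = "complex_of_real (b m)"
  let ?h = "\<lambda>n m. gauge_factor (S n m) x y"
  have h: "?h n (m + 1) * ?h (n + 1) m = ?h (n + 1) (m + 1) * ?h n m"
    by (rule gauge_factor_cross) (simp add: S_n S_m)
  \<comment> \<open>All four corners are written in the amplitudes of the upper corner (n + 1, m +
    1), since \<open>damp\<close> descends.\<close>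
  have AB: "A n (m + 1) = damp p ?a (A (n + 1) (m + 1))" "B n (m + 1) = damp p (- ?a) (B (n + 1) (m + 1))"
    "A (n + 1) m = damp p ?b (A (n + 1) (m + 1))" "B (n + 1) m = damp p (- ?b) (B (n + 1) (m + 1))"
    "A n m = damp p ?b (damp p ?a (A (n + 1) (m + 1)))" "B n m = damp p (- ?b) (damp p (- ?a) (B (n + 1) (m + 1)))"
    using A_n[of n "m + 1"] B_n[of n "m + 1"] A_m[of "n + 1" m] B_m[of "n + 1" m] A_m[of n m] B_m[of n m] by simp_all
  have "of_real (b m) * cnj (T n (m + 1) x y t) * T (n + 1) m x y t
     - of_real (a n) * cnj (T (n + 1) m x y t) * T n (m + 1) x y t
     + of_real (a n - b m) * cnj (T (n + 1) (m + 1) x y t) * T n m x y t =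
     \<kappa> * (of_real (b m) * cdet N p (damp p ?a ?A) (\<lambda>i. - damp p (- ?a) ?B i) * cdet N p (damp p ?b ?A) (damp p (- ?b) ?B)
         * (?h n (m + 1) * ?h (n + 1) m)
     - of_real (a n) * cdet N p (damp p ?b ?A) (\<lambda>i. - damp p (- ?b) ?B i) * cdet N p (damp p ?a ?A) (damp p (- ?a) ?B)
         * (?h n (m + 1) * ?h (n + 1) m)
     + (?a - ?b) * cdet N p ?A (\<lambda>i. - ?B i) * cdet N p (damp p ?b (damp p ?a ?A)) (damp p (- ?b) (damp p (- ?a) ?B))
         * (?h (n + 1) (m + 1) * ?h n m))"
    unfolding cnj_T unfolding T along_def AB amp_uminus amp_damp
    by (simp only: of_real_diff algebra_simps)
  also have "\<dots> = \<kappa> * (?h (n + 1) (m + 1) * ?h n m) *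
    (of_real (b m) * cdet N p (damp p ?a ?A) (\<lambda>i. - damp p (- ?a) ?B i) * cdet N p (damp p ?b ?A) (damp p (- ?b) ?B)
     - of_real (a n) * cdet N p (damp p ?b ?A) (\<lambda>i. - damp p (- ?b) ?B i) * cdet N p (damp p ?a ?A) (damp p (- ?a) ?B)
     + (?a - ?b) * cdet N p ?A (\<lambda>i. - ?B i) * cdet N p (damp p ?b (damp p ?a ?A)) (damp p (- ?b) (damp p (- ?a) ?B)))"
    unfolding h by (simp only: algebra_simps)
  also have "\<dots> = 0" using cdet_bilinear_lattice[of N p "b m" "a n" ?A ?B, OF p] by simp
  finally show ?thesis .
qed

theorem bilinear: "bilinear_equations a b T"
  unfolding bilinear_equations_def
proof (intro allI conjI eq_xy eq_xx eq_xxx_t eq_lattice)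
  fix n m x y t
  show "hirota 0 1 0 (T (n + 1) m) (T n m) x y t = - of_real (a n) * cnj (T (n + 1) m x y t) * cnj (T n m x y t)"
  proof (rule eq_y_step[of _ "S n m" "a n" "A (n + 1) m" "B (n + 1) m"])
    show "T (n + 1) m = (\<lambda>x y t. gauge_factor (S n m + a n) x y *
        along p (A (n + 1) m) (B (n + 1) m) (cdet N p) x y t)"
      using T[of "n + 1" "m"] unfolding S_n .
    show "T n m = (\<lambda>x y t. gauge_factor (S n m) x y * along p (damp p (of_real (a n)) (A (n + 1) m))
        (damp p (- of_real (a n)) (B (n + 1) m)) (cdet N p) x y t)"
      using T[of n m] unfolding A_n[of n m] B_n[of n m] .
    show "cnj (T (n + 1) m x y t) = \<kappa> * (gauge_factor (S n m + a n) x y *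
        along p (A (n + 1) m) (\<lambda>i. - B (n + 1) m i) (cdet N p) x y t)"
      using cnj_T[of "n + 1" "m" x y t] unfolding S_n .
    show "cnj (T n m x y t) = \<kappa> * (gauge_factor (S n m) x y * along p (damp p (of_real (a n)) (A (n + 1) m))
        (\<lambda>i. - damp p (- of_real (a n)) (B (n + 1) m) i) (cdet N p) x y t)"
      using cnj_T[of n m x y t] unfolding A_n[of n m] B_n[of n m] .
  qed
  show "hirota 0 1 0 (T n (m + 1)) (T n m) x y t = - of_real (b m) * cnj (T n (m + 1) x y t) * cnj (T n m x y t)"
  proof (rule eq_y_step[of _ "S n m" "b m" "A n (m + 1)" "B n (m + 1)"])
    show "T n (m + 1) = (\<lambda>x y t. gauge_factor (S n m + b m) x y *
        along p (A n (m + 1)) (B n (m + 1)) (cdet N p) x y t)"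
      using T[of "n" "m + 1"] unfolding S_m .
    show "T n m = (\<lambda>x y t. gauge_factor (S n m) x y * along p (damp p (of_real (b m)) (A n (m + 1)))
        (damp p (- of_real (b m)) (B n (m + 1))) (cdet N p) x y t)"
      using T[of n m] unfolding A_m[of n m] B_m[of n m] .
    show "cnj (T n (m + 1) x y t) = \<kappa> * (gauge_factor (S n m + b m) x y *
        along p (A n (m + 1)) (\<lambda>i. - B n (m + 1) i) (cdet N p) x y t)"
      using cnj_T[of "n" "m + 1" x y t] unfolding S_m .
    show "cnj (T n m x y t) = \<kappa> * (gauge_factor (S n m) x y * along p (damp p (of_real (b m)) (A n (m + 1)))
        (\<lambda>i. - damp p (- of_real (b m)) (B n (m + 1)) i) (cdet N p) x y t)"
      using cnj_T[of n m x y t] unfolding A_m[of n m] B_m[of n m] .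
  qed
qed

end

section \<open>Reality conditions: the concrete tau function as a tau family\<close>

lemma cnj_intprod: "cnj (intprod g n) = intprod (\<lambda>k. cnj (g k)) n"
  by (simp add: intprod_def)

lemma cnj_cdet: "cnj (cdet N p A B) = cdet N (\<lambda>i. cnj (p i)) (\<lambda>i. cnj (A i)) (\<lambda>i. cnj (B i))"
  by (simp add: cdet_leibniz)

lemma cdet_permute:
  assumes "\<sigma> permutes {0..<N}"
  shows "cdet N (\<lambda>i. p (\<sigma> i)) (\<lambda>i. A (\<sigma> i)) (\<lambda>i. B (\<sigma> i)) = signof \<sigma> * cdet N p A B"
proof -
  have "cmat N (\<lambda>i. p (\<sigma> i)) (\<lambda>i. A (\<sigma> i)) (\<lambda>i. B (\<sigma> i)) = Matrix.mat N N (\<lambda>(i, j). cmat N p A B $$ (\<sigma> i, j))"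
    using permutes_in_image[OF assms] by (intro eq_matI) (auto simp: cmat_entry)
  then show ?thesis unfolding cdet_def using det_permute_rows[OF cmat_carrier assms] by simp
qed

text \<open>The part of \<open>e_eta\<close> (and, with \<open>- a\<close>, \<open>- b\<close>, of \<open>e_mu\<close>) that does not depend on \<open>s, x, y, t\<close>.
  It is 0 for the indices beyond \<open>N\<close>, about which nothing is assumed.\<close>

definition base_eta where
  "base_eta a b N p \<alpha> n m = (\<lambda>i. if i < N then \<alpha> (Suc i) * intprod (\<lambda>k. inverse (1 - of_real (a k) * p (Suc i))) n
     * intprod (\<lambda>k. inverse (1 - of_real (b k) * p (Suc i))) m else 0)"
  for a b :: "int \<Rightarrow> real"

lemma intprod_inverse_step:
  "g n \<noteq> 0 \<Longrightarrow> intprod (\<lambda>k. inverse (g k)) n = g n * intprod (\<lambda>k. inverse (g k)) (n + 1)"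
  by (simp add: intprod_step[of "\<lambda>k. inverse (g k)"])

lemma base_eta_step:
  assumes "\<And>i n. i \<in> {1..N} \<Longrightarrow> 1 - of_real (a n) * p i \<noteq> 0" "\<And>i m. i \<in> {1..N} \<Longrightarrow> 1 - of_real (b m) * p i \<noteq> 0"
  shows "base_eta a b N p \<alpha> n m = damp (\<lambda>i. p (Suc i)) (of_real (a n)) (base_eta a b N p \<alpha> (n + 1) m)"
    and "base_eta a b N p \<alpha> n m = damp (\<lambda>i. p (Suc i)) (of_real (b m)) (base_eta a b N p \<alpha> n (m + 1))"
proof -
  show "base_eta a b N p \<alpha> n m = damp (\<lambda>i. p (Suc i)) (of_real (a n)) (base_eta a b N p \<alpha> (n + 1) m)"
  proof
    fix i
    show "base_eta a b N p \<alpha> n m i = damp (\<lambda>i. p (Suc i)) (of_real (a n)) (base_eta a b N p \<alpha> (n + 1) m) i"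
      using intprod_inverse_step[of "\<lambda>k. 1 - of_real (a k) * p (Suc i)" n] assms(1)[of "Suc i" n]
      by (cases "i < N") (simp_all add: base_eta_def damp_def)
  qed
  show "base_eta a b N p \<alpha> n m = damp (\<lambda>i. p (Suc i)) (of_real (b m)) (base_eta a b N p \<alpha> n (m + 1))"
  proof
    fix i
    show "base_eta a b N p \<alpha> n m i = damp (\<lambda>i. p (Suc i)) (of_real (b m)) (base_eta a b N p \<alpha> n (m + 1)) i"
      using intprod_inverse_step[of "\<lambda>k. 1 - of_real (b k) * p (Suc i)" m] assms(2)[of "Suc i" m]
      by (cases "i < N") (simp_all add: base_eta_def damp_def)
  qed
qed

lemma tau_along:
  "tau a b N p \<alpha> \<beta> n m = (\<lambda>x y t. gauge_factor (intsum a n + intsum b m) x y *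
     along (\<lambda>i. p (Suc i)) (base_eta a b N p \<alpha> n m) (base_eta (\<lambda>k. - a k) (\<lambda>k. - b k) N p \<beta> n m)
       (cdet N (\<lambda>i. p (Suc i))) x y t)"
proof (intro ext)
  fix x y t
  have "Matrix.mat N N (\<lambda>(i, j). e_eta a b p \<alpha> (i + 1) j n m x y t + e_mu a b p \<beta> (i + 1) j n m x y t) =
    cmat N (\<lambda>i. p (Suc i)) (amp (\<lambda>i. p (Suc i)) 1 (base_eta a b N p \<alpha> n m) x y t)
      (amp (\<lambda>i. p (Suc i)) (- 1) (base_eta (\<lambda>k. - a k) (\<lambda>k. - b k) N p \<beta> n m) x y t)"
    unfolding cmat_def
    by (intro cong_mat refl) (auto simp: e_eta_def e_mu_def amp_def phase_def base_eta_def)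
  then show "tau a b N p \<alpha> \<beta> n m x y t = gauge_factor (intsum a n + intsum b m) x y *
     along (\<lambda>i. p (Suc i)) (base_eta a b N p \<alpha> n m) (base_eta (\<lambda>k. - a k) (\<lambda>k. - b k) N p \<beta> n m)
       (cdet N (\<lambda>i. p (Suc i))) x y t"
    unfolding tau_def gauge_factor_def along_def cdet_def by (simp only: add.assoc)
qed

text \<open>The permutation \<open>\<sigma>\<close> is the identity for solitons and exchanges \<open>2 k - 1\<close> and \<open>2 k\<close> for breathers.\<close>

lemma tau_family_tau:
  fixes a b :: "int \<Rightarrow> real"
  assumes p: "\<And>i. i \<in> {1..N} \<Longrightarrow> p i \<noteq> 0"
    and a: "\<And>i n. i \<in> {1..N} \<Longrightarrow> 1 + of_real (a n) * p i \<noteq> 0 \<and> 1 - of_real (a n) * p i \<noteq> 0"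
    and b: "\<And>i m. i \<in> {1..N} \<Longrightarrow> 1 + of_real (b m) * p i \<noteq> 0 \<and> 1 - of_real (b m) * p i \<noteq> 0"
    and \<sigma>: "\<sigma> permutes {0..<N}"
    and conj: "\<And>i. i < N \<Longrightarrow> cnj (p (Suc i)) = p (Suc (\<sigma> i))" "\<And>i. i < N \<Longrightarrow> cnj (\<alpha> (Suc i)) = \<alpha> (Suc (\<sigma> i))"
      "\<And>i. i < N \<Longrightarrow> cnj (\<beta> (Suc i)) = - \<beta> (Suc (\<sigma> i))"
  shows "tau_family N (\<lambda>i. p (Suc i)) a b (base_eta a b N p \<alpha>) (base_eta (\<lambda>k. - a k) (\<lambda>k. - b k) N p \<beta>)
    (\<lambda>n m. intsum a n + intsum b m) (tau a b N p \<alpha> \<beta>) (signof \<sigma>)"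
proof
  let ?p = "\<lambda>i. p (Suc i)" and ?A = "base_eta a b N p \<alpha>" and ?B = "base_eta (\<lambda>k. - a k) (\<lambda>k. - b k) N p \<beta>"
  show "?p i \<noteq> 0" if "i < N" for i using p that by simp
  show "?A n m = damp ?p (of_real (a n)) (?A (n + 1) m)" "?A n m = damp ?p (of_real (b m)) (?A n (m + 1))" for n m
    by (rule base_eta_step; use a b in blast)+
  have B: "?B n m = damp ?p (of_real (- a n)) (?B (n + 1) m)" "?B n m = damp ?p (of_real (- b m)) (?B n (m + 1))" for n m
    by (rule base_eta_step; use a b in simp)+
  show "?B n m = damp ?p (- of_real (a n)) (?B (n + 1) m)" for n m
    using B(1)[of n m] unfolding of_real_minus .
  show "?B n m = damp ?p (- of_real (b m)) (?B n (m + 1))" for n m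
    using B(2)[of n m] unfolding of_real_minus .
  show "intsum a (n + 1) + intsum b m = intsum a n + intsum b m + a n" for n m
    using intsum_step[of a n] by simp
  show "intsum a n + intsum b (m + 1) = intsum a n + intsum b m + b m" for n m
    using intsum_step[of b m] by simp
  show "tau a b N p \<alpha> \<beta> n m = (\<lambda>x y t. gauge_factor (intsum a n + intsum b m) x y * along ?p (?A n m) (?B n m) (cdet N ?p) x y t)"
    for n m by (rule tau_along)
  show "(complex_of_int (sign \<sigma>))\<^sup>2 = 1"
    by (simp add: sign_def)
  fix n m x y t
  have lt: "\<sigma> i < N \<longleftrightarrow> i < N" for i using permutes_in_image[OF \<sigma>, of i] by simp
  \<comment> \<open>Conjugation turns row i into row \<open>\<sigma> i\<close> with its
    \<open>B\<close> part negated; undoing the row permutation costs its sign.\<close>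
  have "cnj (cdet N ?p (amp ?p 1 (?A n m) x y t) (amp ?p (- 1) (?B n m) x y t)) =
    cdet N (\<lambda>i. ?p (\<sigma> i)) (\<lambda>i. amp ?p 1 (?A n m) x y t (\<sigma> i)) (\<lambda>i. - amp ?p (- 1) (?B n m) x y t (\<sigma> i))"
    unfolding cnj_cdet unfolding cdet_def cmat_def
    by (rule arg_cong[of _ _ Determinant.det], intro cong_mat refl)
       (auto simp: amp_def phase_def base_eta_def cnj_intprod conj lt exp_cnj)
  also have "\<dots> = signof \<sigma> * cdet N ?p (amp ?p 1 (?A n m) x y t) (\<lambda>i. - amp ?p (- 1) (?B n m) x y t i)"
    using cdet_permute[OF \<sigma>, of ?p "amp ?p 1 (?A n m) x y t" "\<lambda>i. - amp ?p (- 1) (?B n m) x y t i"] by simp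
  finally show "cnj (tau a b N p \<alpha> \<beta> n m x y t) = signof \<sigma> *
     (gauge_factor (intsum a n + intsum b m) x y * along ?p (?A n m) (\<lambda>i. - ?B n m i) (cdet N ?p) x y t)"
    unfolding tau_along along_def amp_uminus
    by (simp add: gauge_factor_def exp_cnj)
qed

text \<open>Rows are numbered from 0, so the partner of an even row is the next one. Numbers from
  \<open>N\<close> on are fixed, as \<open>permutes\<close> requires.\<close>

definition pair_swap :: "nat \<Rightarrow> nat \<Rightarrow> nat" where
  "pair_swap N i = (if i < N then if even i then Suc i else i - 1 else i)"

lemma pair_swap_permutes: "even N \<Longrightarrow> pair_swap N permutes {0..<N}"
proof -
  assume N: "even N"
  have inv: "pair_swap N (pair_swap N i) = i" for i
    using N by (auto simp: pair_swap_def elim!: evenE oddE)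
  show "pair_swap N permutes {0..<N}"
    unfolding permutes_def
  proof (intro conjI allI impI)
    show "pair_swap N i = i" if "i \<notin> {0..<N}" for i using that by (simp add: pair_swap_def)
    show "\<exists>!j. pair_swap N j = i" for i by (rule ex1I[of _ "pair_swap N i"]) (use inv in auto)
  qed
qed

section \<open>The potential mKdV equation\<close>

lemma has_vector_derivative_divide_complex:
  fixes f g :: "real \<Rightarrow> complex"
  assumes "(f has_vector_derivative f') (at s)" "(g has_vector_derivative g') (at s)" "g s \<noteq> 0"
  shows "((\<lambda>s. f s / g s) has_vector_derivative (f' * g s - f s * g') / (g s)\<^sup>2) (at s)"
proof -
  have "((\<lambda>s. f s / g s) has_derivative (\<lambda>h. (h *\<^sub>R f' * g s - f s * (h *\<^sub>R g')) / (g s * g s))) (at s)"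
    by (rule has_derivative_divide'[OF assms(1,2)[unfolded has_vector_derivative_def] assms(3)])
  then show ?thesis
    unfolding has_vector_derivative_def
    by (rule has_derivative_eq_rhs) (auto simp: fun_eq_iff power2_eq_square scaleR_conv_of_real algebra_simps)
qed

lemma has_vector_derivative_cnj_fun:
  "(f has_vector_derivative f') (at s) \<Longrightarrow> ((\<lambda>s. cnj (f s)) has_vector_derivative cnj f') (at s)"
  by (rule bounded_linear.has_vector_derivative[OF bounded_linear_cnj])

lemma has_real_derivative_Im:
  "(f has_vector_derivative f') (at s) \<Longrightarrow> ((\<lambda>s. Im (f s)) has_real_derivative Im f') (at s)"
  unfolding has_real_derivative_iff_has_vector_derivative
  by (rule bounded_linear.has_vector_derivative[OF bounded_linear_Im])

text \<open>Differentiating exp (L z) = z gives L' = 1 / z for any branch. So the derivative of L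
  along the quotient of f and its conjugate is f'/f minus the conjugate of f'/f, that is 2 i Im
  (f'/f), and the factor 2 / i makes it 4 Im (f'/f).\<close>

lemma theta_derivative:
  fixes f :: "real \<Rightarrow> complex" and \<theta> :: "real \<Rightarrow> real"
  assumes f: "(f has_vector_derivative f') (at s)" and nz: "f s \<noteq> 0"
    and V: "open V" "L holomorphic_on V" "\<And>z. z \<in> V \<Longrightarrow> exp (L z) = z"
    and ev: "eventually (\<lambda>s. f s / cnj (f s) \<in> V \<and> of_real (\<theta> s) = 2 / \<i> * L (f s / cnj (f s))) (nhds s)"
  shows "(\<theta> has_real_derivative 4 * Im (f' / f s)) (at s)"
proof -
  let ?g = "\<lambda>s. f s / cnj (f s)"
  have gV: "?g s \<in> V" using eventually_nhds_x_imp_x[OF ev] by simp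
  obtain L' where L': "(L has_field_derivative L') (at (?g s))"
    using V gV by (meson holomorphic_on_imp_differentiable_at field_differentiable_def)
  have "((\<lambda>z. exp (L z)) has_field_derivative exp (L (?g s)) * L') (at (?g s))"
    by (rule DERIV_chain2[OF DERIV_exp L'])
  then have "((\<lambda>z. z) has_field_derivative exp (L (?g s)) * L') (at (?g s))"
    by (rule has_field_derivative_transform_within_open[OF _ V(1) gV]) (use V(3) in auto)
  then have L'g: "?g s * L' = 1" using DERIV_ident DERIV_unique V(3)[OF gV] by metis
  have g: "(?g has_vector_derivative (f' * cnj (f s) - f s * cnj f') / (cnj (f s))\<^sup>2) (at s)"
    using nz by (intro has_vector_derivative_divide_complex has_vector_derivative_cnj_fun f) auto
  have L'eq: "L' = cnj (f s) / f s" using L'g nz by (simp add: field_simps)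
  have "(f' * cnj (f s) - f s * cnj f') / (cnj (f s))\<^sup>2 * L' = f' / f s - cnj (f' / f s)"
    unfolding L'eq using nz by (simp add: field_simps power2_eq_square)
  then have "((\<lambda>s. L (?g s)) has_vector_derivative (f' / f s - cnj (f' / f s))) (at s)"
    using field_vector_diff_chain_at[OF g L'] by (simp only: o_def)
  then have "((\<lambda>s. Im (2 * L (?g s))) has_real_derivative Im (2 * (f' / f s - cnj (f' / f s)))) (at s)"
    by (intro has_real_derivative_Im has_vector_derivative_mult_right)
  also have "Im (2 * (z - cnj z)) = 4 * Im z" for z by simp
  finally have "((\<lambda>s. Im (2 * L (?g s))) has_real_derivative 4 * Im (f' / f s)) (at s)" .
  moreover have "eventually (\<lambda>s. \<theta> s = Im (2 * L (?g s))) (nhds s)"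
    using ev
  proof eventually_elim
    case (elim s)
    then have "Re (of_real (\<theta> s)) = Re (2 / \<i> * L (?g s))" by (simp only:)
    then show ?case by (simp add: Re_divide Im_divide)
  qed
  ultimately show ?thesis by (simp only: DERIV_cong_ev[OF refl _ refl])
qed

lemma theta_branch_local:
  assumes "theta_branch f U \<theta>" "(x, y, t) \<in> U"
  obtains W V L where "open W" "(x, y, t) \<in> W" "open V" "L holomorphic_on V" "\<And>z. z \<in> V \<Longrightarrow> exp (L z) = z"
    "\<And>x y t. (x, y, t) \<in> W \<Longrightarrow> f x y t / cnj (f x y t) \<in> V \<and> of_real (\<theta> x y t) = 2 / \<i> * L (f x y t / cnj (f x y t))"
proof -
  have "\<exists>W V L. open W \<and> (x, y, t) \<in> W \<and> W \<subseteq> U \<and>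
        open V \<and> L holomorphic_on V \<and> (\<forall>z\<in>V. exp (L z) = z) \<and>
        (\<forall>(x, y, t)\<in>W. f x y t / cnj (f x y t) \<in> V \<and>
           complex_of_real (\<theta> x y t) = 2 / \<i> * L (f x y t / cnj (f x y t)))"
    using assms unfolding theta_branch_def by blast
  then obtain W V L where "open W" "(x, y, t) \<in> W" "open V" "L holomorphic_on V" "\<forall>z\<in>V. exp (L z) = z"
    and W: "\<forall>(x, y, t)\<in>W. f x y t / cnj (f x y t) \<in> V \<and>
           complex_of_real (\<theta> x y t) = 2 / \<i> * L (f x y t / cnj (f x y t))" by blast
  then show ?thesis using that[of W V L] by fast
qed

lemma theta_branch_nonzero: "theta_branch f U \<theta> \<Longrightarrow> (x, y, t) \<in> U \<Longrightarrow> f x y t \<noteq> 0"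
  unfolding theta_branch_def by blast

lemma eventually_slice:
  assumes "open W" "(x, y, t) \<in> (W :: (real \<times> real \<times> real) set)"
  shows "eventually (\<lambda>\<xi>. (\<xi>, y, t) \<in> W) (nhds x)" "eventually (\<lambda>\<xi>. (x, y, \<xi>) \<in> W) (nhds t)"
proof -
  have "open ((\<lambda>\<xi>. (\<xi>, y, t)) -` W)" "open ((\<lambda>\<xi>. (x, y, \<xi>)) -` W)"
    by (intro open_vimage assms(1) continuous_intros)+
  then show "eventually (\<lambda>\<xi>. (\<xi>, y, t) \<in> W) (nhds x)" "eventually (\<lambda>\<xi>. (x, y, \<xi>) \<in> W) (nhds t)"
    using assms(2) by (auto simp: eventually_nhds)
qed

lemma theta_branch_derivs:
  assumes br: "theta_branch f U \<theta>" and P: "(x, y, t) \<in> U" and d: "dx f fx" "dt f ft"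
  shows "((\<lambda>\<xi>. \<theta> \<xi> y t) has_real_derivative 4 * Im (fx x y t / f x y t)) (at x)"
    and "((\<lambda>\<xi>. \<theta> x y \<xi>) has_real_derivative 4 * Im (ft x y t / f x y t)) (at t)"
proof -
  obtain W V L where WVL: "open W" "(x, y, t) \<in> W" "open V" "L holomorphic_on V" "\<And>z. z \<in> V \<Longrightarrow> exp (L z) = z"
    "\<And>x y t. (x, y, t) \<in> W \<Longrightarrow> f x y t / cnj (f x y t) \<in> V \<and> of_real (\<theta> x y t) = 2 / \<i> * L (f x y t / cnj (f x y t))"
    by (rule theta_branch_local[OF br P]) blast
  note nz = theta_branch_nonzero[OF br P]
  show "((\<lambda>\<xi>. \<theta> \<xi> y t) has_real_derivative 4 * Im (fx x y t / f x y t)) (at x)"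
    by (rule theta_derivative[OF dxD[OF d(1)] nz WVL(3-5)], assumption)
       (rule eventually_mono[OF eventually_slice(1)[OF WVL(1,2)]], erule WVL(6))
  show "((\<lambda>\<xi>. \<theta> x y \<xi>) has_real_derivative 4 * Im (ft x y t / f x y t)) (at t)"
    by (rule theta_derivative[OF dtD[OF d(2)] nz WVL(3-5)], assumption)
       (rule eventually_mono[OF eventually_slice(2)[OF WVL(1,2)]], erule WVL(6))
qed

lemma of_real_Im: "complex_of_real (Im z) = - \<i> / 2 * (z - cnj z)"
  by (simp add: complex_eq_iff)

text \<open>Here \<open>u1\<close>, \<open>u2\<close>, \<open>u3\<close>, \<open>ut\<close> stand for \<open>\<tau>\<^sub>x/\<tau>\<close>, \<open>\<tau>\<^sub>x\<^sub>x/\<tau>\<close>, \<open>\<tau>\<^sub>x\<^sub>x\<^sub>x/\<tau>\<close>, \<open>\<tau>\<^sub>t/\<tau>\<close>.\<close>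

lemma mKdV_from_bilinear:
  assumes u: "u2 - 2 * u1 * cnj u1 + cnj u2 = 0"
    and t: "u3 - 3 * u2 * cnj u1 + 3 * u1 * cnj u2 - cnj u3 + (ut - cnj ut) = 0"
  shows "4 * Im ut + 1 / 2 * (4 * Im u1) ^ 3 + 4 * Im (u3 - 3 * u2 * u1 + 2 * u1 ^ 3) = 0"
proof -
  \<comment> \<open>Conjugates become independent unknowns. The two bilinear equations eliminate
    \<open>v2\<close> and \<open>ut\<close>, and a polynomial identity in the others
    remains.\<close>
  define v1 v2 v3 vt where "v1 = cnj u1" and "v2 = cnj u2" and "v3 = cnj u3" and "vt = cnj ut"
  note v = v1_def v2_def v3_def vt_def
  have v2: "v2 = 2 * u1 * v1 - u2" using u unfolding v[symmetric] by (simp add: algebra_simps add_eq_0_iff2)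
  have ut: "ut = vt - u3 + 3 * u2 * v1 - 3 * u1 * v2 + v3"
    using t unfolding v[symmetric] by (simp add: algebra_simps)
  have "complex_of_real (4 * Im ut + 1 / 2 * (4 * Im u1) ^ 3 + 4 * Im (u3 - 3 * u2 * u1 + 2 * u1 ^ 3)) =
    4 * (- \<i> / 2 * (ut - vt)) + 1 / 2 * (4 * (- \<i> / 2 * (u1 - v1))) ^ 3
      + 4 * (- \<i> / 2 * ((u3 - 3 * u2 * u1 + 2 * u1 ^ 3) - (v3 - 3 * v2 * v1 + 2 * v1 ^ 3)))"
    unfolding of_real_add of_real_mult of_real_power of_real_Im v by simp
  also have "\<dots> = - 2 * \<i> * ((ut - vt) - 2 * (u1 - v1) ^ 3
      + ((u3 - 3 * u2 * u1 + 2 * u1 ^ 3) - (v3 - 3 * v2 * v1 + 2 * v1 ^ 3)))"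
    by (simp add: field_simps power3_eq_cube)
  also have "(ut - vt) - 2 * (u1 - v1) ^ 3 + ((u3 - 3 * u2 * u1 + 2 * u1 ^ 3) - (v3 - 3 * v2 * v1 + 2 * v1 ^ 3)) = 0"
    unfolding ut v2 by (simp add: algebra_simps power3_eq_cube power2_eq_square)
  finally show ?thesis by (metis mult_zero_right of_real_eq_0_iff)
qed

lemma potential_mKdV_theta:
  assumes br: "theta_branch f U \<theta>"
    and d: "dx f fx" "dx fx fxx" "dx fxx fxxx" "dt f ft"
    and bil: "\<And>x y t. hirota 2 0 0 f (conj_fun f) x y t = 0"
      "\<And>x y t. hirota 3 0 0 f (conj_fun f) x y t + hirota 0 0 1 f (conj_fun f) x y t = 0"
  shows "potential_mKdV_on U \<theta>"
proof -
  have cx: "dx (conj_fun g) (conj_fun g')" if "dx g g'" for g g'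
    using that unfolding dx_def conj_fun_def by (auto intro: has_vector_derivative_cnj_fun)
  have ct: "dt (conj_fun g) (conj_fun g')" if "dt g g'" for g g'
    using that unfolding dt_def conj_fun_def by (auto intro: has_vector_derivative_cnj_fun)
  note h2 = hirota_200[OF d(1-3) d(1-3)[THEN cx]]
    and h3 = hirota_300[OF d(1-3) d(1-3)[THEN cx]] and ht = hirota_001[OF d(4) ct[OF d(4)]]
  define \<theta>x \<theta>t \<theta>xx \<theta>xxx where "\<theta>x = (\<lambda>x y t. 4 * Im (fx x y t / f x y t))"
    and "\<theta>t = (\<lambda>x y t. 4 * Im (ft x y t / f x y t))"
    and "\<theta>xx = (\<lambda>x y t. 4 * Im ((fxx x y t * f x y t - fx x y t * fx x y t) / (f x y t)\<^sup>2))"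
    and "\<theta>xxx = (\<lambda>x y t. 4 * Im (fxxx x y t / f x y t - 3 * (fxx x y t / f x y t) * (fx x y t / f x y t)
        + 2 * (fx x y t / f x y t) ^ 3))"
  show ?thesis
    unfolding potential_mKdV_on_def
  proof (rule exI[of _ \<theta>t], rule exI[of _ \<theta>x], rule exI[of _ \<theta>xx], rule exI[of _ \<theta>xxx], clarify, intro conjI)
    fix x y t assume P: "(x, y, t) \<in> U"
    note nz = theta_branch_nonzero[OF br P]
    show "((\<lambda>\<tau>. \<theta> x y \<tau>) has_real_derivative \<theta>t x y t) (at t)"
      "((\<lambda>\<xi>. \<theta> \<xi> y t) has_real_derivative \<theta>x x y t) (at x)"
      unfolding \<theta>t_def \<theta>x_def by (rule theta_branch_derivs[OF br P d(1,4)])+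
    have dq: "((\<lambda>\<xi>. fx \<xi> y t / f \<xi> y t) has_vector_derivative
        (fxx x y t * f x y t - fx x y t * fx x y t) / (f x y t)\<^sup>2) (at x)"
      by (intro has_vector_derivative_divide_complex dxD d nz)
    show "((\<lambda>\<xi>. \<theta>x \<xi> y t) has_real_derivative \<theta>xx x y t) (at x)"
      unfolding \<theta>x_def \<theta>xx_def by (intro DERIV_cmult has_real_derivative_Im dq)
    have "((\<lambda>\<xi>. fxx \<xi> y t * f \<xi> y t - fx \<xi> y t * fx \<xi> y t) has_vector_derivative
        (fxx x y t * fx x y t + fxxx x y t * f x y t) - (fx x y t * fxx x y t + fxx x y t * fx x y t)) (at x)"
      by (intro has_vector_derivative_diff has_vector_derivative_mult dxD d)
    moreover have "((\<lambda>\<xi>. f \<xi> y t * f \<xi> y t) has_vector_derivative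
        (f x y t * fx x y t + fx x y t * f x y t)) (at x)"
      by (intro has_vector_derivative_mult dxD d)
    ultimately have "((\<lambda>\<xi>. (fxx \<xi> y t * f \<xi> y t - fx \<xi> y t * fx \<xi> y t) / (f \<xi> y t * f \<xi> y t)) has_vector_derivative
       (((fxx x y t * fx x y t + fxxx x y t * f x y t) - (fx x y t * fxx x y t + fxx x y t * fx x y t)) * (f x y t * f x y t)
         - (fxx x y t * f x y t - fx x y t * fx x y t) * (f x y t * fx x y t + fx x y t * f x y t))
        / (f x y t * f x y t)\<^sup>2) (at x)"
      using nz by (intro has_vector_derivative_divide_complex) auto
    also have "(((fxx x y t * fx x y t + fxxx x y t * f x y t) - (fx x y t * fxx x y t + fxx x y t * fx x y t)) * (f x y t * f x y t)
         - (fxx x y t * f x y t - fx x y t * fx x y t) * (f x y t * fx x y t + fx x y t * f x y t))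
        / (f x y t * f x y t)\<^sup>2 = fxxx x y t / f x y t - 3 * (fxx x y t / f x y t) * (fx x y t / f x y t)
        + 2 * (fx x y t / f x y t) ^ 3"
      using nz by (simp add: field_simps power2_eq_square power3_eq_cube)
    finally show "((\<lambda>\<xi>. \<theta>xx \<xi> y t) has_real_derivative \<theta>xxx x y t) (at x)"
      unfolding \<theta>xx_def \<theta>xxx_def power2_eq_square by (intro DERIV_cmult has_real_derivative_Im)
    define u1 u2 u3 ut where "u1 = fx x y t / f x y t" and "u2 = fxx x y t / f x y t"
      and "u3 = fxxx x y t / f x y t" and "ut = ft x y t / f x y t"
    have fs: "fx x y t = u1 * f x y t" "fxx x y t = u2 * f x y t" "fxxx x y t = u3 * f x y t" "ft x y t = ut * f x y t"
      using nz by (simp_all add: u1_def u2_def u3_def ut_def)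
    have "(f x y t * cnj (f x y t)) * (u2 - 2 * u1 * cnj u1 + cnj u2) = 0"
      using bil(1)[of x y t] unfolding h2 conj_fun_def fs by (simp add: algebra_simps)
    then have e2: "u2 - 2 * u1 * cnj u1 + cnj u2 = 0" using nz by simp
    have "(f x y t * cnj (f x y t)) * (u3 - 3 * u2 * cnj u1 + 3 * u1 * cnj u2 - cnj u3 + (ut - cnj ut)) = 0"
      using bil(2)[of x y t] unfolding h3 ht conj_fun_def fs by (simp add: algebra_simps)
    then have e3: "u3 - 3 * u2 * cnj u1 + 3 * u1 * cnj u2 - cnj u3 + (ut - cnj ut) = 0" using nz by simp
    show "\<theta>t x y t + 1 / 2 * \<theta>x x y t ^ 3 + \<theta>xxx x y t = 0"
      using mKdV_from_bilinear[OF e2 e3] unfolding \<theta>t_def \<theta>x_def \<theta>xxx_def u1_def u2_def u3_def ut_def .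
  qed
qed

section \<open>The discrete potential mKdV equation\<close>

text \<open>The quotient of f and its conjugate has modulus 1. On the unit ball about its value w
  the ratio z / w stays in the right half-plane, so Ln (z / w) + Ln w is a holomorphic logarithm
  there even if w lies on the cut of \<open>Ln\<close>. Modulus 1 makes this logarithm purely
  imaginary, hence theta real.\<close>

lemma theta_branch_exists:
  assumes cont: "continuous_on UNIV (\<lambda>(x, y, t). f x y t)" and nz: "f x0 y0 t0 \<noteq> 0"
  shows "\<exists>U \<theta>. (x0, y0, t0) \<in> U \<and> theta_branch f U \<theta>"
proof -
  define g where "g = (\<lambda>(x, y, t). f x y t / cnj (f x y t))"
  define w where "w = g (x0, y0, t0)"
  define V where "V = ball w 1"
  define L where "L = (\<lambda>z. Ln (z / w) + Ln w)"
  define U1 where "U1 = {P. (\<lambda>(x, y, t). f x y t) P \<noteq> 0}"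
  define U where "U = U1 \<inter> g -` V"
  have w: "norm w = 1" using nz by (simp add: w_def g_def norm_divide)
  then have w0: "w \<noteq> 0" by auto
  have U1: "open U1" unfolding U1_def by (intro open_Collect_neq cont continuous_on_const)
  have "continuous_on U1 (\<lambda>P. (\<lambda>(x, y, t). f x y t) P / cnj ((\<lambda>(x, y, t). f x y t) P))"
    by (intro continuous_intros continuous_on_subset[OF cont]) (auto simp: U1_def)
  then have "continuous_on U1 g" by (rule continuous_on_eq) (auto simp: g_def)
  then have U: "open U" unfolding U_def V_def using U1 by (intro continuous_open_preimage) auto
  have pos: "z / w \<notin> \<real>\<^sub>\<le>\<^sub>0" if "z \<in> V" for z
  proof
    assume "z / w \<in> \<real>\<^sub>\<le>\<^sub>0"
    then have "Re (z / w) \<le> 0" by (auto simp: complex_nonpos_Reals_iff)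
    moreover have "z / w - 1 = (z - w) / w" using w0 by (simp add: diff_divide_distrib)
    then have "norm (z / w - 1) = norm (z - w) / norm w" by (simp only: norm_divide)
    moreover have "norm (z - w) < 1" using that by (simp add: V_def dist_norm norm_minus_commute)
    ultimately have "norm (z / w - 1) < 1" using w by simp
    then have "\<bar>Re (z / w - 1)\<bar> < 1" using abs_Re_le_cmod[of "z / w - 1"] by linarith
    then show False using \<open>Re (z / w) \<le> 0\<close> by simp
  qed
  have L: "L holomorphic_on V" unfolding L_def
    using pos w0 by (intro holomorphic_intros) auto
  have eL: "exp (L z) = z" if "z \<in> V" for z
  proof -
    have "z / w \<noteq> 0" using pos[OF that] by auto
    then show ?thesis using w0 by (simp add: L_def exp_add)
  qed
  define \<theta> where "\<theta> = (\<lambda>x y t. Re (2 / \<i> * L (g (x, y, t))))"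
  have real: "of_real (\<theta> x y t) = 2 / \<i> * L (g (x, y, t))" if "(x, y, t) \<in> U" for x y t
  proof -
    have "norm (g (x, y, t)) = 1" using that by (simp add: U_def U1_def g_def norm_divide)
    moreover have "exp (L (g (x, y, t))) = g (x, y, t)" using that eL by (simp add: U_def)
    ultimately have "exp (Re (L (g (x, y, t)))) = 1" using norm_exp_eq_Re[of "L (g (x, y, t))"] by simp
    then have "Re (L (g (x, y, t))) = 0" by simp
    then show ?thesis by (simp add: \<theta>_def complex_eq_iff Re_divide Im_divide)
  qed
  have "theta_branch f U \<theta>"
    unfolding theta_branch_def
  proof (intro conjI U ballI)
    fix P assume P: "P \<in> U"
    show "case P of (x, y, t) \<Rightarrow> f x y t \<noteq> 0" using P by (auto simp: U_def U1_def)
    show "\<exists>W V L. open W \<and> P \<in> W \<and> W \<subseteq> U \<and> open V \<and> L holomorphic_on V \<and> (\<forall>z\<in>V. exp (L z) = z) \<and>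
        (\<forall>(x, y, t)\<in>W. f x y t / cnj (f x y t) \<in> V \<and>
           complex_of_real (\<theta> x y t) = 2 / \<i> * L (f x y t / cnj (f x y t)))"
    proof (rule exI[of _ U], rule exI[of _ V], rule exI[of _ L], intro conjI U P L ballI eL subset_refl)
      show "open V" by (simp add: V_def)
      fix Q assume Q: "Q \<in> U"
      obtain x y t where "Q = (x, y, t)" by (cases Q)
      then show "case Q of (x, y, t) \<Rightarrow> f x y t / cnj (f x y t) \<in> V \<and>
           complex_of_real (\<theta> x y t) = 2 / \<i> * L (f x y t / cnj (f x y t))"
        using Q real[of x y t] by (auto simp: U_def g_def)
    qed assumption+
  qed
  moreover have "(x0, y0, t0) \<in> U" using nz by (simp add: U_def U1_def V_def w_def)
  ultimately show ?thesis by blast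
qed

text \<open>\<open>\<tau> e\<^bsup>-i\<Theta>/4\<^esup>\<close> equals its conjugate because \<open>e\<^bsup>i\<Theta>/2\<^esup> = \<tau>/\<tau>\<^sup>*\<close>.\<close>

lemma theta_branch_polar:
  assumes br: "theta_branch f U \<theta>" and P: "(x, y, t) \<in> U"
  obtains r :: real where "r \<noteq> 0" "f x y t = of_real r * cis (\<theta> x y t / 4)"
proof -
  obtain W V L where WVL: "(x, y, t) \<in> W" "\<And>z. z \<in> V \<Longrightarrow> exp (L z) = z"
    "\<And>x y t. (x, y, t) \<in> W \<Longrightarrow> f x y t / cnj (f x y t) \<in> V \<and> of_real (\<theta> x y t) = 2 / \<i> * L (f x y t / cnj (f x y t))"
    by (rule theta_branch_local[OF br P]) blast
  note nz = theta_branch_nonzero[OF br P]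
  let ?f = "f x y t" and ?\<theta> = "\<theta> x y t"
  have "L (?f / cnj ?f) = \<i> * of_real (?\<theta> / 2)"
    using WVL(3)[OF WVL(1)] by (simp add: field_simps)
  then have "?f / cnj ?f = cis (?\<theta> / 2)"
    using WVL(2)[of "?f / cnj ?f"] WVL(3)[OF WVL(1)] by (simp add: cis_conv_exp)
  then have f: "?f = cis (?\<theta> / 2) * cnj ?f" using nz by (simp add: field_simps)
  define r where "r = ?f * cis (- ?\<theta> / 4)"
  have "cnj r = cnj ?f * cis (?\<theta> / 4)" by (simp add: r_def cis_cnj)
  also have "cis (?\<theta> / 4) = cis (?\<theta> / 2) * cis (- ?\<theta> / 4)" by (simp add: cis_mult)
  also have "cnj ?f * (cis (?\<theta> / 2) * cis (- ?\<theta> / 4)) = r"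
    unfolding r_def by (subst (2) f) (simp add: mult_ac)
  finally have "r \<in> \<real>" by (simp add: Reals_cnj_iff)
  then obtain s where s: "r = of_real s" by (auto elim: Reals_cases)
  have "?f = r * cis (?\<theta> / 4)" by (simp add: r_def mult.assoc cis_mult)
  then show ?thesis using that[of s] nz s by auto
qed

text \<open>As a and b differ, the real part gives R cos B = S cos A; the imaginary part gives (b -
  a) S sin A = (b + a) R sin B. Multiplying the latter by cos B and cancelling S yields the
  cross-multiplied form, whether or not a cosine vanishes.\<close>

lemma tan_equation_from_lattice:
  fixes a b R S A B :: real
  assumes "of_real (b * R) * cis (- B) - of_real (a * R) * cis B + of_real ((a - b) * S) * cis (- A) = 0"
    and "R \<noteq> 0" "S \<noteq> 0" "a \<noteq> b"
  shows "tan_equation b a A B"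
proof -
  have re: "b * R * cos B - a * R * cos B + (a - b) * S * cos A = 0"
    and im: "- (b * R * sin B) - a * R * sin B - (a - b) * S * sin A = 0"
    using arg_cong[OF assms(1), of Re] arg_cong[OF assms(1), of Im] by simp_all
  have "(b - a) * (R * cos B - S * cos A) = 0" using re by (simp add: algebra_simps)
  then have c: "R * cos B = S * cos A" using assms(4) by simp
  have s: "(b - a) * S * sin A = (b + a) * R * sin B" using im by (simp add: algebra_simps)
  have "S * ((b - a) * sin A * cos B) = ((b - a) * S * sin A) * cos B" by simp
  also have "\<dots> = (b + a) * sin B * (R * cos B)" unfolding s by simp
  also have "\<dots> = S * ((b + a) * cos A * sin B)" unfolding c by simp
  finally have cross: "(b - a) * sin A * cos B = (b + a) * cos A * sin B" using assms(3) by simp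
  show ?thesis
    unfolding tan_equation_def using cross assms(4)
    by (auto simp: tan_def field_simps)
qed

lemma discrete_mKdV_theta:
  assumes bil: "of_real b * cnj T01 * T10 - of_real a * cnj T10 * T01 + of_real (a - b) * cnj T11 * T00 = 0"
    and polar: "T00 = of_real r00 * cis (\<theta>00 / 4)" "T01 = of_real r01 * cis (\<theta>01 / 4)"
      "T10 = of_real r10 * cis (\<theta>10 / 4)" "T11 = of_real r11 * cis (\<theta>11 / 4)"
    and nz: "r00 \<noteq> 0" "r01 \<noteq> 0" "r10 \<noteq> 0" "r11 \<noteq> 0" "a \<noteq> b"
  shows "tan_equation b a ((\<theta>11 - \<theta>00) / 4) ((\<theta>01 - \<theta>10) / 4)"
proof (rule tan_equation_from_lattice[of _ "r01 * r10" _ _ "r11 * r00"])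
  have m: "cis (- (u / 4)) * cis (v / 4) = cis ((v - u) / 4)" for u v
    by (simp add: cis_mult diff_divide_distrib)
  have "of_real (b * (r01 * r10)) * cis (- ((\<theta>01 - \<theta>10) / 4)) - of_real (a * (r01 * r10)) * cis ((\<theta>01 - \<theta>10) / 4)
     + of_real ((a - b) * (r11 * r00)) * cis (- ((\<theta>11 - \<theta>00) / 4)) =
    of_real b * of_real r01 * of_real r10 * (cis (- (\<theta>01 / 4)) * cis (\<theta>10 / 4))
     - of_real a * of_real r10 * of_real r01 * (cis (- (\<theta>10 / 4)) * cis (\<theta>01 / 4))
     + of_real (a - b) * of_real r11 * of_real r00 * (cis (- (\<theta>11 / 4)) * cis (\<theta>00 / 4))"
    unfolding m by (simp add: algebra_simps diff_divide_distrib)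
  also have "\<dots> = 0"
    using bil unfolding polar by (simp add: cis_cnj algebra_simps)
  finally show "of_real (b * (r01 * r10)) * cis (- ((\<theta>01 - \<theta>10) / 4)) - of_real (a * (r01 * r10)) * cis ((\<theta>01 - \<theta>10) / 4)
     + of_real ((a - b) * (r11 * r00)) * cis (- ((\<theta>11 - \<theta>00) / 4)) = 0" .
qed (use nz in auto)

context tau_family
begin

lemma T_continuous: "continuous_on UNIV (\<lambda>(x, y, t). T n m x y t)"
  unfolding T along_def cdet_leibniz amp_def phase_def gauge_factor_def case_prod_beta
  by (intro continuous_on_sum continuous_on_prod continuous_on_add continuous_on_diff continuous_on_mult
      continuous_on_minus continuous_on_power continuous_on_exp continuous_on_of_real
      continuous_on_fst continuous_on_snd continuous_on_id continuous_on_const)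

theorem solutions:
  assumes "\<And>n m. a n \<noteq> b m"
  shows "gives_mKdV_solutions a b T"
  unfolding gives_mKdV_solutions_def
proof (intro conjI allI impI)
  fix n m x y t assume "T n m x y t \<noteq> 0"
  then show "\<exists>U \<theta>. (x, y, t) \<in> U \<and> theta_branch (T n m) U \<theta>"
    by (rule theta_branch_exists[OF T_continuous])
next
  fix U \<Theta> assume br: "\<forall>n m. theta_branch (T n m) (U n m) (\<Theta> n m)"
  show "potential_mKdV_on (U n m) (\<Theta> n m)" for n m
    by (rule potential_mKdV_theta[OF _ T_derivs(1-3,6) eq_xx eq_xxx_t]) (use br in blast)
  show "discrete_potential_mKdV a b U \<Theta>"
    unfolding discrete_potential_mKdV_def
  proof (intro allI impI)
    fix n m x y t
    assume P: "(x, y, t) \<in> U n m \<inter> U (n + 1) m \<inter> U n (m + 1) \<inter> U (n + 1) (m + 1)"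
    have polar: "\<exists>r. r \<noteq> 0 \<and> T n m x y t = complex_of_real r * cis (\<Theta> n m x y t / 4)" if "(x, y, t) \<in> U n m" for n m
      using theta_branch_polar[of "T n m" "U n m" "\<Theta> n m", OF _ that] br by metis
    obtain r00 r10 r01 r11 where r: "r00 \<noteq> 0" "T n m x y t = complex_of_real r00 * cis (\<Theta> n m x y t / 4)"
      "r10 \<noteq> 0" "T (n + 1) m x y t = complex_of_real r10 * cis (\<Theta> (n + 1) m x y t / 4)"
      "r01 \<noteq> 0" "T n (m + 1) x y t = complex_of_real r01 * cis (\<Theta> n (m + 1) x y t / 4)"
      "r11 \<noteq> 0" "T (n + 1) (m + 1) x y t = complex_of_real r11 * cis (\<Theta> (n + 1) (m + 1) x y t / 4)"
      using polar[of n m] polar[of "n + 1" m] polar[of n "m + 1"] polar[of "n + 1" "m + 1"] P by auto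
    show "tan_equation (b m) (a n) ((\<Theta> (n + 1) (m + 1) x y t - \<Theta> n m x y t) / 4)
       ((\<Theta> n (m + 1) x y t - \<Theta> (n + 1) m x y t) / 4)"
      by (rule discrete_mKdV_theta[OF eq_lattice r(2,6,4,8) r(1,5,3,7) assms])
  qed
qed

end

theorem proposition5p1:
  fixes a b :: "int \<Rightarrow> real" and N :: nat and p \<alpha> \<beta> :: "nat \<Rightarrow> complex"
  assumes "\<And>n. a n \<noteq> 0" and "\<And>m. b m \<noteq> 0" and "\<And>n m. a n \<noteq> b m"
    and "\<And>i. i \<in> {1..N} \<Longrightarrow> p i \<noteq> 0"
    and "\<And>i n. i \<in> {1..N} \<Longrightarrow>
      1 + of_real (a n) * p i \<noteq> 0 \<and> 1 - of_real (a n) * p i \<noteq> 0"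
    and "\<And>i m. i \<in> {1..N} \<Longrightarrow>
      1 + of_real (b m) * p i \<noteq> 0 \<and> 1 - of_real (b m) * p i \<noteq> 0"
  shows
    "((\<forall>i\<in>{1..N}. p i \<in> \<real> \<and> \<alpha> i \<in> \<real> \<and> (\<exists>r. \<beta> i = \<i> * complex_of_real r)) \<longrightarrow>
        bilinear_equations a b (tau a b N p \<alpha> \<beta>) \<and>
        gives_mKdV_solutions a b (tau a b N p \<alpha> \<beta>)) \<and>
     (\<forall>M. N = 2 * M \<and>
        (\<forall>k\<in>{1..M}. p (2 * k) = cnj (p (2 * k - 1)) \<and> \<alpha> (2 * k) = cnj (\<alpha> (2 * k - 1)) \<and>
           \<beta> (2 * k) = - cnj (\<beta> (2 * k - 1))) \<longrightarrow>
        bilinear_equations a b (tau a b N p \<alpha> \<beta>) \<and>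
        gives_mKdV_solutions a b (tau a b N p \<alpha> \<beta>))"
proof -
  have main: "bilinear_equations a b (tau a b N p \<alpha> \<beta>) \<and> gives_mKdV_solutions a b (tau a b N p \<alpha> \<beta>)"
    if \<sigma>: "\<sigma> permutes {0..<N}" and conj: "\<And>i. i < N \<Longrightarrow> cnj (p (Suc i)) = p (Suc (\<sigma> i)) \<and>
      cnj (\<alpha> (Suc i)) = \<alpha> (Suc (\<sigma> i)) \<and> cnj (\<beta> (Suc i)) = - \<beta> (Suc (\<sigma> i))" for \<sigma>
  proof -
    interpret tau_family N "\<lambda>i. p (Suc i)" a b "base_eta a b N p \<alpha>" "base_eta (\<lambda>k. - a k) (\<lambda>k. - b k) N p \<beta>"
      "\<lambda>n m. intsum a n + intsum b m" "tau a b N p \<alpha> \<beta>" "signof \<sigma>"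
      using assms(4-6) \<sigma> conj by (intro tau_family_tau) blast+
    show ?thesis using bilinear solutions[OF assms(3)] by simp
  qed
  show ?thesis
  proof (intro conjI impI allI)
    assume real: "\<forall>i\<in>{1..N}. p i \<in> \<real> \<and> \<alpha> i \<in> \<real> \<and> (\<exists>r. \<beta> i = \<i> * complex_of_real r)"
    have "bilinear_equations a b (tau a b N p \<alpha> \<beta>) \<and> gives_mKdV_solutions a b (tau a b N p \<alpha> \<beta>)"
    proof (rule main[of id])
      fix i assume "i < N"
      then have "p (Suc i) \<in> \<real> \<and> \<alpha> (Suc i) \<in> \<real> \<and> (\<exists>r. \<beta> (Suc i) = \<i> * complex_of_real r)" using real by simp
      then show "cnj (p (Suc i)) = p (Suc (id i)) \<and> cnj (\<alpha> (Suc i)) = \<alpha> (Suc (id i)) \<and>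
          cnj (\<beta> (Suc i)) = - \<beta> (Suc (id i))"
        by (auto simp: Reals_cnj_iff)
    qed (rule permutes_id)
    then show "bilinear_equations a b (tau a b N p \<alpha> \<beta>)" "gives_mKdV_solutions a b (tau a b N p \<alpha> \<beta>)" by auto
  next
    fix M assume pairs: "N = 2 * M \<and> (\<forall>k\<in>{1..M}. p (2 * k) = cnj (p (2 * k - 1)) \<and> \<alpha> (2 * k) = cnj (\<alpha> (2 * k - 1)) \<and>
           \<beta> (2 * k) = - cnj (\<beta> (2 * k - 1)))"
    have "bilinear_equations a b (tau a b N p \<alpha> \<beta>) \<and> gives_mKdV_solutions a b (tau a b N p \<alpha> \<beta>)"
    proof (rule main[of "pair_swap N"])
      show "pair_swap N permutes {0..<N}" using pairs by (intro pair_swap_permutes) simp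
      fix i assume i: "i < N"
      \<comment> \<open>Row i counts from 0, so it belongs to the pair of parameters 2 k + 1 and 2 k
        + 2, which is pair number \<open>Suc k\<close> in the assumption.\<close>
      define k where "k = i div 2"
      have k: "Suc k \<in> {1..M}" using i pairs by (auto simp: k_def)
      have ps: "p (2 * k + 2) = cnj (p (2 * k + 1))" "\<alpha> (2 * k + 2) = cnj (\<alpha> (2 * k + 1))"
        "\<beta> (2 * k + 2) = - cnj (\<beta> (2 * k + 1))"
        using pairs k by (auto dest!: bspec[of _ _ "Suc k"])
      consider "i = 2 * k" | "i = 2 * k + 1" unfolding k_def by linarith
      then show "cnj (p (Suc i)) = p (Suc (pair_swap N i)) \<and> cnj (\<alpha> (Suc i)) = \<alpha> (Suc (pair_swap N i)) \<and>
          cnj (\<beta> (Suc i)) = - \<beta> (Suc (pair_swap N i))"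
        using ps i by cases (simp_all add: pair_swap_def)
    qed
    then show "bilinear_equations a b (tau a b N p \<alpha> \<beta>)" "gives_mKdV_solutions a b (tau a b N p \<alpha> \<beta>)" by auto
  qed
qed

end
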